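(* Fix $n\ge 2$. Let $K$ be the generator of the algebra $\mathcal K_p$, with $p(K)=-K^{n+1}+A_0K^n+A_1K^{n-1}+\ldots+A_n$, where $A_0,\dots,A_n\in\mathfrak z$. Define $\phi_0(\xi,x):=1$ and $\phi_{i+1}(\xi,x):=\phi_i(\xi,x)\,\xi x-A_i$. Then the element $$K(x):=\sum_{i=0}^{n-1}\phi_i(\xi,x)K^{n-i}+\frac{\zeta-x^{-1}\phi_n(\xi,x)}{x-x^{-1}}\in\mathcal K_p(x)$$ is a principal solution to the reflection equation with spectral parameter $$R\Bigl(\frac xy\Bigr)K(x)R(xy)K(y)=K(y)R(xy)K(x)R\Bigl(\frac xy\Bigr)$$ for any pair $\xi,\zeta\in\mathfrak z$ such that $\zeta\xi=p(0)$ (that is, $\zeta\xi=A_n$).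
   Context: $k$ is a field of characteristic zero, $\mathfrak z$ is a commutative unital $k$-algebra, $q\in k$ is invertible with $q\ne\pm1$, and $\omega:=q-q^{-1}$. The affine Hecke algebra (of rank one) $\mathcal H$ is the unital associative $\mathfrak z$-algebra generated by $R,K$ with relations $R^2=\omega R+1$ and $RKRK=KRKR$; thus $R^{-1}=R-\omega$. For the polynomial $p$ with coefficients in $\mathfrak z$, $\mathcal H_p$ is the quotient of $\mathcal H$ by the two-sided ideal generated by $p(K)$, and $\mathcal K_p\subset\mathcal H_p$ is the $\mathfrak z$-subalgebra generated by $K$; one has $\mathcal K_p\simeq\mathfrak z[u]/(p(u))$ via $K\leftrightarrow u$. For a $k$-module $B$ put $B(x):=B\otimes_k k(x)$ and $B(x,y):=B\otimes_k k(x,y)$. Put $R(x):=R-x^{-1}R^{-1}$. The reflection equation with spectral parameter is considered in $\mathcal H_p(x,y)$, with the unknown $K(x)\in\mathcal K_p(x)$. For $n>1$ put $\tilde K:=K^n-A_0K^{n-1}-\ldots-A_{n-1}\in\mathcal K_p$; it satisfies $K\tilde K=A_n$, and $\{K^i\}_{i=0}^{n-1}\cup\{\tilde K\}$ is a basis of $\mathcal K_p$ over $\mathfrak z$. A solution is called principal if either $n=1$, or $n>1$ and the coefficient of $K^{n-1}$ in its expansion over this basis is non-zero; otherwise it is called small.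
   Formalization: K(x) is shown to be a solution for every pair with ζξ = A_n, but principal only when ξ ≠ 0: the coefficient of K^{n-1} in the given basis is ξx, so for ξ = 0 (possible when A_n = 0) the solution is small and the claim as stated fails. *)

theory Defs
  imports
    "HOL-Algebra.Algebraic_Closure_Type"
    "HOL-Algebra.Generated_Rings"
    "HOL-Algebra.QuotRing"
    "HOL-Library.FuncSet"
    "HOL-Library.Poly_Mapping"
    "HOL-Computational_Algebra.Polynomial"
    "HOL-Computational_Algebra.Fraction_Field"
begin

section \<open>The free algebra on two letters\<close>

datatype gen = GenR | GenK

datatype gen_word = Word (letters: "gen list")

text \<open>Words form the free monoid under concatenation, written additively because this is the
  monoid notation \<^typ>\<open>'a \<Rightarrow>\<^sub>0 'b\<close> expects; \<open>gen_word \<Rightarrow>\<^sub>0 'z\<close>, with its library ring structure,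
  is then the free unital associative algebra over \<open>'z\<close> on the letters \<open>R\<close> and \<open>K\<close>.\<close>

instantiation gen_word :: monoid_add
begin

definition zero_gen_word :: gen_word where
  "0 = Word []"

definition plus_gen_word :: "gen_word \<Rightarrow> gen_word \<Rightarrow> gen_word" where
  "v + w = Word (letters v @ letters w)"

instance
  by standard (simp_all add: zero_gen_word_def plus_gen_word_def)

end

abbreviation free_ring :: "(gen_word \<Rightarrow>\<^sub>0 'z::comm_ring_1) ring" where
  "free_ring \<equiv> ring_of_type_algebra"

definition letter :: "gen \<Rightarrow> gen_word \<Rightarrow>\<^sub>0 'z::comm_ring_1" where
  "letter g = Poly_Mapping.single (Word [g]) 1"

definition scalar :: "'z::comm_ring_1 \<Rightarrow> gen_word \<Rightarrow>\<^sub>0 'z" where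
  "scalar c = Poly_Mapping.single 0 c"


section \<open>The affine Hecke algebra, its quotient, and the subalgebra generated by \<open>K\<close>\<close>

text \<open>The argument \<open>w\<close> is the image of \<open>\<omega> = q - q\<inverse>\<close> in \<open>'z\<close>. The library's
  \<^const>\<open>ideal\<close> and \<^const>\<open>genideal\<close> are two-sided.\<close>

definition hecke_ideal :: "'z::comm_ring_1 \<Rightarrow> (gen_word \<Rightarrow>\<^sub>0 'z) set" where
  "hecke_ideal w = genideal free_ring
     {letter GenR * letter GenR - (scalar w * letter GenR + 1),
      letter GenR * letter GenK * letter GenR * letter GenK
        - letter GenK * letter GenR * letter GenK * letter GenR}"

definition hecke :: "'z::comm_ring_1 \<Rightarrow> (gen_word \<Rightarrow>\<^sub>0 'z) set ring" where
  "hecke w = free_ring Quot hecke_ideal w"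

definition hecke_of :: "'z::comm_ring_1 \<Rightarrow> (gen_word \<Rightarrow>\<^sub>0 'z) \<Rightarrow> (gen_word \<Rightarrow>\<^sub>0 'z) set" where
  "hecke_of w f = hecke_ideal w +>\<^bsub>free_ring\<^esub> f"

definition cyc_poly :: "nat \<Rightarrow> (nat \<Rightarrow> 'z::comm_ring_1) \<Rightarrow> 'z poly" where
  "cyc_poly n A = - monom 1 (n + 1) + (\<Sum>i\<le>n. monom (A i) (n - i))"

definition eval_K :: "'z::comm_ring_1 poly \<Rightarrow> gen_word \<Rightarrow>\<^sub>0 'z" where
  "eval_K p = (\<Sum>i\<le>degree p. scalar (coeff p i) * letter GenK ^ i)"

definition hecke_p_ideal ::
  "'z::comm_ring_1 \<Rightarrow> 'z poly \<Rightarrow> (gen_word \<Rightarrow>\<^sub>0 'z) set set" where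
  "hecke_p_ideal w p = genideal (hecke w) {hecke_of w (eval_K p)}"

definition hecke_p :: "'z::comm_ring_1 \<Rightarrow> 'z poly \<Rightarrow> (gen_word \<Rightarrow>\<^sub>0 'z) set set ring" where
  "hecke_p w p = hecke w Quot hecke_p_ideal w p"

definition hecke_p_of ::
  "'z::comm_ring_1 \<Rightarrow> 'z poly \<Rightarrow> (gen_word \<Rightarrow>\<^sub>0 'z) \<Rightarrow> (gen_word \<Rightarrow>\<^sub>0 'z) set set" where
  "hecke_p_of w p f = hecke_p_ideal w p +>\<^bsub>hecke w\<^esub> hecke_of w f"

abbreviation scalar_p :: "'z::comm_ring_1 \<Rightarrow> 'z poly \<Rightarrow> 'z \<Rightarrow> (gen_word \<Rightarrow>\<^sub>0 'z) set set" where
  "scalar_p w p c \<equiv> hecke_p_of w p (scalar c)"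

abbreviation R_p :: "'z::comm_ring_1 \<Rightarrow> 'z poly \<Rightarrow> (gen_word \<Rightarrow>\<^sub>0 'z) set set" where
  "R_p w p \<equiv> hecke_p_of w p (letter GenR)"

abbreviation K_p :: "'z::comm_ring_1 \<Rightarrow> 'z poly \<Rightarrow> (gen_word \<Rightarrow>\<^sub>0 'z) set set" where
  "K_p w p \<equiv> hecke_p_of w p (letter GenK)"

text \<open>A \<open>'z\<close>-subalgebra is a subring containing the scalars.\<close>

definition alg_K :: "'z::comm_ring_1 \<Rightarrow> 'z poly \<Rightarrow> (gen_word \<Rightarrow>\<^sub>0 'z) set set ring" where
  "alg_K w p = (hecke_p w p)
     \<lparr>carrier := generate_ring (hecke_p w p) (insert (K_p w p) (range (scalar_p w p)))\<rparr>"


section \<open>Tensor products of algebras\<close>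

text \<open>\<open>A \<otimes>\<^sub>k L\<close> is the group of formal integer combinations of pairs in \<open>A \<times> L\<close>, multiplied
  by \<open>(a, l)(b, m) = (ab, lm)\<close>, modulo the bilinearity relations. The \<open>k\<close>-algebra structures are
  the maps \<open>\<alpha> : k \<rightarrow> A\<close> and \<open>\<beta> : k \<rightarrow> L\<close>. Since pairs multiply relations into relations,
  the ideal generated by the relations is the subgroup they generate.\<close>

definition formal_sums :: "('a, 'm) ring_scheme \<Rightarrow> (('a \<times> 'l::comm_ring_1) \<Rightarrow>\<^sub>0 int) ring" where
  "formal_sums A =
    \<lparr>carrier = {f. Poly_Mapping.keys f \<subseteq> carrier A \<times> UNIV},
     monoid.mult = (\<lambda>f g. \<Sum>u\<in>Poly_Mapping.keys f. \<Sum>v\<in>Poly_Mapping.keys g.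
               Poly_Mapping.single (fst u \<otimes>\<^bsub>A\<^esub> fst v, snd u * snd v)
                 (Poly_Mapping.lookup f u * Poly_Mapping.lookup g v)),
     one = Poly_Mapping.single (\<one>\<^bsub>A\<^esub>, 1) 1,
     zero = 0,
     add = (+)\<rparr>"

abbreviation formal_pair :: "'a \<Rightarrow> 'l \<Rightarrow> ('a \<times> 'l) \<Rightarrow>\<^sub>0 int" where
  "formal_pair a l \<equiv> Poly_Mapping.single (a, l) 1"

definition tensor_relations ::
  "('a, 'm) ring_scheme \<Rightarrow> ('k \<Rightarrow> 'a) \<Rightarrow> ('k \<Rightarrow> 'l::comm_ring_1) \<Rightarrow> (('a \<times> 'l) \<Rightarrow>\<^sub>0 int) set" where
  "tensor_relations A \<alpha> \<beta> =
     {formal_pair (a \<oplus>\<^bsub>A\<^esub> b) l - (formal_pair a l + formal_pair b l) | a b l.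
        a \<in> carrier A \<and> b \<in> carrier A}
   \<union> {formal_pair a (l + m) - (formal_pair a l + formal_pair a m) | a l m. a \<in> carrier A}
   \<union> {formal_pair (\<alpha> c \<otimes>\<^bsub>A\<^esub> a) l - formal_pair a (\<beta> c * l) | a c l. a \<in> carrier A}"

definition tensor_ideal ::
  "('a, 'm) ring_scheme \<Rightarrow> ('k \<Rightarrow> 'a) \<Rightarrow> ('k \<Rightarrow> 'l::comm_ring_1) \<Rightarrow> (('a \<times> 'l) \<Rightarrow>\<^sub>0 int) set" where
  "tensor_ideal A \<alpha> \<beta> = genideal (formal_sums A) (tensor_relations A \<alpha> \<beta>)"

definition tensor_alg ::
  "('a, 'm) ring_scheme \<Rightarrow> ('k \<Rightarrow> 'a) \<Rightarrow> ('k \<Rightarrow> 'l::comm_ring_1) \<Rightarrow> (('a \<times> 'l) \<Rightarrow>\<^sub>0 int) set ring" where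
  "tensor_alg A \<alpha> \<beta> = formal_sums A Quot tensor_ideal A \<alpha> \<beta>"

definition tensor_elem ::
  "('a, 'm) ring_scheme \<Rightarrow> ('k \<Rightarrow> 'a) \<Rightarrow> ('k \<Rightarrow> 'l::comm_ring_1) \<Rightarrow> 'a \<Rightarrow> 'l
     \<Rightarrow> (('a \<times> 'l) \<Rightarrow>\<^sub>0 int) set" where
  "tensor_elem A \<alpha> \<beta> a l = tensor_ideal A \<alpha> \<beta> +>\<^bsub>formal_sums A\<^esub> formal_pair a l"

text \<open>\<open>f \<otimes> g\<close>, with target \<open>A' \<otimes>\<^sub>k L'\<close>. For \<open>k\<close>-linear \<open>f\<close> and \<open>g\<close> the cosets in the union
  below all coincide.\<close>

definition tensor_map ::
  "('b, 'm) ring_scheme \<Rightarrow> ('k \<Rightarrow> 'b) \<Rightarrow> ('k \<Rightarrow> 'l'::comm_ring_1) \<Rightarrow> ('a \<Rightarrow> 'b) \<Rightarrow> ('l \<Rightarrow> 'l')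
     \<Rightarrow> (('a \<times> 'l) \<Rightarrow>\<^sub>0 int) set \<Rightarrow> (('b \<times> 'l') \<Rightarrow>\<^sub>0 int) set" where
  "tensor_map A' \<alpha>' \<beta>' f g T =
     (\<Union>s\<in>T. tensor_ideal A' \<alpha>' \<beta>' +>\<^bsub>formal_sums A'\<^esub>
        (\<Sum>u\<in>Poly_Mapping.keys s.
           Poly_Mapping.single (f (fst u), g (snd u)) (Poly_Mapping.lookup s u)))"


section \<open>Rational functions\<close>

text \<open>\<open>k(x)\<close> is \<open>'k poly fract\<close>. \<open>k(x,y)\<close> is the fraction field of \<open>k[x][y]\<close>, that is
  \<open>'k poly poly fract\<close>, with \<open>y\<close> the outer variable.\<close>

definition const_x :: "'k::field \<Rightarrow> 'k poly fract" where
  "const_x c = Fract [:c:] 1"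

definition var_x :: "'k::field poly fract" where
  "var_x = Fract [:0, 1:] 1"

definition const_xy :: "'k::field \<Rightarrow> 'k poly poly fract" where
  "const_xy c = Fract [:[:c:]:] 1"

definition x_xy :: "'k::field poly poly fract" where
  "x_xy = Fract [:[:0, 1:]:] 1"

definition y_xy :: "'k::field poly poly fract" where
  "y_xy = Fract [:0, 1:] 1"

text \<open>The substitution \<open>r(x) \<mapsto> r(t)\<close> from \<open>k(x)\<close> to \<open>k(x,y)\<close>, for \<open>t\<close> transcendental over \<open>k\<close>.\<close>

definition rat_subst :: "'k::field poly poly fract \<Rightarrow> 'k poly fract \<Rightarrow> 'k poly poly fract" where
  "rat_subst t r = (THE v. \<exists>a b. r = Fract a b \<and> b \<noteq> 0 \<and> poly (map_poly const_xy b) t \<noteq> 0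
     \<and> v = poly (map_poly const_xy a) t / poly (map_poly const_xy b) t)"


section \<open>Base change to rational functions\<close>

text \<open>Throughout, \<open>\<iota> : k \<rightarrow> 'z\<close> is the \<open>k\<close>-algebra structure of \<open>'z\<close>.\<close>

abbreviation (input) base_x ::
  "('k::field \<Rightarrow> 'z::comm_ring_1) \<Rightarrow> (('z \<times> 'k poly fract) \<Rightarrow>\<^sub>0 int) set ring" where
  "base_x \<iota> \<equiv> tensor_alg ring_of_type_algebra \<iota> const_x"

abbreviation (input) base_elem ::
  "('k::field \<Rightarrow> 'z::comm_ring_1) \<Rightarrow> 'z \<Rightarrow> 'k poly fract \<Rightarrow> (('z \<times> 'k poly fract) \<Rightarrow>\<^sub>0 int) set" where
  "base_elem \<iota> \<equiv> tensor_elem ring_of_type_algebra \<iota> const_x"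

definition hecke_p_x ::
  "('k::field \<Rightarrow> 'z::comm_ring_1) \<Rightarrow> 'z \<Rightarrow> 'z poly
     \<Rightarrow> (((gen_word \<Rightarrow>\<^sub>0 'z) set set \<times> 'k poly fract) \<Rightarrow>\<^sub>0 int) set ring" where
  "hecke_p_x \<iota> w p = tensor_alg (hecke_p w p) (\<lambda>c. scalar_p w p (\<iota> c)) const_x"

definition hecke_p_xy ::
  "('k::field \<Rightarrow> 'z::comm_ring_1) \<Rightarrow> 'z \<Rightarrow> 'z poly
     \<Rightarrow> (((gen_word \<Rightarrow>\<^sub>0 'z) set set \<times> 'k poly poly fract) \<Rightarrow>\<^sub>0 int) set ring" where
  "hecke_p_xy \<iota> w p = tensor_alg (hecke_p w p) (\<lambda>c. scalar_p w p (\<iota> c)) const_xy"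

definition alg_K_x ::
  "('k::field \<Rightarrow> 'z::comm_ring_1) \<Rightarrow> 'z \<Rightarrow> 'z poly
     \<Rightarrow> (((gen_word \<Rightarrow>\<^sub>0 'z) set set \<times> 'k poly fract) \<Rightarrow>\<^sub>0 int) set ring" where
  "alg_K_x \<iota> w p = tensor_alg (alg_K w p) (\<lambda>c. scalar_p w p (\<iota> c)) const_x"

text \<open>\<open>T(x) \<mapsto> T(t)\<close>, from \<open>\<H>\<^sub>p(x)\<close> to \<open>\<H>\<^sub>p(x,y)\<close>. The same formula also serves on \<open>\<K>\<^sub>p(x)\<close>,
  where it includes the composition with the inclusion of \<open>\<K>\<^sub>p\<close> in \<open>\<H>\<^sub>p\<close>.\<close>

definition spec_subst ::
  "('k::field \<Rightarrow> 'z::comm_ring_1) \<Rightarrow> 'z \<Rightarrow> 'z poly \<Rightarrow> 'k poly poly fract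
     \<Rightarrow> (((gen_word \<Rightarrow>\<^sub>0 'z) set set \<times> 'k poly fract) \<Rightarrow>\<^sub>0 int) set
     \<Rightarrow> (((gen_word \<Rightarrow>\<^sub>0 'z) set set \<times> 'k poly poly fract) \<Rightarrow>\<^sub>0 int) set" where
  "spec_subst \<iota> w p t =
     tensor_map (hecke_p w p) (\<lambda>c. scalar_p w p (\<iota> c)) const_xy id (rat_subst t)"

text \<open>The \<open>\<zz>(x)\<close>-algebra structure of \<open>\<K>\<^sub>p(x)\<close>.\<close>

definition scalar_x ::
  "('k::field \<Rightarrow> 'z::comm_ring_1) \<Rightarrow> 'z \<Rightarrow> 'z poly \<Rightarrow> (('z \<times> 'k poly fract) \<Rightarrow>\<^sub>0 int) set
     \<Rightarrow> (((gen_word \<Rightarrow>\<^sub>0 'z) set set \<times> 'k poly fract) \<Rightarrow>\<^sub>0 int) set" where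
  "scalar_x \<iota> w p =
     tensor_map (alg_K w p) (\<lambda>c. scalar_p w p (\<iota> c)) const_x (scalar_p w p) id"

definition alg_K_elem ::
  "('k::field \<Rightarrow> 'z::comm_ring_1) \<Rightarrow> 'z \<Rightarrow> 'z poly \<Rightarrow> (gen_word \<Rightarrow>\<^sub>0 'z) set set
     \<Rightarrow> (((gen_word \<Rightarrow>\<^sub>0 'z) set set \<times> 'k poly fract) \<Rightarrow>\<^sub>0 int) set" where
  "alg_K_elem \<iota> w p a = tensor_elem (alg_K w p) (\<lambda>c. scalar_p w p (\<iota> c)) const_x a 1"


section \<open>The reflection equation with spectral parameter\<close>

definition R_x ::
  "('k::field \<Rightarrow> 'z::comm_ring_1) \<Rightarrow> 'z \<Rightarrow> 'z poly
     \<Rightarrow> (((gen_word \<Rightarrow>\<^sub>0 'z) set set \<times> 'k poly fract) \<Rightarrow>\<^sub>0 int) set" where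
  "R_x \<iota> w p =
     (let el = tensor_elem (hecke_p w p) (\<lambda>c. scalar_p w p (\<iota> c)) const_x
      in el (R_p w p) 1 \<ominus>\<^bsub>hecke_p_x \<iota> w p\<^esub> el (inv\<^bsub>hecke_p w p\<^esub> R_p w p) (inverse var_x))"

definition is_solution ::
  "('k::field \<Rightarrow> 'z::comm_ring_1) \<Rightarrow> 'z \<Rightarrow> 'z poly
     \<Rightarrow> (((gen_word \<Rightarrow>\<^sub>0 'z) set set \<times> 'k poly fract) \<Rightarrow>\<^sub>0 int) set \<Rightarrow> bool" where
  "is_solution \<iota> w p T \<longleftrightarrow>
     T \<in> carrier (alg_K_x \<iota> w p) \<and>
     (let R = (\<lambda>t. spec_subst \<iota> w p t (R_x \<iota> w p));
          K = (\<lambda>t. spec_subst \<iota> w p t T)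
      in R (x_xy / y_xy) \<otimes>\<^bsub>hecke_p_xy \<iota> w p\<^esub> K x_xy
           \<otimes>\<^bsub>hecke_p_xy \<iota> w p\<^esub> R (x_xy * y_xy) \<otimes>\<^bsub>hecke_p_xy \<iota> w p\<^esub> K y_xy
       = K y_xy \<otimes>\<^bsub>hecke_p_xy \<iota> w p\<^esub> R (x_xy * y_xy)
           \<otimes>\<^bsub>hecke_p_xy \<iota> w p\<^esub> K x_xy \<otimes>\<^bsub>hecke_p_xy \<iota> w p\<^esub> R (x_xy / y_xy))"


section \<open>Principal solutions\<close>

text \<open>The basis \<open>1, K, \<dots>, K\<^bsup>n-1\<^esup>, K\<^sup>~\<close>, where \<open>K\<^sup>~\<close> has index \<open>n\<close>. Because it is a basis of
  \<open>\<K>\<^sub>p\<close> over \<open>\<zz>\<close>, the family of coefficients over \<open>\<zz>(x)\<close> in \<open>K_coeffs\<close> exists and is unique.\<close>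

definition K_basis ::
  "'z::comm_ring_1 \<Rightarrow> nat \<Rightarrow> (nat \<Rightarrow> 'z) \<Rightarrow> nat \<Rightarrow> (gen_word \<Rightarrow>\<^sub>0 'z) set set" where
  "K_basis w n A i = hecke_p_of w (cyc_poly n A)
     (if i < n then letter GenK ^ i
      else letter GenK ^ n - (\<Sum>j<n. scalar (A j) * letter GenK ^ (n - 1 - j)))"

definition K_coeffs ::
  "('k::field \<Rightarrow> 'z::comm_ring_1) \<Rightarrow> 'z \<Rightarrow> nat \<Rightarrow> (nat \<Rightarrow> 'z)
     \<Rightarrow> (((gen_word \<Rightarrow>\<^sub>0 'z) set set \<times> 'k poly fract) \<Rightarrow>\<^sub>0 int) set
     \<Rightarrow> nat \<Rightarrow> (('z \<times> 'k poly fract) \<Rightarrow>\<^sub>0 int) set" where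
  "K_coeffs \<iota> w n A T =
     (THE c. c \<in> {..n} \<rightarrow>\<^sub>E carrier (base_x \<iota>) \<and>
        T = (\<Oplus>\<^bsub>alg_K_x \<iota> w (cyc_poly n A)\<^esub> i\<in>{..n}.
               scalar_x \<iota> w (cyc_poly n A) (c i)
                 \<otimes>\<^bsub>alg_K_x \<iota> w (cyc_poly n A)\<^esub>
               alg_K_elem \<iota> w (cyc_poly n A) (K_basis w n A i)))"

definition is_principal_solution ::
  "('k::field \<Rightarrow> 'z::comm_ring_1) \<Rightarrow> 'z \<Rightarrow> nat \<Rightarrow> (nat \<Rightarrow> 'z)
     \<Rightarrow> (((gen_word \<Rightarrow>\<^sub>0 'z) set set \<times> 'k poly fract) \<Rightarrow>\<^sub>0 int) set \<Rightarrow> bool" where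
  "is_principal_solution \<iota> w n A T \<longleftrightarrow>
     is_solution \<iota> w (cyc_poly n A) T \<and>
     (n = 1 \<or> (n > 1 \<and> K_coeffs \<iota> w n A T (n - 1) \<noteq> \<zero>\<^bsub>base_x \<iota>\<^esub>))"


section \<open>The element \<open>K(x)\<close>\<close>

primrec phi ::
  "('k::field \<Rightarrow> 'z::comm_ring_1) \<Rightarrow> (nat \<Rightarrow> 'z) \<Rightarrow> 'z \<Rightarrow> nat
     \<Rightarrow> (('z \<times> 'k poly fract) \<Rightarrow>\<^sub>0 int) set" where
  "phi \<iota> A \<xi> 0 = \<one>\<^bsub>base_x \<iota>\<^esub>"
| "phi \<iota> A \<xi> (Suc i) =
     (phi \<iota> A \<xi> i \<otimes>\<^bsub>base_x \<iota>\<^esub> base_elem \<iota> \<xi> var_x) \<ominus>\<^bsub>base_x \<iota>\<^esub> base_elem \<iota> (A i) 1"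

definition K_x ::
  "('k::field \<Rightarrow> 'z::comm_ring_1) \<Rightarrow> 'z \<Rightarrow> nat \<Rightarrow> (nat \<Rightarrow> 'z) \<Rightarrow> 'z \<Rightarrow> 'z
     \<Rightarrow> (((gen_word \<Rightarrow>\<^sub>0 'z) set set \<times> 'k poly fract) \<Rightarrow>\<^sub>0 int) set" where
  "K_x \<iota> w n A \<xi> \<zeta> =
     (let p = cyc_poly n A in
      (\<Oplus>\<^bsub>alg_K_x \<iota> w p\<^esub> i\<in>{0..<n}.
         scalar_x \<iota> w p (phi \<iota> A \<xi> i)
           \<otimes>\<^bsub>alg_K_x \<iota> w p\<^esub> alg_K_elem \<iota> w p (K_p w p [^]\<^bsub>alg_K w p\<^esub> (n - i)))
      \<oplus>\<^bsub>alg_K_x \<iota> w p\<^esub>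
      scalar_x \<iota> w p
        ((base_elem \<iota> \<zeta> 1 \<ominus>\<^bsub>base_x \<iota>\<^esub>
            (base_elem \<iota> 1 (inverse var_x) \<otimes>\<^bsub>base_x \<iota>\<^esub> phi \<iota> A \<xi> n))
         \<otimes>\<^bsub>base_x \<iota>\<^esub> base_elem \<iota> 1 (inverse (var_x - inverse var_x))))"

end

theory Submission
  imports Defs "HOL-Library.Product_Plus"
begin

text \<open>Let \<open>P = -p\<close>, and let \<open>G\<^sub>x(u) = (P(u) - P(\<xi>x)) / (u - \<xi>x)\<close>, whose coefficients are the
  \<open>\<phi>\<^sub>i(\<xi>, x)\<close>. The condition \<open>\<zeta>\<xi> = p(0)\<close> gives \<open>P(\<xi>x) = -\<xi>\<psi>\<^sub>x\<close> with \<open>\<psi>\<^sub>x = \<zeta> - x\<phi>\<^sub>n\<close>, and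
  \<open>K(x) = G\<^sub>x(K) + \<psi>\<^sub>x / (x - x\<inverse>)\<close>. If \<open>\<psi>\<^sub>x\<close> and \<open>K - \<xi>x\<close> were invertible, \<open>K(x)\<close> would be
  proportional to \<open>(K - \<xi>x\<inverse>)(K - \<xi>x)\<inverse>\<close>; since they need not be, everything is derived from polynomial
  identities without division.

  The Hecke relations yield a formula for \<open>R f(K) R g(K) - g(K) R f(K) R\<close> as a combination of the
  \<open>K\<^sup>i R K\<^sup>j\<close>. For \<open>f = G\<^sub>x\<close> and \<open>g = G\<^sub>y\<close>, modulo \<open>P\<close>, it becomes an expression in the
  commutators of \<open>R\<close> with \<open>G\<^sub>x\<close>, \<open>G\<^sub>y\<close> and in \<open>G\<^sub>x R G\<^sub>y - G\<^sub>y R G\<^sub>x\<close>. Together with the resolvent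
  identity \<open>(y - x) G\<^sub>x G\<^sub>y = \<psi>\<^sub>x G\<^sub>y - \<psi>\<^sub>y G\<^sub>x\<close> this is exactly the reflection equation after clearing
  denominators.

  Let \<open>R\<close> act on \<open>\<zz>[u]/(p)\<close> as the scalar \<open>q\<close>. This shows that the \<open>K\<^sup>i\<close> with \<open>i \<le> n\<close> are independent
  over \<open>\<zz>(x)\<close>, and the coefficient of \<open>K\<^sup>n\<^sup>-\<^sup>1\<close> comes out as \<open>\<phi>\<^sub>1 + A\<^sub>0 = \<xi>x\<close>.\<close>

section \<open>The commutation relation\<close>

text \<open>The polynomial identities hold over any commutative ring, with \<open>x\<close> and
  \<open>y\<close> arbitrary elements, so neither \<open>\<xi>\<close> nor \<open>x - y\<close> may
  be cancelled. The factor \<open>x - y\<close> is carried along: it is the coefficient of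
  \<open>R\<close> in x R(x/y), so the reflection equation supplies it. Division by
  \<open>\<xi>\<close> is avoided because (G_x - G_x(0)) / u is again a polynomial and G_y - G_x is
  an explicit multiple of \<open>\<xi>\<close> in terms of these quotients.

  Writing elements as combinations of K^i R K^j turns the noncommutative problem into one about
  commutative polynomials in u and v, where multiples of P(u) and of P(v) may be dropped
  independently.

  Quotients and tensor products are records with carriers. Calculation is kept in types instead: in
  the free algebra over \<zz>[x, y], modulo an ideal given as a set.

  The coefficients of K(x) are fixed by a definite description, so independence is not enough: an
  expansion of K(x) must also be exhibited. That \<open>\<xi>\<close> \<otimes> x is non-zero is
  seen by a k-linear functional on k(x) with value 1 at x.\<close>

text \<open>A bivariate polynomial is an element of \<open>'c poly poly\<close> with inner variable \<open>u\<close> and outer variable \<open>v\<close>;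
  then \<open>f(u)\<close> is \<open>[:f:]\<close>, \<open>f(v)\<close> is \<open>lift_poly f\<close>, and \<open>diff_quot f\<close> is \<open>(f(v) - f(u)) / (v - u)\<close>.\<close>

definition lift_poly :: "'c::comm_ring_1 poly \<Rightarrow> 'c poly poly" where
  "lift_poly f = map_poly (\<lambda>a. [:a:]) f"

definition diff_quot :: "'c::comm_ring_1 poly \<Rightarrow> 'c poly poly" where
  "diff_quot f = synthetic_div (lift_poly f) [:0, 1:]"

lemma lift_poly_0 [simp]: "lift_poly 0 = 0"
  by (simp add: lift_poly_def)

lemma lift_poly_pCons [simp]: "lift_poly (pCons a f) = pCons [:a:] (lift_poly f)"
  by (simp add: lift_poly_def map_poly_pCons)

lemma lift_poly_1 [simp]: "lift_poly 1 = 1"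
  by (simp add: one_pCons)

lemma lift_poly_add: "lift_poly (f + g) = lift_poly f + lift_poly g"
  by (rule poly_eqI) (simp add: lift_poly_def coeff_map_poly)

lemma lift_poly_smult: "lift_poly (smult a f) = smult [:a:] (lift_poly f)"
  by (rule poly_eqI) (simp add: lift_poly_def coeff_map_poly)

lemma lift_poly_mult: "lift_poly (f * g) = lift_poly f * lift_poly g"
  by (induction f) (simp_all add: lift_poly_add lift_poly_smult)

lemma lift_poly_diff: "lift_poly (f - g) = lift_poly f - lift_poly g"
  by (rule poly_eqI) (simp add: lift_poly_def coeff_map_poly)

lemma poly_lift_poly [simp]: "poly (lift_poly f) [:0, 1:] = f"
  by (induction f) (simp_all add: mult.commute)

lemma diff_quot_correct: "[:-[:0, 1:], 1:] * diff_quot f = lift_poly f - [:f:]"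
  using synthetic_div_correct'[of "[:0, 1:]" "lift_poly f"] by (simp add: diff_quot_def algebra_simps)

lemma diff_quot_0 [simp]: "diff_quot 0 = 0"
  by (simp add: diff_quot_def)

lemma diff_quot_pCons [simp]: "diff_quot (pCons a f) = pCons f (diff_quot f)"
  by (simp add: diff_quot_def)

lemma smult_const_1 [simp]: "smult [:1:] F = (F :: 'c::comm_ring_1 poly poly)"
  using smult_1_left[of F] unfolding one_pCons[symmetric] .

lemma smult_const_minus: "smult [:- a:] F = - smult [:a:] (F :: 'c::comm_ring_1 poly poly)"
  using smult_minus_left[of "[:a:]" F] by (simp only: minus_pCons minus_zero)

text \<open>The structure map is a parameter because the calculus is used over two coefficient
  rings, \<zz> and \<zz>[x, y].\<close>

locale central_algebra =
  fixes c :: "'c::comm_ring_1 \<Rightarrow> 'a::ring_1"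
  assumes c_add: "c (s + t) = c s + c t"
    and c_mult: "c (s * t) = c s * c t"
    and c_1: "c 1 = 1"
    and c_central: "c s * a = a * c s"
begin

lemma c_0 [simp]: "c 0 = 0"
  using c_add[of 0 0] by simp

lemma c_minus: "c (- s) = - c s"
  using c_add[of s "- s"] by (simp add: eq_neg_iff_add_eq_0 add.commute)

lemma c_diff: "c (s - t) = c s - c t"
  using c_add[of s "- t"] by (simp add: c_minus)

lemma c_left_commute: "a * (c s * b) = c s * (a * b)"
  by (metis c_central mult.assoc)

definition ev :: "'a \<Rightarrow> 'c poly \<Rightarrow> 'a" where
  "ev K f = fold_coeffs (\<lambda>a r. c a + r * K) f 0"

lemma ev_0 [simp]: "ev K 0 = 0"
  by (simp add: ev_def)

lemma ev_pCons [simp]: "ev K (pCons a f) = c a + ev K f * K"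
  by (cases "f = 0 \<and> a = 0") (auto simp: ev_def)

lemma ev_add: "ev K (f + g) = ev K f + ev K g"
  by (induction f g rule: poly_induct2) (simp_all add: c_add algebra_simps)

lemma ev_smult: "ev K (smult a f) = c a * ev K f"
  by (induction f) (simp_all add: algebra_simps flip: c_mult)

lemma ev_K: "ev K f * K = K * ev K f"
  by (induction f) (simp_all add: algebra_simps c_central)

lemma ev_mult: "ev K (f * g) = ev K f * ev K g"
proof (induction f)
  case (pCons a f)
  then show ?case by (simp add: ev_add ev_smult distrib_right mult.assoc) (simp add: ev_K flip: mult.assoc)
qed simp

lemma ev_1 [simp]: "ev K 1 = 1"
  using ev_pCons[of K 1 0] by (simp add: c_1 one_pCons)

lemma ev_minus: "ev K (- f) = - ev K f"
  using ev_add[of K f "- f"] by (simp add: eq_neg_iff_add_eq_0 add.commute)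

lemma ev_diff: "ev K (f - g) = ev K f - ev K g"
  using ev_add[of K f "- g"] by (simp add: ev_minus)

lemma ev_commute: "ev K f * ev K g = ev K g * ev K f"
  by (metis ev_mult mult.commute)

lemma ev_left_commute: "ev K f * (ev K g * a) = ev K g * (ev K f * a)"
  by (metis ev_commute mult.assoc)

lemma ev_K_left: "ev K f * (K * a) = K * (ev K f * a)"
  by (metis ev_K mult.assoc)

text \<open>The substitution \<open>u\<^sup>i v\<^sup>j \<mapsto> K\<^sup>i R K\<^sup>j\<close>.\<close>

definition bimod :: "'a \<Rightarrow> 'a \<Rightarrow> 'c poly poly \<Rightarrow> 'a" where
  "bimod R K F = fold_coeffs (\<lambda>f r. ev K f * R + r * K) F 0"

lemma bimod_0 [simp]: "bimod R K 0 = 0"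
  by (simp add: bimod_def)

lemma bimod_pCons [simp]: "bimod R K (pCons f F) = ev K f * R + bimod R K F * K"
  by (cases "F = 0 \<and> f = 0") (auto simp: bimod_def)

lemma bimod_add: "bimod R K (F + G) = bimod R K F + bimod R K G"
  by (induction F G rule: poly_induct2) (simp_all add: ev_add algebra_simps)

lemma bimod_smult: "bimod R K (smult f F) = ev K f * bimod R K F"
  by (induction F) (simp_all add: ev_mult algebra_simps ev_left_commute)

lemma bimod_minus: "bimod R K (- F) = - bimod R K F"
  using bimod_add[of R K F "- F"] by (simp add: eq_neg_iff_add_eq_0 add.commute)

lemma bimod_diff: "bimod R K (F - G) = bimod R K F - bimod R K G"
  using bimod_add[of R K F "- G"] by (simp add: bimod_minus)

text \<open>The outer variable v acts by right multiplication with K, as u acts by left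
  multiplication. Hence taking the commutator with g(K) is multiplication by g(v) - g(u).\<close>

lemma bimod_lift: "bimod R K (lift_poly g * F) = bimod R K F * ev K g"
proof (induction g)
  case (pCons a g)
  then show ?case
    by (simp add: bimod_add bimod_smult algebra_simps c_central)
qed simp

text \<open>Terms without \<open>R\<close>, and those in which \<open>R\<close> meets only scalars,
  cancel; the rest is grouped into the differences that can be evaluated later. The first two keep
  \<open>c p\<close> attached, since in the application p = x - y and only these multiples are
  known.\<close>

lemma expand:
  assumes "H * G = G * H"
  shows "(c p * R + c a) * (c r * G + c g) * (c s * R + c b) * (c t * H + c h)
      - (c t * H + c h) * (c s * R + c b) * (c r * G + c g) * (c p * R + c a)
    = c (s * r * t) * (c p * (R * G * R * H - H * R * G * R)) + c (b * r * t) * (c p * (R * (G * H) - G * H * R))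
      + c (a * s * r * t) * (G * R * H - H * R * G) + c (p * s * g * t) * (R * R * H - H * (R * R))
      + c ((p * b + a * s) * g * t) * (R * H - H * R) + c (h * r * (p * b - a * s)) * (R * G - G * R)"
proof -
  have "H * (G * z) = G * (H * z)" for z
    using assms by (metis mult.assoc)
  note rules = this assms c_left_commute[of R] c_left_commute[of G] c_left_commute[of H] c_left_commute[of "c u" for u]
    c_central[of v R for v, symmetric] c_central[of v G for v, symmetric] c_central[of v H for v, symmetric] c_central[of v "c u" for u v]
  show ?thesis
    by (simp add: c_mult c_add c_diff algebra_simps rules)
qed

end

section \<open>Congruences modulo a two-sided ideal containing the Hecke relations\<close>

locale hecke_congruence = central_algebra c for c :: "'c::comm_ring_1 \<Rightarrow> 'a::ring_1" +
  fixes J :: "'a set" and R K :: 'a and w :: 'c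
  assumes J_0: "0 \<in> J"
    and J_add: "\<lbrakk>a \<in> J; b \<in> J\<rbrakk> \<Longrightarrow> a + b \<in> J"
    and J_left: "a \<in> J \<Longrightarrow> b * a \<in> J"
    and J_right: "a \<in> J \<Longrightarrow> a * b \<in> J"
    and hecke: "R * R - (c w * R + 1) \<in> J"
    and reflection: "R * K * R * K - K * R * K * R \<in> J"
begin

definition cong :: "'a \<Rightarrow> 'a \<Rightarrow> bool" (infix "\<approx>" 50) where
  "a \<approx> b \<longleftrightarrow> a - b \<in> J"

lemma cong_refl [simp, intro]: "a \<approx> a"
  by (simp add: cong_def J_0)

lemma J_minus: "a \<in> J \<Longrightarrow> - a \<in> J"
  using J_left[of a "-1"] by simp

lemma cong_sym: "a \<approx> b \<Longrightarrow> b \<approx> a"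
  using J_minus[of "a - b"] by (simp add: cong_def)

lemma cong_trans [trans]: "\<lbrakk>a \<approx> b; b \<approx> d\<rbrakk> \<Longrightarrow> a \<approx> d"
  using J_add[of "a - b" "b - d"] by (simp add: cong_def)

lemma cong_add: "\<lbrakk>a \<approx> b; d \<approx> e\<rbrakk> \<Longrightarrow> a + d \<approx> b + e"
  using J_add[of "a - b" "d - e"] by (simp add: cong_def algebra_simps)

lemma cong_minus: "a \<approx> b \<Longrightarrow> - a \<approx> - b"
  using J_minus[of "a - b"] by (simp add: cong_def)

lemma cong_diff: "\<lbrakk>a \<approx> b; d \<approx> e\<rbrakk> \<Longrightarrow> a - d \<approx> b - e"
  using cong_add[of a b "- d" "- e"] cong_minus[of d e] by simp

lemma cong_left: "a \<approx> b \<Longrightarrow> d * a \<approx> d * b"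
  using J_left[of "a - b" d] by (simp add: cong_def algebra_simps)

lemma cong_right: "a \<approx> b \<Longrightarrow> a * d \<approx> b * d"
  using J_right[of "a - b" d] by (simp add: cong_def algebra_simps)

lemma RR: "R * R \<approx> c w * R + 1"
  by (simp add: cong_def hecke)

text \<open>The second Jucys-Murphy element. The reflection relation says precisely that it commutes
  with \<open>K\<close>, and enters the calculation only in this form.\<close>

abbreviation L :: 'a where "L \<equiv> R * K * R"

lemma L_K: "L * K \<approx> K * L"
  by (simp add: cong_def reflection flip: mult.assoc)

lemma L_ev: "L * ev K f \<approx> ev K f * L"
proof (induction f)
  case (pCons a f)
  have "L * ev K (pCons a f) = c a * L + (L * ev K f) * K"
    by (simp add: distrib_left c_central mult.assoc)
  also have "\<dots> \<approx> c a * L + ev K f * L * K"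
    by (intro cong_add cong_right pCons.IH cong_refl)
  also have "\<dots> \<approx> c a * L + ev K f * (K * L)"
    unfolding mult.assoc[of "ev K f" L] by (intro cong_add cong_left L_K cong_refl)
  also have "\<dots> = ev K (pCons a f) * L"
    by (simp add: distrib_right mult.assoc)
  finally show ?case .
qed simp

lemma R_L: "R * L \<approx> c w * L + K * R"
proof -
  have "R * R * (K * R) \<approx> (c w * R + 1) * (K * R)"
    by (intro cong_right RR)
  then show ?thesis by (simp add: algebra_simps)
qed

text \<open>As \<open>L\<close> commutes with \<open>K\<close>, K^i R K^j L is K^i (R L) K^j, and
  \<open>R_L\<close> splits this into w K^(i+j) L, which sees only the diagonal v = u, and K^(i+1) R
  K^j, which is multiplication by u.\<close>

lemma bimod_L: "bimod R K F * L \<approx> c w * ev K (poly F [:0, 1:]) * L + bimod R K (smult [:0, 1:] F)"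
proof (induction F)
  case (pCons f F)
  have "bimod R K (pCons f F) * L = ev K f * (R * L) + bimod R K F * (K * L)"
    by (simp add: algebra_simps)
  also have "\<dots> \<approx> ev K f * (c w * L + K * R) + bimod R K F * (L * K)"
    by (intro cong_add cong_left R_L cong_sym[OF L_K])
  also have "\<dots> = ev K f * (c w * L + K * R) + (bimod R K F * L) * K"
    by (simp add: mult.assoc)
  also have "\<dots> \<approx> ev K f * (c w * L + K * R)
      + (c w * ev K (poly F [:0, 1:]) * L + bimod R K (smult [:0, 1:] F)) * K"
    by (intro cong_add cong_right pCons.IH cong_refl)
  also have "\<dots> = ev K f * (c w * L + K * R)
      + (c w * ev K (poly F [:0, 1:]) * (L * K) + bimod R K (smult [:0, 1:] F) * K)"
    by (simp add: algebra_simps)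
  also have "\<dots> \<approx> ev K f * (c w * L + K * R)
      + (c w * ev K (poly F [:0, 1:]) * (K * L) + bimod R K (smult [:0, 1:] F) * K)"
    by (intro cong_add cong_left L_K cong_refl)
  also have "\<dots> = c w * ev K (poly (pCons f F) [:0, 1:]) * L + bimod R K (smult [:0, 1:] (pCons f F))"
    by (simp add: ev_add ev_mult algebra_simps c_left_commute c_1 ev_K ev_K_left)
  finally show ?case .
qed simp

text \<open>The polynomial is -w (g(v) - g(u)) (u f(v) - v f(u)) / (v - u), written without
  division. Appending a factor K to f(K) reduces to f itself, because R f(K) K R is R f(K) R^-1
  times \<open>L\<close> and \<open>L\<close> commutes with g(K).\<close>

lemma commutation:
  "R * ev K f * R * ev K g - ev K g * R * ev K f * R
    \<approx> bimod R K (smult [:- w:] ((pCons 0 (diff_quot f) - lift_poly f) * (lift_poly g - [:g:])))"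
proof (induction f)
  case 0
  show ?case by simp
next
  case (pCons a f)
  define D where "D = lift_poly g - [:g:]"
  define H where "H = smult [:- w:] (pCons 0 (diff_quot f)) * D"
  define Z where "Z = R * ev K f * R"
  define Y where "Y = Z - c w * R * ev K f"
  have RfD: "bimod R K (lift_poly f * D) = R * ev K f * ev K g - ev K g * R * ev K f" for f
  proof -
    have "lift_poly f * D = lift_poly f * (lift_poly g * 1) - smult g (lift_poly f * 1)"
      by (simp add: D_def algebra_simps)
    also have "bimod R K \<dots> = R * ev K g * ev K f - ev K g * (R * ev K f)"
      unfolding bimod_diff bimod_smult bimod_lift by (simp add: one_pCons c_1)
    finally show ?thesis by (simp add: mult.assoc ev_commute[of K f g])
  qed
  \<comment> \<open>Inserting R^-1 R, with R^-1 = R - w, in front of K R creates \<open>L\<close>;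
    what precedes it is \<open>Y\<close>, that is, R f(K) R^-1.\<close>
  have "R * ev K f * ((R - c w) * R) * (K * R) \<approx> R * ev K f * 1 * (K * R)"
    using hecke by (intro cong_right cong_left) (simp add: cong_def algebra_simps)
  then have "R * (ev K f * K) * R \<approx> Y * L"
    by (intro cong_sym[of "Y * L"]) (simp add: Z_def Y_def algebra_simps c_left_commute c_central)
  then have "R * (ev K f * K) * R * ev K g - ev K g * (R * (ev K f * K) * R) \<approx> Y * L * ev K g - ev K g * (Y * L)"
    by (intro cong_diff cong_left cong_right)
  also have "\<dots> \<approx> Y * (ev K g * L) - ev K g * (Y * L)"
    unfolding mult.assoc[of Y] by (intro cong_diff cong_left L_ev cong_refl)
  also have "\<dots> = ((Z * ev K g - ev K g * Z) - c w * bimod R K (lift_poly f * D)) * L"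
    unfolding RfD by (simp add: Y_def algebra_simps c_left_commute ev_left_commute[of K f g])
  also have "\<dots> \<approx> (bimod R K (smult [:- w:] ((pCons 0 (diff_quot f) - lift_poly f) * D))
      - c w * bimod R K (lift_poly f * D)) * L"
    using pCons.IH by (intro cong_right cong_diff cong_refl) (simp add: Z_def D_def mult.assoc)
  also have "\<dots> = (bimod R K (smult [:- w:] ((pCons 0 (diff_quot f) - lift_poly f) * D) - smult [:w:] (lift_poly f * D))) * L"
    by (simp add: bimod_diff bimod_smult)
  also have "smult [:- w:] ((pCons 0 (diff_quot f) - lift_poly f) * D) - smult [:w:] (lift_poly f * D) = H"
    by (simp add: H_def algebra_simps smult_diff_right smult_const_minus)
  also have "bimod R K H * L \<approx> c w * ev K (poly H [:0, 1:]) * L + bimod R K (smult [:0, 1:] H)"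
    by (rule bimod_L)
  \<comment> \<open>\<open>H\<close> contains the factor g(v) - g(u), so the diagonal term of
    \<open>bimod_L\<close> disappears.\<close>
  also have "poly H [:0, 1:] = 0"
    by (simp add: H_def D_def)
  finally have main: "R * (ev K f * K) * R * ev K g - ev K g * (R * (ev K f * K) * R) \<approx> bimod R K (smult [:0, 1:] H)"
    by simp
  have "c a * (R * R) * ev K g - ev K g * (c a * (R * R)) \<approx>
      c a * (c w * R + 1) * ev K g - ev K g * (c a * (c w * R + 1))"
    by (intro cong_diff cong_left cong_right RR)
  also have "\<dots> = bimod R K (smult [:w * a:] D)"
  proof -
    have D: "bimod R K D = R * ev K g - ev K g * R"
      using RfD[of 1] by simp
    show ?thesis
      unfolding bimod_smult D by (simp add: c_mult algebra_simps c_left_commute[of "ev K g"] c_central[of a "ev K g", symmetric] c_central[of v "c u" for u v])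
  qed
  finally have const: "c a * (R * R) * ev K g - ev K g * (c a * (R * R)) \<approx> bimod R K (smult [:w * a:] D)" .
  have "R * ev K (pCons a f) * R * ev K g - ev K g * R * ev K (pCons a f) * R =
     (R * (ev K f * K) * R * ev K g - ev K g * (R * (ev K f * K) * R))
      + (c a * (R * R) * ev K g - ev K g * (c a * (R * R)))"
    by (simp add: algebra_simps c_left_commute)
  also have "\<dots> \<approx> bimod R K (smult [:0, 1:] H) + bimod R K (smult [:w * a:] D)"
    by (intro cong_add main const)
  also have "\<dots> = bimod R K (smult [:0, 1:] H + smult [:w * a:] D)"
    by (simp add: bimod_add)
  also have "smult [:0, 1:] H + smult [:w * a:] D
      = smult [:- w:] ((pCons 0 (diff_quot (pCons a f)) - lift_poly (pCons a f)) * D)"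
  proof -
    have "pCons 0 (diff_quot (pCons a f)) - lift_poly (pCons a f)
      = [:0, 1:] * ([:f:] + [:0, 1:] * diff_quot f - lift_poly f) - [:[:a:]:]"
      by simp
    also have "[:f:] + [:0, 1:] * diff_quot f - lift_poly f = [:[:0, 1:]:] * diff_quot f"
    proof -
      have "[:-[:0, 1:], 1:] = [:0, 1:] - [:[:0, 1 :: 'c:]:]" by simp
      then have "[:0, 1:] * diff_quot f - [:[:0, 1:]:] * diff_quot f = lift_poly f - [:f:]"
        by (metis diff_quot_correct left_diff_distrib)
      then show ?thesis by (simp only: algebra_simps)
    qed
    finally have "pCons 0 (diff_quot (pCons a f)) - lift_poly (pCons a f)
      = pCons 0 (smult [:0, 1:] (diff_quot f)) - [:[:a:]:]" by simp
    then show ?thesis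
      by (simp add: H_def algebra_simps smult_diff_right smult_add_right)
  qed
  finally show ?case by (simp add: D_def)
qed

lemma bimod_lift_J: "ev K P \<in> J \<Longrightarrow> bimod R K (lift_poly P * F) \<in> J"
  by (simp add: bimod_lift J_left)

lemma bimod_smult_J: "ev K P \<in> J \<Longrightarrow> bimod R K (smult P F) \<in> J"
  by (simp add: bimod_smult J_right)

end

section \<open>The reflection equation with cleared denominators\<close>

text \<open>With G = (P - P(a)) / (u - a), u times the left side is (u - a) G + a G(0), which
  differs from P by a constant and vanishes at 0; so both sides are (P - P(0)) / u. What matters is
  the independence of \<open>a\<close>.\<close>

lemma synthetic_div_shift:
  "synthetic_div P a - smult a (synthetic_div (synthetic_div P a) 0) = synthetic_div P (0 :: 'c::comm_ring_1)"
proof (induction P)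
  case (pCons e P)
  have "poly P a - a * poly (synthetic_div P a) 0 = poly P 0"
    using arg_cong[OF synthetic_div_correct'[of a P], of "\<lambda>q. poly q 0"] by simp
  with pCons.IH show ?case by simp
qed simp

lemma poly_0_pCons: "f = pCons (poly f 0) (synthetic_div f (0 :: 'c::comm_ring_1))"
  using synthetic_div_correct[of f 0] by simp

locale reflection_data =
  fixes P :: "'c::comm_ring_1 poly" and \<xi> \<zeta> :: 'c
  assumes P_0: "poly P 0 = - (\<zeta> * \<xi>)"
begin

definition G :: "'c \<Rightarrow> 'c poly" where "G x = synthetic_div P (\<xi> * x)"

definition \<psi> :: "'c \<Rightarrow> 'c" where "\<psi> x = \<zeta> - x * poly (G x) 0"

text \<open>Its role is to exhibit the factor \<open>\<xi>\<close> in G_y - G_x = \<xi> (y B_y - x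
  B_x).\<close>

definition B :: "'c \<Rightarrow> 'c poly" where "B x = synthetic_div (G x) 0"

lemma G_eq: "G x = [:0, 1:] * B x + [:poly (G x) 0:]"
  using poly_0_pCons[of "G x"] by (simp add: B_def)

lemma poly_P: "poly P (\<xi> * x) = - (\<xi> * \<psi> x)"
  using arg_cong[OF synthetic_div_correct'[of "\<xi> * x" P], of "\<lambda>q. poly q 0"]
  by (simp add: P_0 G_def[symmetric] \<psi>_def algebra_simps)

lemma mult_G: "([:0, 1:] - [:\<xi> * x:]) * G x = P + [:\<xi> * \<psi> x:]"
proof -
  have "P + [:\<xi> * \<psi> x:] = [:- (\<xi> * x), 1:] * G x + ([:poly P (\<xi> * x):] + [:\<xi> * \<psi> x:])"
    using synthetic_div_correct'[of "\<xi> * x" P] by (simp only: G_def flip: add.assoc)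
  also have "[:poly P (\<xi> * x):] + [:\<xi> * \<psi> x:] = 0"
    by (simp add: poly_P)
  also have "[:- (\<xi> * x), 1:] = [:0, 1:] - [:\<xi> * x:]"
    by simp
  finally show ?thesis by (simp only: add_0_right)
qed

lemma G_B: "G x - [:\<xi> * x:] * B x = G y - [:\<xi> * y:] * B y"
  using synthetic_div_shift[of P "\<xi> * x"] synthetic_div_shift[of P "\<xi> * y"]
  by (simp add: B_def G_def)

text \<open>Multiplying each instance of \<open>mult_G\<close> by the other G and subtracting gives
  \<open>\<xi>\<close> times this identity. As \<open>\<xi>\<close> may be a zero divisor, the proof
  instead splits each G as u B + G(0) and rewrites its products with u.\<close>

lemma resolvent:
  "smult (y - x) (G x * G y) = smult (\<psi> x) (G y) - smult (\<psi> y) (G x) + P * (smult y (B y) - smult x (B x))"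
proof -
  have aux: "(y - x) * (g * g') = s * g' - s' * g + p * (y * b' - x * b)"
    if "u * g = k * x * g + p + k * s" "u * g' = k * y * g' + p + k * s'"
      "g = u * b + f" "g' = u * b' + f'" "g - k * x * b = g' - k * y * b'"
      "s = z - x * f" "s' = z - y * f'"
    for u g g' p s s' x y b b' f f' k z :: "'c poly"
  proof -
    \<comment> \<open>\<open>g0\<close> is (P - P(0)) / u, the part common to both G, so that
      \<open>u * g0\<close> involves neither x nor y.\<close>
    define g0 where "g0 = g - k * x * b"
    have ug0: "u * g0 = p + k * z"
    proof -
      have "u * g0 = u * g - k * x * (g - f)" using that(3) by (simp add: g0_def algebra_simps)
      then show ?thesis using that(1,6) by (simp add: algebra_simps)
    qed
    have 1: "x * (g * g0) = x * p * b + z * (g - g0) + x * f * g0"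
    proof -
      have "x * (g * g0) = x * b * (u * g0) + x * f * g0" unfolding that(3) by (simp add: algebra_simps)
      also have "\<dots> = x * p * b + z * (k * x * b) + x * f * g0" by (simp only: ug0) (simp add: algebra_simps)
      finally show ?thesis by (simp add: g0_def)
    qed
    have 2: "y * (g * g') = x * g * g' + s * g' - x * (g * g0) - s * g0 + y * p * b' + y * f' * g"
    proof -
      have "y * (g * g') = y * b' * (u * g) + y * f' * g" unfolding that(4) by (simp add: algebra_simps)
      also have "\<dots> = (x * g + s) * (k * y * b') + y * p * b' + y * f' * g" by (simp only: that(1)) (simp add: algebra_simps)
      also have "k * y * b' = g' - g0" using that(5) by (simp add: g0_def algebra_simps)
      finally show ?thesis by (simp add: algebra_simps)
    qed
    have "y * (g * g') - x * (g * g') = s * g' - s * g0 + y * p * b' + y * f' * g - (x * p * b + z * (g - g0) + x * f * g0)"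
      unfolding 2 1 by (simp add: algebra_simps)
    then show ?thesis by (simp add: that(6,7) algebra_simps)
  qed
  show ?thesis
    using aux[of "[:0, 1:]" "G x" "[:\<xi>:]" "[:x:]" P "[:\<psi> x:]" "G y" "[:y:]" "[:\<psi> y:]" "B x"
        "[:poly (G x) 0:]" "B y" "[:poly (G y) 0:]" "[:\<zeta>:]"] mult_G[of x] mult_G[of y] G_eq[of x] G_eq[of y] G_B[of x y]
    by (simp add: algebra_simps \<psi>_def)
qed

text \<open>This is \<open>mult_G\<close> under the difference quotient. Both sides agree after
  multiplication by v - u, which is monic in v and hence can be cancelled.\<close>

lemma diff_quot_G: "([:0, 1:] - [:[:\<xi> * x:]:]) * diff_quot (G x) = diff_quot P - [:G x:]"
proof -
  have "[:-[:0, 1:], 1:] * (([:0, 1:] - [:[:\<xi> * x:]:]) * diff_quot (G x))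
      = ([:0, 1:] - [:[:\<xi> * x:]:]) * (lift_poly (G x) - [:G x:])"
    unfolding diff_quot_correct[symmetric] by (simp only: ac_simps)
  also have "\<dots> = lift_poly (([:0, 1:] - [:\<xi> * x:]) * G x) - ([:0, 1:] - [:[:\<xi> * x:]:]) * [:G x:]"
    by (simp only: lift_poly_mult lift_poly_diff right_diff_distrib) simp
  also have "\<dots> = (lift_poly P - [:P:]) - [:-[:0, 1:], 1:] * [:G x:]"
  proof -
    have "([:0, 1:] - [:[:\<xi> * x:]:]) * [:G x:] = [:-[:0, 1:], 1:] * [:G x:] + [:([:0, 1:] - [:\<xi> * x:]) * G x:]"
      by (simp add: algebra_simps)
    then show ?thesis
      unfolding mult_G by (simp add: lift_poly_add)
  qed
  also have "\<dots> = [:-[:0, 1:], 1:] * (diff_quot P - [:G x:])"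
    unfolding diff_quot_correct[symmetric] by (simp only: right_diff_distrib)
  finally have *: "[:-[:0, 1:], 1:] * (([:0, 1:] - [:[:\<xi> * x:]:]) * diff_quot (G x) - (diff_quot P - [:G x:])) = 0"
    by (simp only: right_diff_distrib) simp
  have cancel: "F = 0" if "[:-u, 1:] * F = 0" for F :: "'c poly poly" and u
    using synthetic_div_unique_lemma[of u F 0] that by simp
  from cancel[OF *] show ?thesis by simp
qed

text \<open>The polynomial of \<open>commutation\<close> for f = G_x and g = G_y, up to the factor
  -w, is reduced modulo P(u) and P(v). Under \<open>bimod\<close> these multiples acquire a factor
  P(K) on the left or on the right.\<close>

lemma bivariate:
  "smult [:x - y:] ((pCons 0 (diff_quot (G x)) - lift_poly (G x)) * (lift_poly (G y) - [:G y:]))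
   = smult [:y:] ([:G x:] * lift_poly (G y) - [:G y:] * lift_poly (G x))
     + smult [:\<psi> x:] (lift_poly (G y) - [:G y:]) - smult [:\<psi> y:] (lift_poly (G x) - [:G x:])
     + lift_poly P * (smult [:x:] (diff_quot (G x)) - smult [:y:] (diff_quot (G y)) + lift_poly (smult y (B y) - smult x (B x)))
     - smult P (smult [:x:] (diff_quot (G x)) - smult [:y:] (diff_quot (G y)) + [:smult y (B y) - smult x (B x):])"
proof -
  have aux: "(x - y) * ((v * h - gv) * (gv' - gu'))
      = y * (gu * gv' - gu' * gv) + s * (gv' - gu') - s' * (gv - gu)
        + pv * (x * h - y * h' + nv) - pu * (x * h - y * h' + nu)"
    if "(v - u) * h = gv - gu" "(v - u) * h' = gv' - gu'" "(v - u) * hp = pv - pu"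
      "(v - k * x) * h = hp - gu" "(v - k * y) * h' = hp - gu'"
      "(y - x) * (gu * gu') = s * gu' - s' * gu + pu * nu"
      "(y - x) * (gv * gv') = s * gv' - s' * gv + pv * nv"
    for x y v u h h' hp gv gu gv' gu' pv pu k s s' nu nv :: "'c poly poly"
  proof -
    define q where "q = (v - u) * h * h'"
    have "(v - k * x) * q = ((v - k * x) * h) * ((v - u) * h')"
      by (simp add: q_def ac_simps)
    also have "\<dots> = ((v - u) * hp) * h' - gu * ((v - u) * h')"
      unfolding that(4) by (simp add: algebra_simps)
    finally have 1: "(v - k * x) * q = (pv - pu) * h' - gu * (gv' - gu')"
      unfolding that(2,3) .
    have "(v - k * y) * q = ((v - k * y) * h') * ((v - u) * h)"
      by (simp add: q_def ac_simps)
    also have "\<dots> = ((v - u) * hp) * h - gu' * ((v - u) * h)"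
      unfolding that(5) by (simp add: algebra_simps)
    finally have 2: "(v - k * y) * q = (pv - pu) * h - gu' * (gv - gu)"
      unfolding that(1,3) .
    \<comment> \<open>In this combination of v - \<xi> y and v - \<xi> x the \<open>\<xi>\<close>
      drops out, and each of the two factors turns a difference quotient of some G into that of
      P.\<close>
    have "(x - y) * (v * q) = x * ((v - k * y) * q) - y * ((v - k * x) * q)"
      by (simp add: algebra_simps)
    also have "\<dots> = x * ((pv - pu) * h - gu' * (gv - gu)) - y * ((pv - pu) * h' - gu * (gv' - gu'))"
      unfolding 1 2 ..
    finally have 3: "(x - y) * (v * q) = \<dots>" .
    have "(x - y) * ((v * h - gv) * (gv' - gu')) = (x - y) * (v * q) - (x - y) * gv * (gv' - gu')"
      unfolding q_def that(2)[symmetric] by (simp add: algebra_simps)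
    also have "\<dots> = x * ((pv - pu) * h - gu' * (gv - gu)) - y * ((pv - pu) * h' - gu * (gv' - gu'))
        + (y - x) * (gv * gv') - (y - x) * (gv * gu')"
      unfolding 3 by (simp add: algebra_simps)
    also have "\<dots> = x * ((pv - pu) * h - gu' * gv) - y * ((pv - pu) * h' - gu * gv')
        + (y - x) * (gv * gv') - (y - x) * (gu * gu') - (y - x) * (gv * gu')"
      by (simp add: algebra_simps)
    finally show ?thesis unfolding that(6,7) by (simp add: algebra_simps)
  qed
  have u: "smult [:a:] F = [:[:a:]:] * F" for a :: 'c and F by simp
  have v: "smult Q F = [:Q:] * F" for Q and F :: "'c poly poly" by simp
  have p: "pCons 0 (diff_quot (G x)) = [:0, 1:] * diff_quot (G x)" by simp
  have ru: "[:[:y:] - [:x:]:] * ([:G x:] * [:G y:]) =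
      [:[:\<psi> x:]:] * [:G y:] - [:[:\<psi> y:]:] * [:G x:] + [:P:] * [:smult y (B y) - smult x (B x):]"
    using resolvent[of y x] by (simp add: algebra_simps)
  have rv: "[:[:y:] - [:x:]:] * (lift_poly (G x) * lift_poly (G y)) =
      [:[:\<psi> x:]:] * lift_poly (G y) - [:[:\<psi> y:]:] * lift_poly (G x)
        + lift_poly P * lift_poly (smult y (B y) - smult x (B x))"
    using arg_cong[OF resolvent[of y x], of lift_poly]
    by (simp add: lift_poly_add lift_poly_diff lift_poly_mult lift_poly_smult)
  show ?thesis
    unfolding p
    using aux[of "[:0, 1:]" "[:[:0, 1:]:]" "diff_quot (G x)" "lift_poly (G x)" "[:G x:]" "diff_quot (G y)"
        "lift_poly (G y)" "[:G y:]" "diff_quot P" "lift_poly P" "[:P:]" "[:[:\<xi>:]:]" "[:[:x:]:]" "[:[:y:]:]"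
        "[:[:\<psi> x:]:]" "[:[:\<psi> y:]:]" "[:smult y (B y) - smult x (B x):]" "lift_poly (smult y (B y) - smult x (B x))"]
      diff_quot_correct[of "G x"] diff_quot_correct[of "G y"] diff_quot_correct[of P]
      diff_quot_G[of x] diff_quot_G[of y] ru rv
    by simp
qed

end

locale reflection_congruence = hecke_congruence c J R K w + reflection_data P \<xi> \<zeta>
  for c :: "'c::comm_ring_1 \<Rightarrow> 'a::ring_1" and J R K w and P :: "'c poly" and \<xi> \<zeta> +
  assumes P_J: "ev K P \<in> J"
begin

abbreviation g where "g x \<equiv> ev K (G x)"

lemma commutation_G:
  "c (x - y) * (R * g x * R * g y - g y * R * g x * R) \<approx>
    - (c w * (c y * (g x * R * g y - g y * R * g x) + c (\<psi> x) * (R * g y - g y * R) - c (\<psi> y) * (R * g x - g x * R)))"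
proof -
  have lift: "bimod R K (lift_poly f) = R * ev K f" for f
    using bimod_lift[of R K f 1] by (simp add: one_pCons c_1)
  have lift': "bimod R K ([:f:] * lift_poly f') = ev K f * R * ev K f'" for f f'
    by (simp add: bimod_smult lift mult.assoc)
  let ?F = "(pCons 0 (diff_quot (G x)) - lift_poly (G x)) * (lift_poly (G y) - [:G y:])"
  let ?M = "smult [:y:] ([:G x:] * lift_poly (G y) - [:G y:] * lift_poly (G x))
     + smult [:\<psi> x:] (lift_poly (G y) - [:G y:]) - smult [:\<psi> y:] (lift_poly (G x) - [:G x:])"
  have "c (x - y) * (R * g x * R * g y - g y * R * g x * R) \<approx> c (x - y) * bimod R K (smult [:- w:] ?F)"
    by (intro cong_left commutation)
  also have "\<dots> = - (c w * bimod R K (smult [:x - y:] ?F))"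
    unfolding bimod_smult by (simp add: c_minus c_left_commute[of "c (x - y)" w])
  also have "\<dots> \<approx> - (c w * bimod R K ?M)"
  proof (intro cong_minus cong_left)
    obtain F1 F2 where *: "smult [:x - y:] ?F = ?M + lift_poly P * F1 - smult P F2"
      using bivariate[of x y] by blast
    have "bimod R K (smult [:x - y:] ?F) - bimod R K ?M = bimod R K (lift_poly P * F1) + - bimod R K (smult P F2)"
      unfolding * bimod_diff[of R K "?M + lift_poly P * F1"] bimod_add[of R K ?M] by simp
    then show "bimod R K (smult [:x - y:] ?F) \<approx> bimod R K ?M"
      using J_add[OF bimod_lift_J[OF P_J] J_minus[OF bimod_smult_J[OF P_J]]]
      by (simp add: cong_def)
  qed
  also have "bimod R K ?M = c y * (g x * R * g y - g y * R * g x)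
      + c (\<psi> x) * (R * g y - g y * R) - c (\<psi> y) * (R * g x - g x * R)"
    unfolding bimod_diff bimod_add bimod_smult lift' lift by simp
  finally show ?thesis .
qed

lemma commutation_GG:
  "c (x - y) * (R * (g x * g y) - g x * g y * R) \<approx>
    c (\<psi> y) * (R * g x - g x * R) - c (\<psi> x) * (R * g y - g y * R)"
proof -
  let ?N = "smult y (B y) - smult x (B x)"
  have *: "c (x - y) * (g x * g y) = c (\<psi> y) * g x - c (\<psi> x) * g y - ev K P * ev K ?N"
    using arg_cong[OF resolvent[of y x], of "ev K"]
    by (simp add: ev_add ev_diff ev_smult ev_mult c_diff algebra_simps c_left_commute[of "ev K P"]
        ev_commute[of K "G y" "G x"])
  have "c (x - y) * (R * (g x * g y) - g x * g y * R) = R * (c (x - y) * (g x * g y)) - c (x - y) * (g x * g y) * R"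
    by (simp only: right_diff_distrib c_left_commute mult.assoc)
  also have "\<dots> = c (\<psi> y) * (R * g x - g x * R) - c (\<psi> x) * (R * g y - g y * R)
      - (R * (ev K P * ev K ?N) - ev K P * ev K ?N * R)"
    unfolding * by (simp add: algebra_simps c_left_commute)
  also have "\<dots> \<approx> c (\<psi> y) * (R * g x - g x * R) - c (\<psi> x) * (R * g y - g y * R) - 0"
    using P_J by (intro cong_diff cong_refl)
      (simp add: cong_def J_add[OF _ J_minus, simplified] J_left J_right)
  finally show ?thesis by simp
qed

text \<open>With R(t) = (1 - t^-1) R + t^-1 w, the factors stand for x R(x/y), (x^2 - 1) K(x), x y
  R(x y) and (y^2 - 1) K(y). After \<open>expand\<close> only G_x R G_y - G_y R G_x and the
  commutators of \<open>R\<close> with G_x and G_y remain, and their three coefficients vanish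
  identically.\<close>

theorem reflection_cleared:
  "(c (x - y) * R + c (y * w)) * (c (x * x - 1) * g x + c (x * \<psi> x))
     * (c (x * y - 1) * R + c w) * (c (y * y - 1) * g y + c (y * \<psi> y))
   \<approx> (c (y * y - 1) * g y + c (y * \<psi> y)) * (c (x * y - 1) * R + c w)
     * (c (x * x - 1) * g x + c (x * \<psi> x)) * (c (x - y) * R + c (y * w))"
proof -
  define A where "A = g x * R * g y - g y * R * g x"
  define B where "B = R * g y - g y * R"
  define C where "C = R * g x - g x * R"
  define r where "r = x * x - 1"
  define t where "t = y * y - 1"
  define s where "s = x * y - 1"
  have RRH: "R * R * g y - g y * (R * R) \<approx> c w * B"
  proof -
    have "R * R * g y - g y * (R * R) \<approx> (c w * R + 1) * g y - g y * (c w * R + 1)"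
      by (intro cong_diff cong_left cong_right RR)
    also have "\<dots> = c w * B" by (simp add: B_def algebra_simps c_left_commute)
    finally show ?thesis .
  qed
  have "c (s * r * t) * (c (x - y) * (R * g x * R * g y - g y * R * g x * R))
      + c (w * r * t) * (c (x - y) * (R * (g x * g y) - g x * g y * R))
      + c (y * w * s * r * t) * A + c ((x - y) * s * (x * \<psi> x) * t) * (R * R * g y - g y * (R * R))
      + c (((x - y) * w + y * w * s) * (x * \<psi> x) * t) * B + c (y * \<psi> y * r * ((x - y) * w - y * w * s)) * C
    \<approx> c (s * r * t) * (- (c w * (c y * A + c (\<psi> x) * B - c (\<psi> y) * C)))
      + c (w * r * t) * (c (\<psi> y) * C - c (\<psi> x) * B)
      + c (y * w * s * r * t) * A + c ((x - y) * s * (x * \<psi> x) * t) * (c w * B)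
      + c (((x - y) * w + y * w * s) * (x * \<psi> x) * t) * B + c (y * \<psi> y * r * ((x - y) * w - y * w * s)) * C"
    unfolding A_def B_def C_def
    by (intro cong_add cong_left cong_refl RRH[unfolded B_def] commutation_GG commutation_G)
  also have "\<dots> = c (- (s * r * t * w * y) + y * w * s * r * t) * A
      + c (- (s * r * t * w * \<psi> x) - w * r * t * \<psi> x + (x - y) * s * (x * \<psi> x) * t * w
          + ((x - y) * w + y * w * s) * (x * \<psi> x) * t) * B
      + c (s * r * t * w * \<psi> y + w * r * t * \<psi> y + y * \<psi> y * r * ((x - y) * w - y * w * s)) * C"
    by (simp add: c_add c_diff c_minus c_mult algebra_simps c_central[of v "c u" for u v] c_left_commute[of "c u" for u])
  also have "- (s * r * t * w * y) + y * w * s * r * t = 0"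
    by (simp add: algebra_simps)
  also have "- (s * r * t * w * \<psi> x) - w * r * t * \<psi> x + (x - y) * s * (x * \<psi> x) * t * w
          + ((x - y) * w + y * w * s) * (x * \<psi> x) * t = 0"
    by (simp add: s_def r_def algebra_simps)
  also have "s * r * t * w * \<psi> y + w * r * t * \<psi> y + y * \<psi> y * r * ((x - y) * w - y * w * s) = 0"
    by (simp add: s_def t_def algebra_simps)
  finally show ?thesis
    unfolding cong_def expand[OF ev_commute] by (simp add: A_def B_def C_def r_def s_def t_def)
qed

end

section \<open>Rings on whole types as carrier records, and induction on finitely supported
  functions\<close>

lemma ring_of_type_algebra_simps [simp]:
  "carrier ring_of_type_algebra = UNIV"
  "x \<oplus>\<^bsub>ring_of_type_algebra\<^esub> y = x + y"
  "x \<otimes>\<^bsub>ring_of_type_algebra\<^esub> y = x * y"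
  "\<zero>\<^bsub>ring_of_type_algebra\<^esub> = 0"
  "\<one>\<^bsub>ring_of_type_algebra\<^esub> = 1"
  by (simp_all add: ring_of_type_algebra_def)

lemma ring_ring_of_type_algebra: "ring (ring_of_type_algebra :: 'a::ring_1 ring)"
proof -
  have "\<exists>y. x + y = 0" for x :: 'a
    using add.right_inverse by blast
  then show ?thesis
    unfolding ring_of_type_algebra_def using add.right_inverse
    by unfold_locales (auto simp: algebra_simps Units_def)
qed

lemma a_inv_ring_of_type_algebra [simp]: "\<ominus>\<^bsub>ring_of_type_algebra\<^esub> x = - (x :: 'a::ring_1)"
proof -
  interpret ring "ring_of_type_algebra :: 'a ring" by (rule ring_ring_of_type_algebra)
  show ?thesis by (rule minus_equality) simp_all
qed

lemma a_minus_ring_of_type_algebra [simp]: "x \<ominus>\<^bsub>ring_of_type_algebra\<^esub> y = x - (y :: 'a::ring_1)"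
  by (simp add: a_minus_def)

lemma poly_mapping_induct [case_names zero single add]:
  fixes f :: "'m \<Rightarrow>\<^sub>0 'b::ab_group_add"
  assumes zero: "P 0" and single: "\<And>i b. P (Poly_Mapping.single i b)"
    and add: "\<And>f g. \<lbrakk>P f; P g\<rbrakk> \<Longrightarrow> P (f + g)"
  shows "P f"
proof (induction f rule: Poly_Mapping.update_induct)
  case (update f a b)
  have "Poly_Mapping.update a b f = f + Poly_Mapping.single a b"
    using update(1) by (intro poly_mapping_eqI)
      (auto simp: Poly_Mapping.lookup_update lookup_add lookup_single when_def in_keys_iff)
  with update show ?case by (simp add: single add)
qed (rule zero)

text \<open>Integer combinations arise from generators by sums and negation alone; the bound
  \<open>U\<close> on the keys matches the carrier of \<open>formal_sums\<close>.\<close>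

lemma int_combination_induct [consumes 1, case_names zero pair add minus]:
  fixes f :: "'u \<Rightarrow>\<^sub>0 int"
  assumes keys: "Poly_Mapping.keys f \<subseteq> U"
    and zero: "P 0" and pair: "\<And>u. u \<in> U \<Longrightarrow> P (Poly_Mapping.single u 1)"
    and add: "\<And>f g. \<lbrakk>Poly_Mapping.keys f \<subseteq> U; Poly_Mapping.keys g \<subseteq> U; P f; P g\<rbrakk> \<Longrightarrow> P (f + g)"
    and minus: "\<And>f. \<lbrakk>Poly_Mapping.keys f \<subseteq> U; P f\<rbrakk> \<Longrightarrow> P (- f)"
  shows "P f"
proof -
  have single: "P (Poly_Mapping.single u n)" if "u \<in> U" for u n
  proof (induction n rule: int_induct[where k = 0])
    case (step1 i)
    then show ?case using that unfolding single_add by (intro add pair) auto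
  next
    case (step2 i)
    then show ?case
      using that unfolding diff_conv_add_uminus single_add single_uminus
      by (intro add minus pair) (auto simp flip: single_uminus)
  qed (simp add: zero)
  show ?thesis
    using keys
  proof (induction f rule: Poly_Mapping.update_induct)
    case (update f a b)
    have "Poly_Mapping.update a b f = f + Poly_Mapping.single a b"
      using update(1) by (intro poly_mapping_eqI)
        (auto simp: Poly_Mapping.lookup_update lookup_add lookup_single when_def in_keys_iff)
    moreover have "a \<in> U" "Poly_Mapping.keys f \<subseteq> U"
      using update(2,4) by (auto simp: Poly_Mapping.keys_update split: if_splits)
    ultimately show ?case
      using update(3) by (auto intro!: add single split: if_splits)
  qed (rule zero)
qed

section \<open>Homomorphisms out of monoid algebras\<close>

text \<open>The universal property of a monoid algebra, for images that commute with each other. It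
  is used for \<zz>[x, y], for the free algebra over it, and for the action on \<zz>[u].\<close>

locale monoid_algebra_hom = S: ring S for S :: "('s, 't) ring_scheme" (structure) +
  fixes h :: "'b::ring_1 \<Rightarrow> 's" and m :: "'m::monoid_add \<Rightarrow> 's"
  assumes h_hom: "h \<in> ring_hom ring_of_type_algebra S"
    and m_closed: "m i \<in> carrier S" and m_0: "m 0 = \<one>" and m_add: "m (i + j) = m i \<otimes> m j"
    and commute: "h b \<otimes> m i = m i \<otimes> h b"
begin

definition extend :: "('m \<Rightarrow>\<^sub>0 'b) \<Rightarrow> 's" where
  "extend f = (\<Oplus>i\<in>Poly_Mapping.keys f. h (Poly_Mapping.lookup f i) \<otimes> m i)"

lemma h_simps [simp]: "h a \<in> carrier S" "h (a * b) = h a \<otimes> h b" "h (a + b) = h a \<oplus> h b" "h 1 = \<one>" "h 0 = \<zero>"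
proof -
  interpret ring_hom_ring ring_of_type_algebra S h
    by (intro ring_hom_ringI2 ring_ring_of_type_algebra S.ring_axioms h_hom)
  show "h a \<in> carrier S" "h (a * b) = h a \<otimes> h b" "h (a + b) = h a \<oplus> h b" "h 1 = \<one>" "h 0 = \<zero>"
    using hom_closed[of a] hom_mult[of a b] hom_add[of a b] hom_one hom_zero by simp_all
qed

lemma extend_superset:
  assumes "finite U" "Poly_Mapping.keys f \<subseteq> U"
  shows "extend f = (\<Oplus>i\<in>U. h (Poly_Mapping.lookup f i) \<otimes> m i)"
  unfolding extend_def using assms
  by (intro S.add.finprod_mono_neutral_cong_left) (auto simp: m_closed in_keys_iff)

lemma extend_closed [simp]: "extend f \<in> carrier S"
  unfolding extend_def by (intro S.finsum_closed) (auto simp: m_closed)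

lemma extend_add: "extend (f + g) = extend f \<oplus> extend g"
proof -
  let ?U = "Poly_Mapping.keys f \<union> Poly_Mapping.keys g"
  have "extend (f + g) = (\<Oplus>i\<in>?U. h (Poly_Mapping.lookup f i) \<otimes> m i \<oplus> h (Poly_Mapping.lookup g i) \<otimes> m i)"
    using Poly_Mapping.keys_add[of f g]
    by (subst extend_superset[of ?U]) (auto simp: lookup_add S.l_distr m_closed)
  also have "\<dots> = extend f \<oplus> extend g"
    by (subst S.finsum_addf) (auto simp: m_closed extend_superset[of ?U])
  finally show ?thesis .
qed

lemma extend_0 [simp]: "extend 0 = \<zero>"
  by (simp add: extend_def)

lemma extend_single: "extend (Poly_Mapping.single i b) = h b \<otimes> m i"
  by (subst extend_superset[of "{i}"]) (auto simp: m_closed S.add.finprod_singleton)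

lemma extend_mult: "extend (f * g) = extend f \<otimes> extend g"
proof (induction f rule: poly_mapping_induct)
  case (single i b)
  show ?case
  proof (induction g rule: poly_mapping_induct)
    case (single j d)
    have "h b \<otimes> h d \<otimes> (m i \<otimes> m j) = h b \<otimes> (h d \<otimes> m i) \<otimes> m j"
      by (simp add: S.m_assoc m_closed)
    also have "\<dots> = h b \<otimes> m i \<otimes> (h d \<otimes> m j)"
      unfolding commute[of d i] by (simp add: S.m_assoc m_closed)
    finally show ?case
      by (simp add: mult_single extend_single m_add)
  qed (simp_all add: distrib_left extend_add S.r_distr)
qed (simp_all add: distrib_right extend_add S.l_distr)

lemma extend_hom: "extend \<in> ring_hom ring_of_type_algebra S"
  by (intro ring_hom_memI) (simp_all add: extend_mult extend_add extend_single m_0 flip: single_one)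

end

section \<open>Tensor products\<close>

context
  fixes A :: "('a, 'm) ring_scheme" (structure)
  assumes ring_A: "ring A"
begin

interpretation A: ring A by (rule ring_A)

abbreviation FS :: "(('a \<times> 'l::comm_ring_1) \<Rightarrow>\<^sub>0 int) ring" where "FS \<equiv> formal_sums A"

lemma carrier_formal_sums: "f \<in> carrier FS \<longleftrightarrow> Poly_Mapping.keys f \<subseteq> carrier A \<times> UNIV"
  by (simp add: formal_sums_def)

lemma formal_sums_simps [simp]:
  "f \<oplus>\<^bsub>FS\<^esub> g = f + g" "\<zero>\<^bsub>FS\<^esub> = 0" "\<one>\<^bsub>FS\<^esub> = formal_pair \<one> 1"
  by (simp_all add: formal_sums_def)

lemma formal_mult_add:
  "(f + f') \<otimes>\<^bsub>FS\<^esub> g = f \<otimes>\<^bsub>FS\<^esub> g + f' \<otimes>\<^bsub>FS\<^esub> g"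
  "f \<otimes>\<^bsub>FS\<^esub> (g + g') = f \<otimes>\<^bsub>FS\<^esub> g + f \<otimes>\<^bsub>FS\<^esub> g'"
proof -
  let ?t = "\<lambda>u n v k. Poly_Mapping.single (fst u \<otimes> fst v, snd u * snd v) (n * k :: int)"
  show "(f + f') \<otimes>\<^bsub>FS\<^esub> g = f \<otimes>\<^bsub>FS\<^esub> g + f' \<otimes>\<^bsub>FS\<^esub> g"
    using setsum_keys_plus_distrib[of "\<lambda>u n. \<Sum>v\<in>Poly_Mapping.keys g. ?t u n v (Poly_Mapping.lookup g v)" f f']
    by (simp add: formal_sums_def single_add distrib_right sum.distrib)
  have "(\<Sum>v\<in>Poly_Mapping.keys (g + g'). ?t u n v (Poly_Mapping.lookup (g + g') v)) =
      (\<Sum>v\<in>Poly_Mapping.keys g. ?t u n v (Poly_Mapping.lookup g v)) +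
      (\<Sum>v\<in>Poly_Mapping.keys g'. ?t u n v (Poly_Mapping.lookup g' v))" for u n
    by (rule setsum_keys_plus_distrib) (simp_all add: single_add distrib_left)
  then show "f \<otimes>\<^bsub>FS\<^esub> (g + g') = f \<otimes>\<^bsub>FS\<^esub> g + f \<otimes>\<^bsub>FS\<^esub> g'"
    by (simp add: formal_sums_def sum.distrib)
qed

lemma formal_mult_0 [simp]: "0 \<otimes>\<^bsub>FS\<^esub> g = 0" "f \<otimes>\<^bsub>FS\<^esub> 0 = 0"
  by (simp_all add: formal_sums_def)

lemma formal_mult_minus: "(- f) \<otimes>\<^bsub>FS\<^esub> g = - (f \<otimes>\<^bsub>FS\<^esub> g)" "f \<otimes>\<^bsub>FS\<^esub> (- g) = - (f \<otimes>\<^bsub>FS\<^esub> g)"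
  using formal_mult_add(1)[of f "- f" g] formal_mult_add(2)[of f g "- g"]
  by (simp_all add: eq_neg_iff_add_eq_0 add.commute)

lemma formal_mult_pair:
  "formal_pair a l \<otimes>\<^bsub>FS\<^esub> formal_pair b m = formal_pair (a \<otimes> b) (l * m)"
  by (simp add: formal_sums_def)

lemma formal_pair_closed [simp]: "formal_pair a l \<in> carrier FS \<longleftrightarrow> a \<in> carrier A"
  by (auto simp: formal_sums_def)

lemma formal_closed [simp]:
  "0 \<in> carrier FS" "\<lbrakk>f \<in> carrier FS; g \<in> carrier FS\<rbrakk> \<Longrightarrow> f + g \<in> carrier FS"
  "f \<in> carrier FS \<Longrightarrow> - f \<in> carrier FS" "\<lbrakk>f \<in> carrier FS; g \<in> carrier FS\<rbrakk> \<Longrightarrow> f - g \<in> carrier FS"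
  using Poly_Mapping.keys_add[of f g] Poly_Mapping.keys_diff[of f g]
  by (auto simp: formal_sums_def keys_minus)

lemma formal_sums_induct [consumes 1, case_names zero pair add minus]:
  assumes "f \<in> carrier (FS :: (('a \<times> 'l::comm_ring_1) \<Rightarrow>\<^sub>0 int) ring)"
    and "P 0" and "\<And>a l. a \<in> carrier A \<Longrightarrow> P (formal_pair a l)"
    and "\<And>f g. \<lbrakk>f \<in> carrier FS; g \<in> carrier FS; P f; P g\<rbrakk> \<Longrightarrow> P (f + g)"
    and "\<And>f. \<lbrakk>f \<in> carrier FS; P f\<rbrakk> \<Longrightarrow> P (- f)"
  shows "P f"
  using assms(1) unfolding carrier_formal_sums
  by (induction f rule: int_combination_induct)
     (use assms(2-) in \<open>auto simp: carrier_formal_sums\<close>)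

lemma formal_mult_closed [simp]:
  assumes "f \<in> carrier FS" "g \<in> carrier FS"
  shows "f \<otimes>\<^bsub>FS\<^esub> g \<in> carrier (FS :: (('a \<times> 'l::comm_ring_1) \<Rightarrow>\<^sub>0 int) ring)"
  using assms(1)
proof (induction f rule: formal_sums_induct)
  case (pair a l)
  show ?case using assms(2)
    by (induction g rule: formal_sums_induct)
      (use pair in \<open>simp_all add: formal_mult_add formal_mult_minus formal_mult_pair\<close>)
qed (simp_all add: formal_mult_add formal_mult_minus)

lemma formal_mult_assoc:
  assumes "f \<in> carrier FS" "g \<in> carrier FS" "e \<in> carrier (FS :: (('a \<times> 'l::comm_ring_1) \<Rightarrow>\<^sub>0 int) ring)"
  shows "f \<otimes>\<^bsub>FS\<^esub> g \<otimes>\<^bsub>FS\<^esub> e = f \<otimes>\<^bsub>FS\<^esub> (g \<otimes>\<^bsub>FS\<^esub> e)"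
  using assms(1)
proof (induction f rule: formal_sums_induct)
  case (pair a l)
  note a = this
  show ?case using assms(2)
  proof (induction g rule: formal_sums_induct)
    case (pair b m)
    show ?case using assms(3)
      by (induction e rule: formal_sums_induct)
        (use a pair in \<open>simp_all add: formal_mult_add formal_mult_minus formal_mult_pair A.m_assoc mult.assoc\<close>)
  qed (simp_all add: formal_mult_add formal_mult_minus)
qed (simp_all add: formal_mult_add formal_mult_minus)

lemma ring_formal_sums: "ring (FS :: (('a \<times> 'l::comm_ring_1) \<Rightarrow>\<^sub>0 int) ring)"
proof (rule ringI)
  show "abelian_group (FS :: (('a \<times> 'l) \<Rightarrow>\<^sub>0 int) ring)"
    by (rule abelian_groupI) (auto simp: algebra_simps intro: exI[of _ "- x" for x] bexI[of _ "- x" for x])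
  show "Group.monoid (FS :: (('a \<times> 'l) \<Rightarrow>\<^sub>0 int) ring)"
  proof (rule monoidI)
    fix f :: "('a \<times> 'l) \<Rightarrow>\<^sub>0 int"
    assume f: "f \<in> carrier FS"
    show "\<one>\<^bsub>FS\<^esub> \<otimes>\<^bsub>FS\<^esub> f = f" using f
      by (induction f rule: formal_sums_induct) (simp_all add: formal_mult_add formal_mult_minus formal_mult_pair)
    show "f \<otimes>\<^bsub>FS\<^esub> \<one>\<^bsub>FS\<^esub> = f" using f
      by (induction f rule: formal_sums_induct) (simp_all add: formal_mult_add formal_mult_minus formal_mult_pair)
  qed (simp_all add: formal_mult_assoc)
qed (simp_all add: formal_mult_add)

lemma formal_minus [simp]: "f \<in> carrier FS \<Longrightarrow> \<ominus>\<^bsub>FS\<^esub> f = - f"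
proof -
  interpret F: ring FS by (rule ring_formal_sums)
  show "f \<in> carrier FS \<Longrightarrow> \<ominus>\<^bsub>FS\<^esub> f = - f" by (intro F.minus_equality) simp_all
qed

end

text \<open>\<open>A\<close> will be \<zz>, K_p or H_p. Centrality of \<open>\<alpha>\<close> makes
  the scaling relations stable under multiplication by pairs on either side.\<close>

locale tensor_factors = ring A for A :: "('a, 'm) ring_scheme" (structure) +
  fixes \<alpha> :: "'k \<Rightarrow> 'a" and \<beta> :: "'k \<Rightarrow> 'l::comm_ring_1"
  assumes \<alpha>_closed [simp]: "\<alpha> k \<in> carrier A"
    and \<alpha>_central: "a \<in> carrier A \<Longrightarrow> \<alpha> k \<otimes> a = a \<otimes> \<alpha> k"
begin

abbreviation F :: "(('a \<times> 'l) \<Rightarrow>\<^sub>0 int) ring" where "F \<equiv> formal_sums A"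
abbreviation Rel where "Rel \<equiv> tensor_relations A \<alpha> \<beta>"
abbreviation I where "I \<equiv> tensor_ideal A \<alpha> \<beta>"
abbreviation T where "T \<equiv> tensor_alg A \<alpha> \<beta>"
abbreviation el where "el \<equiv> tensor_elem A \<alpha> \<beta>"
abbreviation coset where "coset f \<equiv> I +>\<^bsub>F\<^esub> f"

sublocale F: ring F by (rule ring_formal_sums[OF ring_axioms])

lemma Rel_closed: "Rel \<subseteq> carrier F"
  by (auto simp: tensor_relations_def ring_axioms)

sublocale I: ideal I F
  unfolding tensor_ideal_def by (rule F.genideal_ideal[OF Rel_closed])

sublocale T: ring T
  unfolding tensor_alg_def by (rule I.quotient_is_ring)

sublocale coset: ring_hom_ring F T coset
  unfolding tensor_alg_def by (rule I.rcos_ring_hom_ring)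

lemma Rel_I: "r \<in> Rel \<Longrightarrow> r \<in> I"
  unfolding tensor_ideal_def using F.genideal_self[OF Rel_closed] by blast

lemma coset_eqI: "\<lbrakk>f \<in> carrier F; g \<in> carrier F; f - g \<in> I\<rbrakk> \<Longrightarrow> coset f = coset g"
  using F.quotient_eq_iff_same_a_r_cos[OF I.ideal_axioms, of f g] by (simp add: a_minus_def ring_axioms)

lemma el_closed [simp]: "a \<in> carrier A \<Longrightarrow> el a l \<in> carrier T"
  unfolding tensor_elem_def by (simp add: ring_axioms)

lemma el_add_left: "\<lbrakk>a \<in> carrier A; b \<in> carrier A\<rbrakk> \<Longrightarrow> el (a \<oplus> b) l = el a l \<oplus>\<^bsub>T\<^esub> el b l"
proof -
  assume ab: "a \<in> carrier A" "b \<in> carrier A"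
  have "coset (formal_pair (a \<oplus> b) l) = coset (formal_pair a l + formal_pair b l)"
    using ab by (intro coset_eqI Rel_I) (auto simp: ring_axioms tensor_relations_def)
  then show ?thesis
    using coset.hom_add[of "formal_pair a l" "formal_pair b l"] ab
    by (simp add: tensor_elem_def ring_axioms)
qed

lemma el_add_right: "a \<in> carrier A \<Longrightarrow> el a (l + m) = el a l \<oplus>\<^bsub>T\<^esub> el a m"
proof -
  assume a: "a \<in> carrier A"
  have "coset (formal_pair a (l + m)) = coset (formal_pair a l + formal_pair a m)"
    using a by (intro coset_eqI Rel_I) (auto simp: ring_axioms tensor_relations_def)
  then show ?thesis
    using coset.hom_add[of "formal_pair a l" "formal_pair a m"] a
    by (simp add: tensor_elem_def ring_axioms)
qed

lemma el_mult: "\<lbrakk>a \<in> carrier A; b \<in> carrier A\<rbrakk> \<Longrightarrow> el a l \<otimes>\<^bsub>T\<^esub> el b m = el (a \<otimes> b) (l * m)"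
  using coset.hom_mult[of "formal_pair a l" "formal_pair b m"]
  by (simp add: tensor_elem_def ring_axioms formal_mult_pair)

lemma one_T: "\<one>\<^bsub>T\<^esub> = el \<one> 1"
  using coset.hom_one by (simp add: tensor_elem_def ring_axioms)

lemma el_zero_left [simp]: "el \<zero> l = \<zero>\<^bsub>T\<^esub>"
  using el_add_left[of \<zero> \<zero> l] T.add.r_cancel_one[of "el \<zero> l" "el \<zero> l"] by simp

lemma el_zero_right [simp]: "a \<in> carrier A \<Longrightarrow> el a 0 = \<zero>\<^bsub>T\<^esub>"
  using el_add_right[of a 0 0] T.add.r_cancel_one[of "el a 0" "el a 0"] by simp

lemma el_minus_left: "a \<in> carrier A \<Longrightarrow> el (\<ominus> a) l = \<ominus>\<^bsub>T\<^esub> el a l"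
  using el_add_left[of "\<ominus> a" a l] by (intro T.minus_equality[symmetric]) (simp_all add: l_neg)

lemma el_minus_right: "a \<in> carrier A \<Longrightarrow> el a (- l) = \<ominus>\<^bsub>T\<^esub> el a l"
  using el_add_right[of a "- l" l] by (intro T.minus_equality[symmetric]) simp_all

lemma el_diff_left: "\<lbrakk>a \<in> carrier A; b \<in> carrier A\<rbrakk> \<Longrightarrow> el (a \<ominus> b) l = el a l \<ominus>\<^bsub>T\<^esub> el b l"
  by (simp add: a_minus_def el_add_left el_minus_left)

lemma el_diff_right: "a \<in> carrier A \<Longrightarrow> el a (l - m) = el a l \<ominus>\<^bsub>T\<^esub> el a m"
  using el_add_right[of a l "- m"] by (simp add: a_minus_def el_minus_right)

lemma carrier_T: "V \<in> carrier T \<Longrightarrow> \<exists>f\<in>carrier F. V = coset f"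
  unfolding tensor_alg_def FactRing_def A_RCOSETS_def' partial_object.simps by blast

text \<open>Negatives need no case of their own: the negative of a pure tensor is again one, so the
  claim is proved for a coset and its negative together.\<close>

lemma tensor_induct [consumes 1, case_names zero el add]:
  assumes "V \<in> carrier T"
    and zero: "P \<zero>\<^bsub>T\<^esub>" and el: "\<And>a l. a \<in> carrier A \<Longrightarrow> P (el a l)"
    and add: "\<And>V W. \<lbrakk>V \<in> carrier T; W \<in> carrier T; P V; P W\<rbrakk> \<Longrightarrow> P (V \<oplus>\<^bsub>T\<^esub> W)"
  shows "P V"
proof -
  obtain f where f: "f \<in> carrier F" "V = coset f" using carrier_T[OF assms(1)] by blast
  have "P (coset f) \<and> P (\<ominus>\<^bsub>T\<^esub> (coset f))"
    using f(1)
  proof (induction f rule: formal_sums_induct[OF ring_axioms, consumes 1, case_names zero pair add minus])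
    case zero
    then show ?case using assms(2) coset.hom_zero by (simp add: ring_axioms)
  next
    case (pair a l)
    then show ?case using el[of a l] el[of "\<ominus> a" l] by (simp add: el_minus_left flip: tensor_elem_def)
  next
    case (add f g)
    have "coset (f + g) = coset f \<oplus>\<^bsub>T\<^esub> coset g"
      using coset.hom_add[of f g] add(1,2) by (simp add: ring_axioms)
    then show ?case
      using add assms(4) by (simp add: T.minus_add)
  next
    case (minus f)
    then show ?case using coset.hom_a_inv[of f] by (simp add: ring_axioms)
  qed
  then show ?thesis using f(2) by simp
qed

lemma central_T:
  assumes "Z \<in> carrier T" "\<And>a. a \<in> carrier A \<Longrightarrow> z \<otimes> a = a \<otimes> z" "z \<in> carrier A"
  shows "el z l \<otimes>\<^bsub>T\<^esub> Z = Z \<otimes>\<^bsub>T\<^esub> el z l"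
  using assms(1)
  by (induction Z rule: tensor_induct)
    (simp_all add: el_mult assms(2,3) mult.commute T.r_distr T.l_distr)

text \<open>A relation multiplied by pairs on both sides is a relation, so that the two-sided ideal
  generated by the relations is the subgroup they generate.\<close>

lemma additive_vanishes:
  fixes \<Psi> :: "(('a \<times> 'l) \<Rightarrow>\<^sub>0 int) \<Rightarrow> 'b::ab_group_add"
  assumes \<Psi>: "\<And>f g. \<Psi> (f + g) = \<Psi> f + \<Psi> g"
    and N: "0 \<in> N" "\<And>a b. \<lbrakk>a \<in> N; b \<in> N\<rbrakk> \<Longrightarrow> a + b \<in> N" "\<And>a. a \<in> N \<Longrightarrow> - a \<in> N"
    and rel: "\<And>r. r \<in> Rel \<Longrightarrow> \<Psi> r \<in> N"
    and f: "f \<in> I"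
  shows "\<Psi> f \<in> N"
proof -
  have [simp]: "\<Psi> 0 = 0" using \<Psi>[of 0 0] by simp
  have minus: "\<Psi> (- f) = - \<Psi> f" for f
    using \<Psi>[of f "- f"] by (simp add: eq_neg_iff_add_eq_0 add.commute)
  note mult = formal_mult_add[OF ring_axioms] formal_mult_minus[OF ring_axioms] formal_mult_0[OF ring_axioms]
    formal_mult_pair[OF ring_axioms]
  \<comment> \<open>Quantifying over two-sided multiples makes \<open>M\<close> an ideal at once.
    That it contains the relations need only be checked for pairs, by additivity, and f = 1 f 1 then
    returns the claim for f itself.\<close>
  define M where "M = {f \<in> carrier F. \<forall>g\<in>carrier F. \<forall>h\<in>carrier F. \<Psi> (g \<otimes>\<^bsub>F\<^esub> f \<otimes>\<^bsub>F\<^esub> h) \<in> N}"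
  have "ideal M F"
  proof (rule idealI)
    show "subgroup M (add_monoid F)"
    proof
      fix x y assume "x \<in> M" "y \<in> M"
      then show "x \<otimes>\<^bsub>add_monoid F\<^esub> y \<in> M"
        by (auto simp: M_def mult \<Psi> ring_axioms intro!: N)
    next
      fix x assume x: "x \<in> M"
      have "inv\<^bsub>add_monoid F\<^esub> x = - x"
        using x formal_minus[OF ring_axioms, of x] by (simp add: a_inv_def M_def)
      with x show "inv\<^bsub>add_monoid F\<^esub> x \<in> M"
        by (auto simp: M_def mult minus ring_axioms intro!: N)
    qed (auto simp: M_def mult ring_axioms N)
  next
    fix a x assume "a \<in> M" and x: "x \<in> carrier F"
    then have a: "a \<in> carrier F" "\<And>g h. \<lbrakk>g \<in> carrier F; h \<in> carrier F\<rbrakk> \<Longrightarrow> \<Psi> (g \<otimes>\<^bsub>F\<^esub> a \<otimes>\<^bsub>F\<^esub> h) \<in> N"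
      by (simp_all add: M_def)
    have eq: "g \<otimes>\<^bsub>F\<^esub> (x \<otimes>\<^bsub>F\<^esub> a) \<otimes>\<^bsub>F\<^esub> h = g \<otimes>\<^bsub>F\<^esub> x \<otimes>\<^bsub>F\<^esub> a \<otimes>\<^bsub>F\<^esub> h"
      "g \<otimes>\<^bsub>F\<^esub> (a \<otimes>\<^bsub>F\<^esub> x) \<otimes>\<^bsub>F\<^esub> h = g \<otimes>\<^bsub>F\<^esub> a \<otimes>\<^bsub>F\<^esub> (x \<otimes>\<^bsub>F\<^esub> h)"
      if "g \<in> carrier F" "h \<in> carrier F" for g h
      using that x a(1) by (simp_all only: F.m_assoc F.m_closed)
    show "x \<otimes>\<^bsub>F\<^esub> a \<in> M" "a \<otimes>\<^bsub>F\<^esub> x \<in> M"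
      unfolding M_def mem_Collect_eq using x a(1)
      by (intro conjI ballI; simp only: F.m_closed eq a(2))+
  qed (rule F.ring_axioms)
  moreover have "Rel \<subseteq> M"
  proof
    fix r assume r: "r \<in> Rel"
    have rel_pair: "formal_pair a l \<otimes>\<^bsub>F\<^esub> r \<otimes>\<^bsub>F\<^esub> formal_pair b m \<in> Rel"
      if a: "a \<in> carrier A" and b: "b \<in> carrier A" for a l b m
    proof -
      consider (1) a' b' l' where "r = formal_pair (a' \<oplus> b') l' - (formal_pair a' l' + formal_pair b' l')"
          "a' \<in> carrier A" "b' \<in> carrier A"
        | (2) a' l' m' where "r = formal_pair a' (l' + m') - (formal_pair a' l' + formal_pair a' m')" "a' \<in> carrier A"
        | (3) a' k l' where "r = formal_pair (\<alpha> k \<otimes> a') l' - formal_pair a' (\<beta> k * l')" "a' \<in> carrier A"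
        using r unfolding tensor_relations_def by blast
      then show ?thesis
      proof cases
        case 1
        have "formal_pair a l \<otimes>\<^bsub>F\<^esub> r \<otimes>\<^bsub>F\<^esub> formal_pair b m
          = formal_pair (a \<otimes> a' \<otimes> b \<oplus> a \<otimes> b' \<otimes> b) (l * l' * m)
            - (formal_pair (a \<otimes> a' \<otimes> b) (l * l' * m) + formal_pair (a \<otimes> b' \<otimes> b) (l * l' * m))"
          using a b 1(2,3) by (simp only: 1(1) diff_conv_add_uminus mult l_distr r_distr m_closed)
        moreover have "a \<otimes> a' \<otimes> b \<in> carrier A" "a \<otimes> b' \<otimes> b \<in> carrier A"
          using a b 1(2,3) by simp_all
        ultimately show ?thesis unfolding tensor_relations_def by blast
      next
        case 2
        have "formal_pair a l \<otimes>\<^bsub>F\<^esub> r \<otimes>\<^bsub>F\<^esub> formal_pair b m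
          = formal_pair (a \<otimes> a' \<otimes> b) (l * l' * m + l * m' * m)
            - (formal_pair (a \<otimes> a' \<otimes> b) (l * l' * m) + formal_pair (a \<otimes> a' \<otimes> b) (l * m' * m))"
          by (simp only: 2(1) diff_conv_add_uminus mult distrib_left distrib_right)
        moreover have "a \<otimes> a' \<otimes> b \<in> carrier A"
          using a b 2(2) by simp
        ultimately show ?thesis unfolding tensor_relations_def by blast
      next
        case 3
        have "a \<otimes> (\<alpha> k \<otimes> a') \<otimes> b = (a \<otimes> \<alpha> k) \<otimes> (a' \<otimes> b)"
          using a b 3(2) by (simp add: m_assoc)
        also have "a \<otimes> \<alpha> k = \<alpha> k \<otimes> a" using \<alpha>_central[OF a] ..
        also have "\<alpha> k \<otimes> a \<otimes> (a' \<otimes> b) = \<alpha> k \<otimes> (a \<otimes> a' \<otimes> b)"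
          using a b 3(2) by (simp add: m_assoc)
        finally have *: "a \<otimes> (\<alpha> k \<otimes> a') \<otimes> b = \<alpha> k \<otimes> (a \<otimes> a' \<otimes> b)" .
        have **: "l * (\<beta> k * l') * m = \<beta> k * (l * l' * m)" by (simp only: ac_simps)
        have "formal_pair a l \<otimes>\<^bsub>F\<^esub> r \<otimes>\<^bsub>F\<^esub> formal_pair b m
          = formal_pair (\<alpha> k \<otimes> (a \<otimes> a' \<otimes> b)) (l * l' * m) - formal_pair (a \<otimes> a' \<otimes> b) (\<beta> k * (l * l' * m))"
          by (simp only: 3(1) diff_conv_add_uminus mult * **)
        moreover have "a \<otimes> a' \<otimes> b \<in> carrier A"
          using a b 3(2) by simp
        ultimately show ?thesis unfolding tensor_relations_def by blast
      qed
    qed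
    have "\<Psi> (g \<otimes>\<^bsub>F\<^esub> r \<otimes>\<^bsub>F\<^esub> h) \<in> N" if "g \<in> carrier F" "h \<in> carrier F" for g h
      using that(1)
    proof (induction g rule: formal_sums_induct[OF ring_axioms, consumes 1, case_names zero pair add minus])
      case (pair a l)
      note a = this
      show ?case using that(2)
      proof (induction h rule: formal_sums_induct[OF ring_axioms, consumes 1, case_names zero pair add minus])
        case (pair b m)
        show ?case by (rule rel[OF rel_pair[OF a pair]])
      qed (simp_all add: mult \<Psi> minus N)
    qed (simp_all add: mult \<Psi> minus N)
    then show "r \<in> M" using r Rel_closed by (auto simp: M_def)
  qed
  ultimately have "I \<subseteq> M"
    unfolding tensor_ideal_def by (rule F.genideal_minimal)
  then have "f \<in> carrier F" "\<Psi> (\<one>\<^bsub>F\<^esub> \<otimes>\<^bsub>F\<^esub> f \<otimes>\<^bsub>F\<^esub> \<one>\<^bsub>F\<^esub>) \<in> N"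
    using f F.one_closed unfolding M_def by blast+
  then show ?thesis by simp
qed

end

section \<open>Maps f \<otimes> g between tensor products\<close>

definition formal_map :: "('a \<Rightarrow> 'b) \<Rightarrow> ('l \<Rightarrow> 'm) \<Rightarrow> (('a \<times> 'l) \<Rightarrow>\<^sub>0 int) \<Rightarrow> (('b \<times> 'm) \<Rightarrow>\<^sub>0 int)" where
  "formal_map f g s = (\<Sum>u\<in>Poly_Mapping.keys s. Poly_Mapping.single (f (fst u), g (snd u)) (Poly_Mapping.lookup s u))"

lemma formal_map_add: "formal_map f g (s + t) = formal_map f g s + formal_map f g t"
  unfolding formal_map_def by (rule setsum_keys_plus_distrib) (simp_all add: single_add)

lemma formal_map_0 [simp]: "formal_map f g 0 = 0"
  by (simp add: formal_map_def)

lemma formal_map_minus: "formal_map f g (- s) = - formal_map f g s"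
  using formal_map_add[of f g s "- s"] by (simp add: eq_neg_iff_add_eq_0 add.commute)

lemma formal_map_diff: "formal_map f g (s - t) = formal_map f g s - formal_map f g t"
  using formal_map_add[of f g s "- t"] by (simp add: formal_map_minus)

lemma formal_map_pair [simp]: "formal_map f g (formal_pair a l) = formal_pair (f a) (g l)"
  by (simp add: formal_map_def)

text \<open>Kept apart from \<open>tensor_hom\<close> because the coordinate functions on K_p are
  linear but not multiplicative.\<close>

locale tensor_linear = A: tensor_factors A \<alpha> \<beta> + B: tensor_factors B \<alpha>' \<beta>'
  for A :: "('a, 'm) ring_scheme" and \<alpha> :: "'k \<Rightarrow> 'a" and \<beta> :: "'k \<Rightarrow> 'l::comm_ring_1"
    and B :: "('b, 'n) ring_scheme" and \<alpha>' :: "'k \<Rightarrow> 'b" and \<beta>' :: "'k \<Rightarrow> 'r::comm_ring_1" +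
  fixes f :: "'a \<Rightarrow> 'b" and g :: "'l \<Rightarrow> 'r"
  assumes f_closed: "a \<in> carrier A \<Longrightarrow> f a \<in> carrier B"
    and f_add: "\<lbrakk>a \<in> carrier A; b \<in> carrier A\<rbrakk> \<Longrightarrow> f (a \<oplus>\<^bsub>A\<^esub> b) = f a \<oplus>\<^bsub>B\<^esub> f b"
    and f_scale: "a \<in> carrier A \<Longrightarrow> f (\<alpha> k \<otimes>\<^bsub>A\<^esub> a) = \<alpha>' k \<otimes>\<^bsub>B\<^esub> f a"
    and g_add: "g (l + m) = g l + g m"
    and g_scale: "g (\<beta> k * l) = \<beta>' k * g l"
begin

abbreviation tmap where "tmap \<equiv> tensor_map B \<alpha>' \<beta>' f g"

lemma formal_map_closed: "s \<in> carrier A.F \<Longrightarrow> formal_map f g s \<in> carrier B.F"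
  by (induction s rule: formal_sums_induct[OF A.ring_axioms, consumes 1, case_names zero pair add minus])
    (simp_all add: formal_map_add formal_map_minus B.ring_axioms f_closed)

lemma formal_map_ideal: "s \<in> A.I \<Longrightarrow> formal_map f g s \<in> B.I"
proof (rule A.additive_vanishes[of "formal_map f g" B.I])
  show "0 \<in> B.I" using B.I.zero_closed by (simp add: B.ring_axioms)
  show "a + b \<in> B.I" if "a \<in> B.I" "b \<in> B.I" for a b
    using B.I.a_closed[OF that] by (simp add: B.ring_axioms)
  show "- a \<in> B.I" if "a \<in> B.I" for a
    using B.I.a_inv_closed[OF that] B.I.Icarr[OF that] by (simp add: B.ring_axioms)
  show "formal_map f g r \<in> B.I" if "r \<in> A.Rel" for r
  proof (rule B.Rel_I)
    show "formal_map f g r \<in> B.Rel"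
      using that unfolding tensor_relations_def
      by (auto simp: formal_map_add formal_map_diff f_add f_scale g_add g_scale) (use f_closed in blast)+
  qed
qed (rule formal_map_add)

text \<open>Two representatives of a coset differ by an element of \<open>A.I\<close>, which
  \<open>formal_map\<close> sends into \<open>B.I\<close>; so the union in \<open>tensor_map\<close>
  runs over a single coset.\<close>

lemma tmap_coset: "s \<in> carrier A.F \<Longrightarrow> tmap (A.coset s) = B.coset (formal_map f g s)"
proof -
  assume s: "s \<in> carrier A.F"
  have "B.coset (formal_map f g s') = B.coset (formal_map f g s)" if s': "s' \<in> A.coset s" for s'
  proof (rule B.coset_eqI)
    obtain i where i: "i \<in> A.I" "s' = i + s"
      using s' by (auto simp: a_r_coset_def' A.ring_axioms)
    have "i \<in> carrier A.F" using i(1) A.I.Icarr by blast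
    with s i(2) show "formal_map f g s' \<in> carrier B.F"
      by (intro formal_map_closed) (simp add: A.ring_axioms)
    show "formal_map f g s \<in> carrier B.F" by (rule formal_map_closed[OF s])
    show "formal_map f g s' - formal_map f g s \<in> B.I"
      using formal_map_ideal[OF i(1)] by (simp add: i(2) formal_map_add)
  qed
  moreover have "s \<in> A.coset s"
    by (rule A.I.a_rcos_self[OF s])
  ultimately show ?thesis
    unfolding tensor_map_def formal_map_def[symmetric] by blast
qed

lemma tmap_el [simp]: "a \<in> carrier A \<Longrightarrow> tmap (A.el a l) = B.el (f a) (g l)"
  unfolding tensor_elem_def by (simp add: tmap_coset A.ring_axioms)

lemma tmap_closed [simp]: "V \<in> carrier A.T \<Longrightarrow> tmap V \<in> carrier B.T"
  using A.carrier_T[of V] by (auto simp: tmap_coset formal_map_closed)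

lemma tmap_add:
  assumes "V \<in> carrier A.T" "W \<in> carrier A.T"
  shows "tmap (V \<oplus>\<^bsub>A.T\<^esub> W) = tmap V \<oplus>\<^bsub>B.T\<^esub> tmap W"
proof -
  obtain s t where st: "s \<in> carrier A.F" "t \<in> carrier A.F" "V = A.coset s" "W = A.coset t"
    using assms A.carrier_T by meson
  have "A.coset s \<oplus>\<^bsub>A.T\<^esub> A.coset t = A.coset (s + t)"
    using A.coset.hom_add[of s t] st by (simp add: A.ring_axioms)
  then show ?thesis
    using B.coset.hom_add[OF formal_map_closed[OF st(1)] formal_map_closed[OF st(2)]] st
    by (simp add: tmap_coset formal_map_add A.ring_axioms B.ring_axioms)
qed

lemma tmap_zero [simp]: "tmap \<zero>\<^bsub>A.T\<^esub> = \<zero>\<^bsub>B.T\<^esub>"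
  using tmap_add[of "\<zero>\<^bsub>A.T\<^esub>" "\<zero>\<^bsub>A.T\<^esub>"] B.T.add.r_cancel_one[of "tmap \<zero>\<^bsub>A.T\<^esub>" "tmap \<zero>\<^bsub>A.T\<^esub>"] by simp

end

locale tensor_hom = tensor_linear +
  assumes f_mult: "\<lbrakk>a \<in> carrier A; b \<in> carrier A\<rbrakk> \<Longrightarrow> f (a \<otimes>\<^bsub>A\<^esub> b) = f a \<otimes>\<^bsub>B\<^esub> f b"
    and f_one: "f \<one>\<^bsub>A\<^esub> = \<one>\<^bsub>B\<^esub>"
    and g_mult: "g (l * m) = g l * g m" and g_one: "g 1 = 1"
begin

lemma tmap_mult:
  assumes "V \<in> carrier A.T" "W \<in> carrier A.T"
  shows "tmap (V \<otimes>\<^bsub>A.T\<^esub> W) = tmap V \<otimes>\<^bsub>B.T\<^esub> tmap W"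
  using assms(1)
proof (induction V rule: A.tensor_induct)
  case (el a l)
  show ?case using assms(2)
    by (induction W rule: A.tensor_induct)
      (use el in \<open>simp_all add: A.el_mult B.el_mult f_mult g_mult f_closed tmap_add A.T.r_distr B.T.r_distr\<close>)
qed (use assms(2) in \<open>simp_all add: tmap_add A.T.l_distr B.T.l_distr\<close>)

lemma tmap_hom: "tmap \<in> ring_hom A.T B.T"
  by (intro ring_hom_memI) (simp_all add: tmap_mult tmap_add A.one_T B.one_T f_one g_one)

sublocale tmap: ring_hom_ring A.T B.T tmap
  by (intro ring_hom_ringI2 A.T.ring_axioms B.T.ring_axioms tmap_hom)

end

section \<open>Substitution into rational functions\<close>

definition subst_poly :: "'k::field poly poly fract \<Rightarrow> 'k poly \<Rightarrow> 'k poly poly fract" where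
  "subst_poly t a = poly (map_poly const_xy a) t"

lemma const_xy_0 [simp]: "const_xy 0 = 0" and const_xy_1 [simp]: "const_xy 1 = 1"
  by (simp_all add: const_xy_def Zero_fract_def One_fract_def one_pCons)

lemma const_xy_add: "const_xy (a + b) = const_xy a + const_xy b"
  and const_xy_mult: "const_xy (a * b) = const_xy a * const_xy b"
  by (simp_all add: const_xy_def)

lemma subst_poly_0 [simp]: "subst_poly t 0 = 0"
  by (simp add: subst_poly_def)

lemma subst_poly_pCons [simp]: "subst_poly t (pCons c a) = const_xy c + t * subst_poly t a"
  by (simp add: subst_poly_def map_poly_pCons)

lemma subst_poly_add: "subst_poly t (a + b) = subst_poly t a + subst_poly t b"
  by (induction a b rule: poly_induct2) (simp_all add: const_xy_add algebra_simps)

lemma subst_poly_smult: "subst_poly t (smult c a) = const_xy c * subst_poly t a"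
  by (induction a) (simp_all add: const_xy_mult algebra_simps)

lemma subst_poly_mult: "subst_poly t (a * b) = subst_poly t a * subst_poly t b"
  by (induction a) (simp_all add: subst_poly_add subst_poly_smult algebra_simps)

lemma subst_poly_1 [simp]: "subst_poly t 1 = 1"
  by (simp add: one_pCons)

abbreviation poly_xy :: "'k::field poly poly \<Rightarrow> 'k poly poly fract" where "poly_xy F \<equiv> Fract F 1"

lemma poly_xy_eq_0_iff [simp]: "poly_xy F = 0 \<longleftrightarrow> F = 0"
  by (simp add: Zero_fract_def eq_fract)

text \<open>Specialising \<open>y\<close> to a non-zero polynomial in \<open>x\<close> turns the numerator of \<open>b(t)\<close> into a
  multiple of \<open>b\<close>.\<close>

lemma transcendentalI:
  fixes t :: "'k::field poly poly fract"
  assumes t: "t * y_xy ^ d = poly_xy U" "poly U e = e ^ d * [:0, 1:]" and e: "e \<noteq> 0" and b: "b \<noteq> 0"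
  shows "subst_poly t b \<noteq> 0"
proof -
  have "\<exists>N Q. subst_poly t b * y_xy ^ N = poly_xy Q \<and> poly Q e = e ^ N * b"
  proof (induction b)
    case 0
    show ?case by (intro exI[of _ 0]) (simp add: Zero_fract_def)
  next
    case (pCons c b)
    then obtain N Q where Q: "subst_poly t b * y_xy ^ N = poly_xy Q" "poly Q e = e ^ N * b"
      by blast
    have pow: "y_xy ^ m = poly_xy ([:0, 1:] ^ m)" for m
      by (induction m) (simp_all add: y_xy_def One_fract_def)
    have "subst_poly t (pCons c b) * y_xy ^ (N + d) = const_xy c * y_xy ^ (N + d) + (t * y_xy ^ d) * (subst_poly t b * y_xy ^ N)"
      by (simp add: algebra_simps power_add)
    also have "\<dots> = const_xy c * y_xy ^ (N + d) + poly_xy U * poly_xy Q"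
      by (simp only: t(1) Q(1))
    also have "\<dots> = poly_xy ([:[:c:]:] * [:0, 1:] ^ (N + d) + U * Q)"
      unfolding pow const_xy_def by simp
    finally show ?case
      using Q(2) t(2) by (intro exI[of _ "N + d"] exI) (auto simp: poly_power power_add algebra_simps)
  qed
  then obtain N Q where Q: "subst_poly t b * y_xy ^ N = poly_xy Q" "poly Q e = e ^ N * b"
    by blast
  show ?thesis
  proof
    assume "subst_poly t b = 0"
    then have "Q = 0" using Q(1) by simp
    then show False using Q(2) e b by simp
  qed
qed

definition transcendental :: "'k::field poly poly fract \<Rightarrow> bool" where
  "transcendental t \<longleftrightarrow> (\<forall>b. b \<noteq> 0 \<longrightarrow> subst_poly t b \<noteq> 0)"

lemma transcendental_x: "transcendental (x_xy :: 'k::field poly poly fract)"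
  and transcendental_y: "transcendental (y_xy :: 'k poly poly fract)"
  and transcendental_xy: "transcendental (x_xy * y_xy :: 'k poly poly fract)"
  and transcendental_xdivy: "transcendental (x_xy / y_xy :: 'k poly poly fract)"
proof -
  have y: "(y_xy :: 'k poly poly fract) \<noteq> 0"
    by (simp add: y_xy_def Zero_fract_def eq_fract)
  \<comment> \<open>\<open>U\<close> is the numerator of t over y^d, so d = 1 only for x/y. Setting
    y to 1 leaves x in each case except t = y, where y is set to x.\<close>
  show "transcendental (x_xy :: 'k poly poly fract)"
    unfolding transcendental_def
    by (intro allI impI transcendentalI[where d = 0 and U = "[:[:0, 1:]:]" and e = "1"]) (simp_all add: x_xy_def)
  show "transcendental (y_xy :: 'k poly poly fract)"
    unfolding transcendental_def
    by (intro allI impI transcendentalI[where d = 0 and U = "[:0, 1:]" and e = "[:0, 1:]"]) (simp_all add: y_xy_def)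
  show "transcendental (x_xy * y_xy :: 'k poly poly fract)"
    unfolding transcendental_def
    by (intro allI impI transcendentalI[where d = 0 and U = "[:0, [:0, 1:]:]" and e = "1"]) (simp_all add: y_xy_def x_xy_def)
  show "transcendental (x_xy / y_xy :: 'k poly poly fract)"
    unfolding transcendental_def
    by (intro allI impI transcendentalI[where d = 1 and U = "[:[:0, 1:]:]" and e = "1"]) (simp_all add: x_xy_def y)
qed

context
  fixes t :: "'k::field poly poly fract"
  assumes t: "transcendental t"
begin

lemma subst_poly_eq_0_iff [simp]: "subst_poly t b = 0 \<longleftrightarrow> b = 0"
  using t by (auto simp: transcendental_def)

lemma rat_subst_Fract: "b \<noteq> 0 \<Longrightarrow> rat_subst t (Fract a b) = subst_poly t a / subst_poly t b"
proof -
  assume b: "b \<noteq> 0"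
  show ?thesis
    unfolding rat_subst_def subst_poly_def[symmetric]
  proof (rule the_equality)
    fix v assume "\<exists>a' b'. Fract a b = Fract a' b' \<and> b' \<noteq> 0 \<and> subst_poly t b' \<noteq> 0 \<and> v = subst_poly t a' / subst_poly t b'"
    then obtain a' b' where *: "Fract a b = Fract a' b'" "b' \<noteq> 0" "v = subst_poly t a' / subst_poly t b'"
      by blast
    have "a * b' = a' * b" using *(1,2) b by (simp add: eq_fract)
    then have "subst_poly t a * subst_poly t b' = subst_poly t a' * subst_poly t b"
      by (simp flip: subst_poly_mult)
    then show "v = subst_poly t a / subst_poly t b" using *(2,3) b by (simp add: frac_eq_eq)
  qed (use b in auto)
qed

lemma rat_subst_add: "rat_subst t (r + s) = rat_subst t r + rat_subst t s"
  by (cases r, cases s) (simp add: rat_subst_Fract subst_poly_add subst_poly_mult add_frac_eq mult.commute)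

lemma rat_subst_mult: "rat_subst t (r * s) = rat_subst t r * rat_subst t s"
  by (cases r, cases s) (simp add: rat_subst_Fract subst_poly_mult)

lemma rat_subst_1 [simp]: "rat_subst t 1 = 1"
  by (simp add: One_fract_def rat_subst_Fract)

lemma rat_subst_0 [simp]: "rat_subst t 0 = 0"
  using rat_subst_add[of 0 0] by (metis add_0 add_cancel_left_left)

lemma rat_subst_const [simp]: "rat_subst t (const_x c) = const_xy c"
  by (simp add: const_x_def rat_subst_Fract)

lemma rat_subst_var [simp]: "rat_subst t var_x = t"
  by (simp add: var_x_def rat_subst_Fract)

lemma rat_subst_inverse: "rat_subst t (inverse r) = inverse (rat_subst t r)"
proof (cases "r = 0")
  case False
  then show ?thesis
    using rat_subst_mult[of "inverse r" r] by (intro inverse_unique[symmetric]) (simp add: mult.commute)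
qed simp

lemma rat_subst_minus: "rat_subst t (- r) = - rat_subst t r"
  using rat_subst_add[of r "- r"] by (simp add: eq_neg_iff_add_eq_0 add.commute)

lemma rat_subst_diff: "rat_subst t (r - s) = rat_subst t r - rat_subst t s"
  using rat_subst_add[of r "- s"] by (simp add: rat_subst_minus)

lemma transcendental_nonzero: "t \<noteq> 0" "t * t - 1 \<noteq> 0"
proof -
  show "t \<noteq> 0" using subst_poly_eq_0_iff[of "[:0, 1:]"] by simp
  have "const_xy (- 1 :: 'k) = - 1" using const_xy_add[of "1 :: 'k" "- 1"] by (simp add: eq_neg_iff_add_eq_0 add.commute)
  then show "t * t - 1 \<noteq> 0" using subst_poly_eq_0_iff[of "[:- 1, 0, 1:]"] by simp
qed

end

section \<open>The cyclotomic quotient of the affine Hecke algebra\<close>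

lemma scalar_simps:
  "scalar (a + b) = scalar a + scalar b" "scalar (a * b) = scalar a * scalar b" "scalar 1 = 1" "scalar 0 = 0"
  "scalar (- a) = - scalar a"
  by (simp_all add: scalar_def single_add mult_single single_uminus)

lemma scalar_central: "scalar a * f = f * scalar a"
  by (induction f rule: poly_mapping_induct) (simp_all add: scalar_def mult_single mult.commute algebra_simps)

locale hecke_quotient =
  fixes w :: "'z::comm_ring_1" and p :: "'z poly"
begin

sublocale free_ring: ring "free_ring :: (gen_word \<Rightarrow>\<^sub>0 'z) ring"
  by (rule ring_ring_of_type_algebra)

sublocale hecke_ideal: ideal "hecke_ideal w" free_ring
  unfolding hecke_ideal_def by (rule free_ring.genideal_ideal) simp

sublocale hecke: ring "hecke w"
  unfolding hecke_def by (rule hecke_ideal.quotient_is_ring)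

sublocale hecke_of: ring_hom_ring free_ring "hecke w" "hecke_of w"
  unfolding hecke_def hecke_of_def by (rule hecke_ideal.rcos_ring_hom_ring)

lemma hecke_of_closed [simp]: "hecke_of w f \<in> carrier (hecke w)"
  by (rule hecke_of.hom_closed) simp

sublocale hecke_p_ideal: ideal "hecke_p_ideal w p" "hecke w"
  unfolding hecke_p_ideal_def by (rule hecke.genideal_ideal) simp

sublocale hecke_p: ring "hecke_p w p"
  unfolding hecke_p_def by (rule hecke_p_ideal.quotient_is_ring)

lemma hecke_p_of_hom: "ring_hom_ring free_ring (hecke_p w p) (hecke_p_of w p)"
proof -
  have "(+>\<^bsub>hecke w\<^esub>) (hecke_p_ideal w p) \<circ> hecke_of w \<in> ring_hom free_ring (hecke_p w p)"
    using ring_hom_trans[OF hecke_of.homh hecke_p_ideal.rcos_ring_hom] unfolding hecke_p_def .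
  then have "hecke_p_of w p \<in> ring_hom free_ring (hecke_p w p)"
    by (simp add: hecke_p_of_def[abs_def] comp_def)
  then show ?thesis
    by (intro ring_hom_ringI2 free_ring.ring_axioms hecke_p.ring_axioms)
qed

sublocale hecke_p_of: ring_hom_ring free_ring "hecke_p w p" "hecke_p_of w p"
  by (rule hecke_p_of_hom)

lemma hecke_p_of_simps [simp]:
  "hecke_p_of w p f \<in> carrier (hecke_p w p)"
  "hecke_p_of w p (f + g) = hecke_p_of w p f \<oplus>\<^bsub>hecke_p w p\<^esub> hecke_p_of w p g"
  "hecke_p_of w p (f * g) = hecke_p_of w p f \<otimes>\<^bsub>hecke_p w p\<^esub> hecke_p_of w p g"
  "hecke_p_of w p 1 = \<one>\<^bsub>hecke_p w p\<^esub>" "hecke_p_of w p 0 = \<zero>\<^bsub>hecke_p w p\<^esub>"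
  "hecke_p_of w p (- f) = \<ominus>\<^bsub>hecke_p w p\<^esub> hecke_p_of w p f"
  using hecke_p_of.hom_closed[of f] hecke_p_of.hom_add[of f g] hecke_p_of.hom_mult[of f g]
    hecke_p_of.hom_one hecke_p_of.hom_zero hecke_p_of.hom_a_inv[of f] by simp_all

lemma hecke_p_of_diff: "hecke_p_of w p (f - g) = hecke_p_of w p f \<ominus>\<^bsub>hecke_p w p\<^esub> hecke_p_of w p g"
  using hecke_p_of_simps(2)[of f "- g"] by (simp add: a_minus_def)

lemma hecke_p_of_surj: "a \<in> carrier (hecke_p w p) \<Longrightarrow> \<exists>f. a = hecke_p_of w p f"
  unfolding hecke_p_def hecke_p_of_def FactRing_def A_RCOSETS_def' partial_object.simps
  by (auto simp: hecke_def hecke_of_def FactRing_def A_RCOSETS_def')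

lemma hecke_p_of_eq:
  assumes "f - g \<in> hecke_ideal w" shows "hecke_p_of w p f = hecke_p_of w p g"
proof -
  have "hecke_of w f = hecke_of w g"
    using free_ring.quotient_eq_iff_same_a_r_cos[OF hecke_ideal.ideal_axioms, of f g] assms
    by (simp add: hecke_of_def)
  then show ?thesis by (simp add: hecke_p_of_def)
qed

lemma hecke_relations:
  "letter GenR * letter GenR - (scalar w * letter GenR + 1) \<in> hecke_ideal w"
  "letter GenR * letter GenK * letter GenR * letter GenK
    - letter GenK * letter GenR * letter GenK * letter GenR \<in> hecke_ideal w"
  using free_ring.genideal_self[of "{letter GenR * letter GenR - (scalar w * letter GenR + 1),
      letter GenR * letter GenK * letter GenR * letter GenK
        - letter GenK * letter GenR * letter GenK * letter GenR}"]
  unfolding hecke_ideal_def by simp_all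

lemma hecke_p_relations:
  "hecke_p_of w p (letter GenR * letter GenR) = hecke_p_of w p (scalar w * letter GenR + 1)"
  "hecke_p_of w p (letter GenR * letter GenK * letter GenR * letter GenK)
    = hecke_p_of w p (letter GenK * letter GenR * letter GenK * letter GenR)"
  by (rule hecke_p_of_eq, rule hecke_relations)+

lemma hecke_p_eval: "hecke_p_of w p (eval_K p) = \<zero>\<^bsub>hecke_p w p\<^esub>"
proof -
  have "hecke_of w (eval_K p) \<in> hecke_p_ideal w p"
    unfolding hecke_p_ideal_def by (rule hecke.genideal_self') simp
  then show ?thesis
    unfolding hecke_p_of_def by (simp add: hecke_p_ideal.a_rcos_const hecke_p_def FactRing_def)
qed

text \<open>The universal property of the two-stage quotient: an ideal of the free algebra
  containing all relations contains everything that dies in H_p. It serves to show that H_p is large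
  enough.\<close>

lemma hecke_p_of_kernel:
  assumes N: "ideal N free_ring"
    and "letter GenR * letter GenR - (scalar w * letter GenR + 1) \<in> N"
    and "letter GenR * letter GenK * letter GenR * letter GenK
        - letter GenK * letter GenR * letter GenK * letter GenR \<in> N"
    and "eval_K p \<in> N" and f: "hecke_p_of w p f = \<zero>\<^bsub>hecke_p w p\<^esub>"
  shows "f \<in> N"
proof -
  interpret N: ideal N free_ring by (rule N)
  have sub: "hecke_ideal w \<subseteq> N"
    unfolding hecke_ideal_def by (rule free_ring.genideal_minimal[OF N]) (use assms in simp)
  have "ideal (hecke_of w ` N) (hecke w)"
    unfolding hecke_def hecke_of_def by (rule free_ring.ring_ideal_imp_quot_ideal[OF hecke_ideal.ideal_axioms N])
  then have "hecke_p_ideal w p \<subseteq> hecke_of w ` N"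
    unfolding hecke_p_ideal_def by (rule hecke.genideal_minimal) (use assms in simp)
  moreover have "hecke_of w f \<in> hecke_p_ideal w p"
    using f hecke_p_ideal.rcos_const_imp_mem[of "hecke_of w f"]
    by (simp add: hecke_p_of_def hecke_p_def FactRing_def)
  ultimately obtain g where g: "g \<in> N" "hecke_of w f = hecke_of w g" by blast
  have "f - g \<in> hecke_ideal w"
    using free_ring.quotient_eq_iff_same_a_r_cos[OF hecke_ideal.ideal_axioms, of f g] g(2)
    by (simp add: hecke_of_def)
  then show ?thesis
    using N.a_closed[of "f - g" g] sub g(1) by auto
qed

lemma scalar_p_central:
  "a \<in> carrier (hecke_p w p) \<Longrightarrow> scalar_p w p c \<otimes>\<^bsub>hecke_p w p\<^esub> a = a \<otimes>\<^bsub>hecke_p w p\<^esub> scalar_p w p c"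
  using hecke_p_of_surj[of a] scalar_central[of c] by (auto simp flip: hecke_p_of_simps(3))

lemma inv_R_p: "inv\<^bsub>hecke_p w p\<^esub> (R_p w p) = R_p w p \<ominus>\<^bsub>hecke_p w p\<^esub> scalar_p w p w"
proof -
  have 1: "hecke_p_of w p (letter GenR * (letter GenR - scalar w)) = \<one>\<^bsub>hecke_p w p\<^esub>"
    using hecke_p_of_eq[of "letter GenR * (letter GenR - scalar w)" 1] hecke_relations(1)
    by (simp add: algebra_simps scalar_central del: hecke_p_of_simps(2,3,6))
  moreover have "letter GenR * (letter GenR - scalar w) = (letter GenR - scalar w) * letter GenR"
    by (simp add: algebra_simps scalar_central)
  ultimately have "hecke_p_of w p ((letter GenR - scalar w) * letter GenR) = \<one>\<^bsub>hecke_p w p\<^esub>"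
    by simp
  with 1 have "inv\<^bsub>hecke_p w p\<^esub> (R_p w p) = hecke_p_of w p (letter GenR - scalar w)"
    unfolding hecke_p_of_simps(3) by (intro hecke_p.inv_unique'[symmetric] hecke_p_of_simps(1))
  then show ?thesis
    by (simp add: hecke_p_of_diff)
qed

lemma hecke_p_power: "K_p w p [^]\<^bsub>hecke_p w p\<^esub> (m :: nat) = hecke_p_of w p (letter GenK ^ m)"
  by (induction m) (simp_all add: power_Suc2 del: power_Suc)

lemma alg_K_generators: "insert (K_p w p) (range (scalar_p w p)) \<subseteq> carrier (hecke_p w p)"
  by auto

sublocale alg_K: ring "alg_K w p"
  unfolding alg_K_def by (rule hecke_p.generate_ring_is_ring[OF alg_K_generators])

lemma alg_K_simps [simp]:
  "a \<oplus>\<^bsub>alg_K w p\<^esub> b = a \<oplus>\<^bsub>hecke_p w p\<^esub> b" "a \<otimes>\<^bsub>alg_K w p\<^esub> b = a \<otimes>\<^bsub>hecke_p w p\<^esub> b"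
  "\<one>\<^bsub>alg_K w p\<^esub> = \<one>\<^bsub>hecke_p w p\<^esub>" "\<zero>\<^bsub>alg_K w p\<^esub> = \<zero>\<^bsub>hecke_p w p\<^esub>"
  by (simp_all add: alg_K_def)

lemma alg_K_carrier: "a \<in> carrier (alg_K w p) \<Longrightarrow> a \<in> carrier (hecke_p w p)"
  using hecke_p.generate_ring_incl[OF alg_K_generators] by (auto simp: alg_K_def)

lemma scalar_p_alg_K [simp]: "scalar_p w p c \<in> carrier (alg_K w p)"
  and K_p_alg_K [simp]: "K_p w p \<in> carrier (alg_K w p)"
  by (auto simp: alg_K_def intro: generate_ring.incl)

lemma alg_K_power: "a [^]\<^bsub>alg_K w p\<^esub> (m :: nat) = a [^]\<^bsub>hecke_p w p\<^esub> m"
  by (induction m) simp_all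

end

section \<open>The solution\<close>

text \<open>The Horner stages of P: \<open>char_poly A i\<close> is u^i - A_0 u^(i-1) - ... -
  A_(i-1), so that P = -p is stage n + 1 and the recursion for \<phi>_i evaluates stage i at \<xi>
  x.\<close>

primrec char_poly :: "(nat \<Rightarrow> 'c::comm_ring_1) \<Rightarrow> nat \<Rightarrow> 'c poly" where
  "char_poly A 0 = 1"
| "char_poly A (Suc i) = pCons (- A i) (char_poly A i)"

lemma cyc_poly_Suc: "cyc_poly (Suc n) A = pCons (A (Suc n)) (cyc_poly n A)"
proof -
  have "(\<Sum>i\<le>n. monom (A i) (Suc n - i)) = pCons 0 (\<Sum>i\<le>n. monom (A i) (n - i))"
  proof -
    have "(\<Sum>i\<le>n. monom (A i) (Suc n - i)) = (\<Sum>i\<le>n. [:0, 1:] * monom (A i) (n - i))"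
      by (intro sum.cong) (auto simp: Suc_diff_le monom_Suc)
    also have "\<dots> = [:0, 1:] * (\<Sum>i\<le>n. monom (A i) (n - i))"
      by (simp only: sum_distrib_left)
    finally show ?thesis by simp
  qed
  then show ?thesis by (simp add: cyc_poly_def monom_Suc monom_0)
qed

lemma cyc_poly_eq: "cyc_poly n A = - char_poly A (Suc n)"
proof (induction n)
  case 0
  show ?case by (simp add: cyc_poly_def monom_Suc monom_0 one_pCons)
qed (simp add: cyc_poly_Suc)

context central_algebra
begin

lemma ev_altdef: "ev K f = (\<Sum>i\<le>degree f. c (coeff f i) * K ^ i)"
proof (induction f)
  case (pCons a f)
  show ?case
  proof (cases "f = 0")
    case False
    then show ?thesis
      using pCons by (simp add: degree_pCons_eq sum.atMost_Suc_shift sum_distrib_right mult.assoc power_Suc2 del: power_Suc sum.atMost_Suc)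
  qed simp
qed simp

text \<open>The coefficients of a synthetic division are the successive Horner values. The extra
  factor \<open>K\<close> fits the sum in K(x), which stops at K^1 and treats the constant term
  separately.\<close>

lemma ev_synthetic_div_char_poly:
  "ev K (synthetic_div (char_poly A m) a) * K = (\<Sum>i\<in>{0..<m}. c (poly (char_poly A i) a) * K ^ (m - i))"
proof (induction m)
  case (Suc m)
  have "(\<Sum>i\<in>{0..<m}. c (poly (char_poly A i) a) * K ^ (Suc m - i))
      = (\<Sum>i\<in>{0..<m}. c (poly (char_poly A i) a) * K ^ (m - i)) * K"
    by (simp add: sum_distrib_right mult.assoc Suc_diff_le power_Suc2 del: power_Suc)
  then show ?case by (simp add: distrib_right flip: Suc.IH)
qed (simp add: one_pCons)

end

section \<open>Evaluation of the free algebra over \<zz>[x, y] in H_p(x, y)\<close>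

locale hecke_spectral = hecke_quotient w p for w :: "'z::comm_ring_1" and p :: "'z poly" +
  fixes \<iota> :: "'k::field \<Rightarrow> 'z"
begin

abbreviation \<alpha> where "\<alpha> \<equiv> \<lambda>k. scalar_p w p (\<iota> k)"

sublocale Hxy: tensor_factors "hecke_p w p" \<alpha> const_xy
  by unfold_locales (simp_all add: scalar_p_central)

sublocale Hx: tensor_factors "hecke_p w p" \<alpha> const_x
  by unfold_locales (simp_all add: scalar_p_central)

sublocale Kx: tensor_factors "alg_K w p" \<alpha> const_x
  by unfold_locales (simp_all add: scalar_p_central alg_K_carrier)

sublocale Z: tensor_factors "ring_of_type_algebra :: 'z ring" \<iota> const_x
  by (intro tensor_factors.intro tensor_factors_axioms.intro ring_ring_of_type_algebra) (simp_all add: mult.commute)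

sublocale scalar_x: tensor_hom "ring_of_type_algebra :: 'z ring" \<iota> const_x "alg_K w p" \<alpha> const_x "scalar_p w p" id
  by unfold_locales (simp_all add: scalar_simps)

lemma spec_subst_H:
  "transcendental t \<Longrightarrow> tensor_hom (hecke_p w p) \<alpha> const_x (hecke_p w p) \<alpha> const_xy id (rat_subst t)"
  by unfold_locales (simp_all add: rat_subst_add rat_subst_mult)

lemma spec_subst_K:
  "transcendental t \<Longrightarrow> tensor_hom (alg_K w p) \<alpha> const_x (hecke_p w p) \<alpha> const_xy id (rat_subst t)"
  by unfold_locales (simp_all add: rat_subst_add rat_subst_mult alg_K_carrier)

abbreviation S where "S \<equiv> Hxy.T"
abbreviation el where "el \<equiv> Hxy.el"
abbreviation one_H where "one_H \<equiv> \<one>\<^bsub>hecke_p w p\<^esub>"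

lemma el_one_central: "V \<in> carrier S \<Longrightarrow> el one_H l \<otimes>\<^bsub>S\<^esub> V = V \<otimes>\<^bsub>S\<^esub> el one_H l"
  by (rule Hxy.central_T) simp_all

lemma el_scalar_central: "V \<in> carrier S \<Longrightarrow> el (scalar_p w p z) l \<otimes>\<^bsub>S\<^esub> V = V \<otimes>\<^bsub>S\<^esub> el (scalar_p w p z) l"
  by (rule Hxy.central_T) (simp_all add: scalar_p_central)

text \<open>Computations take place in the free algebra on \<open>R\<close> and \<open>K\<close> over \<open>\<zz>[x, y]\<close>, modulo the kernel of
  its evaluation in \<open>\<H>\<^sub>p(x, y)\<close>; denominators become central units of the latter.\<close>

sublocale coeffs: monoid_algebra_hom S "\<lambda>z. el (scalar_p w p z) 1"
  "\<lambda>ij :: nat \<times> nat. el one_H (x_xy ^ fst ij * y_xy ^ snd ij)"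
  by unfold_locales
    (auto simp: Hxy.el_mult Hxy.one_T scalar_simps Hxy.el_add_left power_add ac_simps el_one_central intro!: ring_hom_memI)

lemma coeffs_central:
  assumes "V \<in> carrier S"
  shows "coeffs.extend s \<otimes>\<^bsub>S\<^esub> V = V \<otimes>\<^bsub>S\<^esub> coeffs.extend s"
proof (induction s rule: poly_mapping_induct)
  case (single i b)
  then show ?case
    using assms by (simp add: coeffs.extend_single Hxy.el_mult Hxy.T.r_one el_scalar_central)
qed (simp_all add: coeffs.extend_add Hxy.T.l_distr Hxy.T.r_distr assms)

sublocale eval: monoid_algebra_hom S coeffs.extend "\<lambda>v. el (hecke_p_of w p (Poly_Mapping.single v 1)) 1"
proof unfold_locales
  show "coeffs.extend \<in> ring_hom ring_of_type_algebra S" by (rule coeffs.extend_hom)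
  show "el (hecke_p_of w p (Poly_Mapping.single (i + j) 1)) 1 =
      el (hecke_p_of w p (Poly_Mapping.single i 1)) 1 \<otimes>\<^bsub>S\<^esub> el (hecke_p_of w p (Poly_Mapping.single j 1)) 1" for i j
    by (simp add: Hxy.el_mult flip: hecke_p_of_simps(3)) (simp add: mult_single)
qed (simp_all add: Hxy.one_T coeffs_central)

type_synonym 'y coeff = "(nat \<times> nat) \<Rightarrow>\<^sub>0 'y"

abbreviation ev_S :: "(gen_word \<Rightarrow>\<^sub>0 'z coeff) \<Rightarrow> _" where "ev_S \<equiv> eval.extend"

definition cst :: "'z \<Rightarrow> 'z coeff" where "cst z = Poly_Mapping.single 0 z"
definition vx :: "'z coeff" where "vx = Poly_Mapping.single (1, 0) 1"
definition vy :: "'z coeff" where "vy = Poly_Mapping.single (0, 1) 1"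

lemma coeffs_gen [simp]:
  "coeffs.extend (cst z) = el (scalar_p w p z) 1"
  "coeffs.extend vx = el one_H x_xy" "coeffs.extend vy = el one_H y_xy"
  by (simp_all add: cst_def vx_def vy_def coeffs.extend_single Hxy.el_mult scalar_simps)

sublocale eval_hom: ring_hom_ring ring_of_type_algebra S ev_S
  by (intro ring_hom_ringI2 ring_ring_of_type_algebra Hxy.T.ring_axioms eval.extend_hom)

sublocale coeffs_hom: ring_hom_ring ring_of_type_algebra S coeffs.extend
  by (intro ring_hom_ringI2 ring_ring_of_type_algebra Hxy.T.ring_axioms coeffs.extend_hom)

lemma eval_scalar [simp]: "ev_S (scalar s) = coeffs.extend s"
  by (simp add: scalar_def[of s] eval.extend_single flip: Hxy.one_T)

lemma eval_letter [simp]: "ev_S (letter l) = el (hecke_p_of w p (letter l)) 1"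
  by (simp add: letter_def eval.extend_single)

lemma eval_1 [simp]: "ev_S 1 = \<one>\<^bsub>S\<^esub>"
  using eval_hom.hom_one by simp

lemma eval_minus [simp]: "ev_S (- f) = \<ominus>\<^bsub>S\<^esub> ev_S f"
  using eval_hom.hom_a_inv[of f] by simp

lemma eval_diff: "ev_S (f - g) = ev_S f \<ominus>\<^bsub>S\<^esub> ev_S g"
  using eval.extend_add[of f "- g"] by (simp add: a_minus_def)

lemma coeffs_diff: "coeffs.extend (f - g) = coeffs.extend f \<ominus>\<^bsub>S\<^esub> coeffs.extend g"
  using coeffs.extend_add[of f "- g"] coeffs_hom.hom_a_inv[of g] by (simp add: a_minus_def)

lemma eval_sum: "ev_S (\<Sum>i\<in>U. f i) = (\<Oplus>\<^bsub>S\<^esub>i\<in>U. ev_S (f i))"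
  by (induction U rule: infinite_finite_induct) (simp_all add: eval.extend_add)

sublocale type_level: central_algebra "scalar :: 'z coeff \<Rightarrow> gen_word \<Rightarrow>\<^sub>0 'z coeff"
  by unfold_locales (rule scalar_simps scalar_central)+

sublocale base_level: central_algebra "scalar :: 'z \<Rightarrow> gen_word \<Rightarrow>\<^sub>0 'z"
  by unfold_locales (rule scalar_simps scalar_central)+

abbreviation vK :: "gen_word \<Rightarrow>\<^sub>0 'z coeff" where "vK \<equiv> letter GenK"
abbreviation vR :: "gen_word \<Rightarrow>\<^sub>0 'z coeff" where "vR \<equiv> letter GenR"

text \<open>This links the two coefficient rings, so that p(K) = 0 in H_p puts P(K), formed over
  \<zz>[x, y], into \<open>kernel\<close>.\<close>

lemma eval_char_poly:
  "ev_S (type_level.ev vK (char_poly (\<lambda>i. cst (A i)) m)) = el (hecke_p_of w p (base_level.ev (letter GenK) (char_poly A m))) 1"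
proof (induction m)
  case 0
  show ?case by (simp add: Hxy.one_T)
next
  case (Suc m)
  have "ev_S (scalar (- cst (A m))) = el (hecke_p_of w p (scalar (- A m))) 1"
    by (simp add: scalar_simps Hxy.el_minus_left)
  with Suc show ?case
    by (simp add: eval.extend_add eval.extend_mult Hxy.el_mult Hxy.el_add_left del: eval_scalar)
qed

definition kernel :: "(gen_word \<Rightarrow>\<^sub>0 'z coeff) set" where
  "kernel = {f. ev_S f = \<zero>\<^bsub>S\<^esub>}"

lemma kernel_eq: "f - g \<in> kernel \<longleftrightarrow> ev_S f = ev_S g"
  by (simp add: kernel_def eval_diff)

lemma hecke_congruence: "hecke_congruence scalar kernel vR vK (cst w)"
proof unfold_locales
  show "vR * vR - (scalar (cst w) * vR + 1) \<in> kernel"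
    unfolding kernel_eq using hecke_p_relations(1)
    by (simp add: eval.extend_mult eval.extend_add Hxy.el_mult Hxy.one_T flip: Hxy.el_add_left)
  show "vR * vK * vR * vK - vK * vR * vK * vR \<in> kernel"
    unfolding kernel_eq using hecke_p_relations(2)
    by (simp add: eval.extend_mult Hxy.el_mult)
qed (simp_all add: kernel_def eval.extend_add eval.extend_mult)

end

lemma (in tensor_hom) tmap_diff:
  "\<lbrakk>V \<in> carrier A.T; W \<in> carrier A.T\<rbrakk> \<Longrightarrow> tmap (V \<ominus>\<^bsub>A.T\<^esub> W) = tmap V \<ominus>\<^bsub>B.T\<^esub> tmap W"
  by (simp add: a_minus_def tmap_add)

context hecke_spectral
begin

lemma cst_simps: "cst (a + b) = cst a + cst b" "cst (a * b) = cst a * cst b" "cst (- a) = - cst a" "cst 0 = 0" "cst 1 = 1"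
  by (simp_all add: cst_def single_add mult_single single_uminus)

lemma phi_closed [simp]: "phi \<iota> A \<xi> i \<in> carrier Z.T"
  by (induction i) simp_all

lemmas sx_simps [simp] = scalar_x.tmap_closed[folded scalar_x_def] scalar_x.tmap_el[folded scalar_x_def, simplified]
lemmas sx_rules = scalar_x.tmap_add[folded scalar_x_def] scalar_x.tmap_diff[folded scalar_x_def]
  scalar_x.tmap_mult[folded scalar_x_def] scalar_x.tmap.hom_one[folded scalar_x_def]

lemma alg_K_elem_closed [simp]: "a \<in> carrier (alg_K w p) \<Longrightarrow> alg_K_elem \<iota> w p a \<in> carrier Kx.T"
  by (simp add: alg_K_elem_def)

lemma K_power_closed [simp]: "K_p w p [^]\<^bsub>alg_K w p\<^esub> (m :: nat) \<in> carrier (alg_K w p)"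
  by (rule alg_K.nat_pow_closed) simp

lemma one_alg_K [simp]: "one_H \<in> carrier (alg_K w p)"
  using alg_K.one_closed by simp

lemma K_x_closed: "K_x \<iota> w n A \<xi> \<zeta> \<in> carrier Kx.T" if "p = cyc_poly n A"
  unfolding K_x_def Let_def alg_K_x_def that[symmetric]
  by (intro Kx.T.a_closed Kx.T.finsum_closed) simp_all

text \<open>\<open>vt\<close> represents t in \<zz>[x, y]. Such a representative is available for x
  and y, the arguments at which K(x) is specialised.\<close>

context
  fixes t :: "'k poly poly fract" and vt :: "'z coeff"
  assumes t: "transcendental t" and vt: "coeffs.extend vt = el one_H t"
begin

interpretation sub_K: tensor_hom "alg_K w p" \<alpha> const_x "hecke_p w p" \<alpha> const_xy id "rat_subst t"
  by (rule spec_subst_K[OF t])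

abbreviation sp where "sp \<equiv> spec_subst \<iota> w p t"

lemmas sp_closed = sub_K.tmap_closed[folded spec_subst_def]
lemmas sp_el = sub_K.tmap_el[folded spec_subst_def, unfolded id_apply]
lemmas sp_rules = sub_K.tmap_add[folded spec_subst_def] sub_K.tmap_diff[folded spec_subst_def]
  sub_K.tmap_mult[folded spec_subst_def] sub_K.tmap.hom_one[folded spec_subst_def]
  sub_K.tmap.hom_finsum[folded spec_subst_def]

lemma spec_phi:
  "sp (scalar_x \<iota> w p (phi \<iota> A \<xi> i)) = coeffs.extend (poly (char_poly (\<lambda>i. cst (A i)) i) (cst \<xi> * vt))"
proof (induction i)
  case 0
  then show ?case by (simp add: sx_rules sp_rules)
next
  case (Suc i)
  have "sp (scalar_x \<iota> w p (phi \<iota> A \<xi> (Suc i)))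
     = sp (scalar_x \<iota> w p (phi \<iota> A \<xi> i)) \<otimes>\<^bsub>S\<^esub> el (scalar_p w p \<xi>) t \<ominus>\<^bsub>S\<^esub> el (scalar_p w p (A i)) 1"
    by (simp add: sx_rules sp_rules sp_el t)
  also have "\<dots> = coeffs.extend (poly (char_poly (\<lambda>i. cst (A i)) i) (cst \<xi> * vt) * (cst \<xi> * vt) - cst (A i))"
    unfolding Suc.IH by (simp add: coeffs_diff vt Hxy.el_mult)
  finally show ?case by (simp add: mult.commute)
qed

lemma spec_K_power: "sp (alg_K_elem \<iota> w p (K_p w p [^]\<^bsub>alg_K w p\<^esub> (m :: nat))) = ev_S (vK ^ m)"
proof -
  have "ev_S (vK ^ m) = el (K_p w p [^]\<^bsub>hecke_p w p\<^esub> m) 1"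
    by (induction m) (simp_all add: eval.extend_mult Hxy.el_mult power_Suc2 Hxy.one_T del: power_Suc)
  then show ?thesis by (simp add: alg_K_elem_def sp_el alg_K_power rat_subst_1[OF t] flip: alg_K_power)
qed

abbreviation \<phi> where "\<phi> A \<xi> i \<equiv> poly (char_poly (\<lambda>i. cst (A i)) i) (cst \<xi> * vt)"

lemma spec_K_x:
  assumes p: "p = cyc_poly n A"
  shows "sp (K_x \<iota> w n A \<xi> \<zeta>) = ev_S (\<Sum>i\<in>{0..<n}. scalar (\<phi> A \<xi> i) * vK ^ (n - i))
    \<oplus>\<^bsub>S\<^esub> (el (scalar_p w p \<zeta>) 1 \<ominus>\<^bsub>S\<^esub> el one_H (inverse t) \<otimes>\<^bsub>S\<^esub> coeffs.extend (\<phi> A \<xi> n))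
       \<otimes>\<^bsub>S\<^esub> el one_H (inverse (t - inverse t))"
proof -
  define D where "D = (\<Oplus>\<^bsub>Kx.T\<^esub> i\<in>{0..<n}. scalar_x \<iota> w p (phi \<iota> A \<xi> i)
           \<otimes>\<^bsub>Kx.T\<^esub> alg_K_elem \<iota> w p (K_p w p [^]\<^bsub>alg_K w p\<^esub> (n - i)))"
  have D: "D \<in> carrier Kx.T"
    unfolding D_def by (intro Kx.T.finsum_closed) simp
  have "sp D = ev_S (\<Sum>i\<in>{0..<n}. scalar (\<phi> A \<xi> i) * vK ^ (n - i))"
    by (simp add: D_def sp_rules eval_sum comp_def spec_phi spec_K_power eval.extend_mult)
  with D show ?thesis
    unfolding K_x_def Let_def alg_K_x_def p[symmetric] D_def[symmetric]
    by (simp add: sp_rules(1-4) sp_el sx_rules spec_phi scalar_simps rat_subst_1[OF t]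
        rat_subst_inverse[OF t] rat_subst_diff[OF t] rat_subst_var[OF t])
qed

text \<open>The division by u - \<xi> t includes the constant term \<phi>_n, which the sum in K(x)
  omits. Both give the same total, as (t^2 - 1) \<phi>_n + t (\<zeta> - t \<phi>_n) = t \<zeta> -
  \<phi>_n.\<close>

lemma spec_K_x_cleared:
  assumes p: "p = cyc_poly n A"
  shows "el one_H (t * t - 1) \<otimes>\<^bsub>S\<^esub> sp (K_x \<iota> w n A \<xi> \<zeta>) =
    ev_S (scalar (vt * vt - 1) * type_level.ev vK (synthetic_div (char_poly (\<lambda>i. cst (A i)) (Suc n)) (cst \<xi> * vt))
      + scalar (vt * (cst \<zeta> - vt * \<phi> A \<xi> n)))" (is "?L = ev_S ?R")
proof -
  define f where "f = coeffs.extend (\<phi> A \<xi> n)"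
  define D where "D = (\<Sum>i\<in>{0..<n}. scalar (\<phi> A \<xi> i) * vK ^ (n - i))"
  define m where "m = inverse (t - inverse t)"
  have [simp]: "f \<in> carrier S" by (simp add: f_def)
  have m: "(t * t - 1) * m = t"
  proof -
    have "t - inverse t = (t * t - 1) / t"
      using transcendental_nonzero(1)[OF t] by (simp add: field_simps)
    then show ?thesis using transcendental_nonzero[OF t] by (simp add: m_def)
  qed
  have el_minus_1: "el one_H (t * t - 1) = coeffs.extend (vt * vt - 1)"
    using coeffs_hom.hom_one by (simp add: coeffs_diff vt Hxy.el_mult Hxy.el_diff_right Hxy.one_T)
  have "?R = scalar (vt * vt - 1) * D + scalar (vt * cst \<zeta> - \<phi> A \<xi> n)"
  proof -
    have "(vt * vt - 1) * \<phi> A \<xi> n + vt * (cst \<zeta> - vt * \<phi> A \<xi> n) = vt * cst \<zeta> - \<phi> A \<xi> n"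
      by (simp add: algebra_simps)
    then show ?thesis
      using type_level.ev_synthetic_div_char_poly[of vK "\<lambda>i. cst (A i)" n "cst \<xi> * vt"]
      unfolding D_def char_poly.simps synthetic_div_pCons type_level.ev_pCons distrib_left
      by (simp add: add.assoc add.commute flip: scalar_simps(1,2))
  qed
  then have "ev_S ?R = el one_H (t * t - 1) \<otimes>\<^bsub>S\<^esub> ev_S D \<oplus>\<^bsub>S\<^esub> (el (scalar_p w p \<zeta>) t \<ominus>\<^bsub>S\<^esub> f)"
    by (simp add: eval.extend_add eval.extend_mult el_minus_1 coeffs_diff f_def vt Hxy.el_mult)
  moreover have "?L = el one_H (t * t - 1) \<otimes>\<^bsub>S\<^esub> ev_S D \<oplus>\<^bsub>S\<^esub> (el (scalar_p w p \<zeta>) t \<ominus>\<^bsub>S\<^esub> f)"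
  proof -
    let ?e = "el (scalar_p w p \<zeta>) 1 \<ominus>\<^bsub>S\<^esub> el one_H (inverse t) \<otimes>\<^bsub>S\<^esub> f"
    have "el one_H (t * t - 1) \<otimes>\<^bsub>S\<^esub> (?e \<otimes>\<^bsub>S\<^esub> el one_H m) = el one_H (t * t - 1) \<otimes>\<^bsub>S\<^esub> (el one_H m \<otimes>\<^bsub>S\<^esub> ?e)"
      by (simp add: el_one_central)
    also have "\<dots> = el one_H t \<otimes>\<^bsub>S\<^esub> ?e"
      by (simp add: Hxy.el_mult m flip: Hxy.T.m_assoc)
    also have "\<dots> = el one_H t \<otimes>\<^bsub>S\<^esub> el (scalar_p w p \<zeta>) 1 \<ominus>\<^bsub>S\<^esub> (el one_H t \<otimes>\<^bsub>S\<^esub> el one_H (inverse t)) \<otimes>\<^bsub>S\<^esub> f"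
      by (simp add: a_minus_def Hxy.T.r_distr Hxy.T.r_minus Hxy.T.m_assoc)
    also have "\<dots> = el (scalar_p w p \<zeta>) t \<ominus>\<^bsub>S\<^esub> f"
      using transcendental_nonzero(1)[OF t] by (simp add: Hxy.el_mult flip: Hxy.one_T)
    finally show ?thesis
      unfolding spec_K_x[OF p] by (simp add: Hxy.T.r_distr D_def f_def m_def)
  qed
  ultimately show ?thesis by simp
qed

lemma spec_K_x_eq:
  assumes p: "p = cyc_poly n A"
  shows "sp (K_x \<iota> w n A \<xi> \<zeta>) = el one_H (inverse (t * t - 1)) \<otimes>\<^bsub>S\<^esub>
    ev_S (scalar (vt * vt - 1) * type_level.ev vK (synthetic_div (char_poly (\<lambda>i. cst (A i)) (Suc n)) (cst \<xi> * vt))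
      + scalar (vt * (cst \<zeta> - vt * \<phi> A \<xi> n)))"
proof -
  have "sp (K_x \<iota> w n A \<xi> \<zeta>) \<in> carrier S"
    by (rule sp_closed[OF K_x_closed[OF p]])
  then show ?thesis
    unfolding spec_K_x_cleared[OF p, symmetric]
    using transcendental_nonzero(2)[OF t]
    by (simp add: Hxy.el_mult flip: Hxy.T.m_assoc Hxy.one_T)
qed

end

text \<open>As R^-1 = R - w, R(N/d) is N^-1 ((N - d) R + d w). Numerator and denominator are kept
  apart because x/y is not in \<zz>[x, y]; the cases used are x/y and x y / 1.\<close>

lemma spec_R_x:
  assumes t: "transcendental (N / d)" and N: "N \<noteq> 0" and d: "d \<noteq> 0"
    and "coeffs.extend r = el one_H (N - d)" "coeffs.extend e = el one_H d"
  shows "spec_subst \<iota> w p (N / d) (R_x \<iota> w p) = el one_H (inverse N) \<otimes>\<^bsub>S\<^esub> ev_S (scalar r * vR + scalar (e * cst w))"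
proof -
  interpret sub_H: tensor_hom "hecke_p w p" \<alpha> const_x "hecke_p w p" \<alpha> const_xy id "rat_subst (N / d)"
    by (rule spec_subst_H[OF t])
  note sp = sub_H.tmap_diff[folded spec_subst_def] sub_H.tmap_el[folded spec_subst_def, unfolded id_apply]
  have "spec_subst \<iota> w p (N / d) (R_x \<iota> w p)
    = el (R_p w p) 1 \<ominus>\<^bsub>S\<^esub> el (R_p w p \<ominus>\<^bsub>hecke_p w p\<^esub> scalar_p w p w) (d / N)"
    by (simp add: R_x_def hecke_p_x_def Let_def sp inv_R_p rat_subst_inverse[OF t] rat_subst_var[OF t] rat_subst_1[OF t])
  also have "\<dots> = el (R_p w p) (1 - d / N) \<oplus>\<^bsub>S\<^esub> el (scalar_p w p w) (d / N)"
  proof -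
    have "a \<ominus>\<^bsub>S\<^esub> (b \<ominus>\<^bsub>S\<^esub> c) = a \<ominus>\<^bsub>S\<^esub> b \<oplus>\<^bsub>S\<^esub> c" if "a \<in> carrier S" "b \<in> carrier S" "c \<in> carrier S" for a b c
      using that by (simp add: a_minus_def Hxy.T.minus_add Hxy.T.a_assoc)
    then show ?thesis by (simp add: Hxy.el_diff_left Hxy.el_diff_right)
  qed
  also have "1 - d / N = inverse N * (N - d)"
    using N by (simp add: field_simps)
  also have "d / N = inverse N * d"
    by (simp add: field_simps)
  finally show ?thesis
    using assms(4,5)
    by (simp add: eval.extend_add eval.extend_mult Hxy.T.r_distr Hxy.el_mult)
qed

lemma scaled_mult:
  assumes "V \<in> carrier S" "W \<in> carrier S"
  shows "(el one_H l \<otimes>\<^bsub>S\<^esub> V) \<otimes>\<^bsub>S\<^esub> (el one_H m \<otimes>\<^bsub>S\<^esub> W) = el one_H (l * m) \<otimes>\<^bsub>S\<^esub> (V \<otimes>\<^bsub>S\<^esub> W)"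
proof -
  have "(el one_H l \<otimes>\<^bsub>S\<^esub> V) \<otimes>\<^bsub>S\<^esub> (el one_H m \<otimes>\<^bsub>S\<^esub> W) = el one_H l \<otimes>\<^bsub>S\<^esub> (V \<otimes>\<^bsub>S\<^esub> el one_H m) \<otimes>\<^bsub>S\<^esub> W"
    using assms by (simp add: Hxy.T.m_assoc)
  also have "V \<otimes>\<^bsub>S\<^esub> el one_H m = el one_H m \<otimes>\<^bsub>S\<^esub> V"
    using assms by (simp add: el_one_central)
  also have "el one_H l \<otimes>\<^bsub>S\<^esub> (el one_H m \<otimes>\<^bsub>S\<^esub> V) = el one_H (l * m) \<otimes>\<^bsub>S\<^esub> V"
    using assms by (simp add: Hxy.el_mult flip: Hxy.T.m_assoc)
  finally show ?thesis using assms by (simp add: Hxy.T.m_assoc)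
qed

text \<open>Both sides contain the same four factors in opposite orders. Their denominators are
  central, so each side acquires the same scalar and \<open>reflection_cleared\<close>
  suffices.\<close>

theorem K_x_solution:
  assumes p: "p = cyc_poly n A" and "\<zeta> * \<xi> = poly (cyc_poly n A) 0"
  shows "is_solution \<iota> w p (K_x \<iota> w n A \<xi> \<zeta>)"
proof -
  define P where "P = char_poly (\<lambda>i. cst (A i)) (Suc n)"
  have eval_P: "ev_S (type_level.ev vK P) = \<zero>\<^bsub>S\<^esub>"
  proof -
    have "base_level.ev (letter GenK) (char_poly A (Suc n)) = - eval_K p"
      using base_level.ev_minus[of "letter GenK" p]
      by (simp add: p cyc_poly_eq base_level.ev_altdef eval_K_def)
    then show ?thesis
      unfolding P_def eval_char_poly by (simp add: hecke_p_eval)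
  qed
  interpret H: hecke_congruence "scalar :: 'z coeff \<Rightarrow> _" kernel vR vK "cst w"
    by (rule hecke_congruence)
  interpret C: reflection_congruence "scalar :: 'z coeff \<Rightarrow> _" kernel vR vK "cst w" P "cst \<xi>" "cst \<zeta>"
  proof unfold_locales
    show "poly P 0 = - (cst \<zeta> * cst \<xi>)"
      using assms(2) by (simp add: P_def cyc_poly_eq flip: cst_simps(2,3))
    show "type_level.ev vK P \<in> kernel"
      by (simp add: kernel_def eval_P)
  qed
  have G: "type_level.ev vK (synthetic_div P (cst \<xi> * v)) = C.g v" for v
    by (simp add: C.G_def)
  have psi: "cst \<zeta> - v * poly (char_poly (\<lambda>i. cst (A i)) n) (cst \<xi> * v) = C.\<psi> v" for v
    unfolding C.\<psi>_def C.G_def by (simp add: P_def)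
  let ?r = "scalar (vx - vy) * vR + scalar (vy * cst w)"
  let ?k = "\<lambda>v. scalar (v * v - 1) * C.g v + scalar (v * C.\<psi> v)"
  let ?s = "scalar (vx * vy - 1) * vR + scalar (cst w)"
  have nz: "x_xy \<noteq> (0 :: 'k poly poly fract)" "y_xy \<noteq> (0 :: 'k poly poly fract)"
    using transcendental_nonzero transcendental_x transcendental_y by blast+
  have K: "spec_subst \<iota> w p x_xy (K_x \<iota> w n A \<xi> \<zeta>) = el one_H (inverse (x_xy * x_xy - 1)) \<otimes>\<^bsub>S\<^esub> ev_S (?k vx)"
    "spec_subst \<iota> w p y_xy (K_x \<iota> w n A \<xi> \<zeta>) = el one_H (inverse (y_xy * y_xy - 1)) \<otimes>\<^bsub>S\<^esub> ev_S (?k vy)"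
    using spec_K_x_eq[OF transcendental_x coeffs_gen(2) p, of \<xi> \<zeta>]
      spec_K_x_eq[OF transcendental_y coeffs_gen(3) p, of \<xi> \<zeta>]
    unfolding P_def[symmetric] G psi by simp_all
  have R1: "spec_subst \<iota> w p (x_xy / y_xy) (R_x \<iota> w p) = el one_H (inverse x_xy) \<otimes>\<^bsub>S\<^esub> ev_S ?r"
    by (rule spec_R_x[OF transcendental_xdivy nz]) (simp_all add: coeffs_diff Hxy.el_diff_right)
  have "spec_subst \<iota> w p (x_xy * y_xy / 1) (R_x \<iota> w p) = el one_H (inverse (x_xy * y_xy)) \<otimes>\<^bsub>S\<^esub> ev_S (scalar (vx * vy - 1) * vR + scalar (1 * cst w))"
    by (rule spec_R_x) (use nz transcendental_xy coeffs_hom.hom_one in \<open>simp_all add: coeffs_diff Hxy.el_diff_right Hxy.el_mult Hxy.one_T\<close>)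
  then have R2: "spec_subst \<iota> w p (x_xy * y_xy) (R_x \<iota> w p) = el one_H (inverse (x_xy * y_xy)) \<otimes>\<^bsub>S\<^esub> ev_S ?s"
    by simp
  have "ev_S (?r * ?k vx * ?s * ?k vy) = ev_S (?k vy * ?s * ?k vx * ?r)"
    using C.reflection_cleared[of vx vy] by (simp add: H.cong_def kernel_eq)
  then have "ev_S ?r \<otimes>\<^bsub>S\<^esub> ev_S (?k vx) \<otimes>\<^bsub>S\<^esub> ev_S ?s \<otimes>\<^bsub>S\<^esub> ev_S (?k vy)
      = ev_S (?k vy) \<otimes>\<^bsub>S\<^esub> ev_S ?s \<otimes>\<^bsub>S\<^esub> ev_S (?k vx) \<otimes>\<^bsub>S\<^esub> ev_S ?r"
    by (simp only: eval.extend_mult)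
  then show ?thesis
    unfolding is_solution_def Let_def K R1 R2 hecke_p_xy_def
    using K_x_closed[OF p]
    by (simp add: scaled_mult alg_K_x_def mult.commute mult.left_commute del: eval.extend_mult)
qed

end

section \<open>Remainders modulo a monic polynomial\<close>

lemma degree_char_poly [simp]: "degree (char_poly A m) = m"
  and coeff_char_poly [simp]: "coeff (char_poly A m) m = 1"
proof -
  have "degree (char_poly A m) = m \<and> coeff (char_poly A m) m = 1"
  proof (induction m)
    case (Suc m)
    then have "char_poly A m \<noteq> 0" by auto
    with Suc show ?case by simp
  qed simp
  then show "degree (char_poly A m) = m" "coeff (char_poly A m) m = 1" by simp_all
qed

text \<open>The coefficients need not form a domain; the remainder is still unique for monic P,
  since multiplying a non-zero polynomial by P cannot bring its degree below that of P.\<close>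

definition monic_rem :: "'c::comm_ring_1 poly \<Rightarrow> 'c poly \<Rightarrow> 'c poly" where
  "monic_rem P f = (THE r. degree r < degree P \<and> P dvd f - r)"

lemma degree_monic_mult:
  assumes "lead_coeff P = (1 :: 'c::comm_ring_1)" "q \<noteq> 0"
  shows "degree P \<le> degree (P * q)"
proof -
  have "coeff (P * q) (degree P + degree q) \<noteq> 0"
    using assms by (simp add: coeff_mult_degree_sum)
  then show ?thesis using le_degree[of "P * q"] by fastforce
qed

context
  fixes P :: "'c::comm_ring_1 poly"
  assumes P: "lead_coeff P = 1" "degree P > 0"
begin

lemma monic_rem_unique:
  assumes "degree r < degree P" "P dvd f - r"
  shows "monic_rem P f = r"
  unfolding monic_rem_def
proof (rule the_equality)
  fix r' assume r': "degree r' < degree P \<and> P dvd f - r'"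
  then have "P dvd (f - r) - (f - r')" using dvd_diff[OF assms(2)] by blast
  then obtain q where q: "r' - r = P * q" by (auto elim: dvdE)
  have "degree (r' - r) < degree P" using assms(1) r' by (intro degree_diff_less) auto
  then show "r' = r" using degree_monic_mult[OF P(1), of q] q by fastforce
qed (use assms in auto)

lemma monic_rem: "degree (monic_rem P f) < degree P" "P dvd f - monic_rem P f"
proof -
  obtain q r where qr: "pseudo_divmod f P = (q, r)" by force
  have "P \<noteq> 0" using P by auto
  \<comment> \<open>The power of the leading coefficient in pseudo-division is 1, so this is true
    division.\<close>
  from pseudo_divmod[OF this qr] P have "f = P * q + r" "degree r < degree P" by auto
  moreover from this have "monic_rem P f = r" by (intro monic_rem_unique) auto
  ultimately show "degree (monic_rem P f) < degree P" "P dvd f - monic_rem P f" by auto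
qed

lemma monic_rem_add: "monic_rem P (f + g) = monic_rem P f + monic_rem P g"
proof (rule monic_rem_unique)
  show "degree (monic_rem P f + monic_rem P g) < degree P"
    by (intro degree_add_less monic_rem)
  show "P dvd f + g - (monic_rem P f + monic_rem P g)"
    using dvd_add[OF monic_rem(2)[of f] monic_rem(2)[of g]] by (simp add: algebra_simps)
qed

lemma monic_rem_smult: "monic_rem P (smult a f) = smult a (monic_rem P f)"
proof (rule monic_rem_unique)
  show "degree (smult a (monic_rem P f)) < degree P"
    using degree_smult_le monic_rem(1) by (rule le_less_trans)
  show "P dvd smult a f - smult a (monic_rem P f)"
    using monic_rem(2)[of f] by (simp add: dvd_smult flip: smult_diff_right)
qed

lemma monic_rem_cong: "P dvd f - g \<Longrightarrow> monic_rem P f = monic_rem P g"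
  using monic_rem[of g] dvd_add[of P "f - g" "g - monic_rem P g"] by (intro monic_rem_unique) auto

lemma monic_rem_small: "degree f < degree P \<Longrightarrow> monic_rem P f = f"
  by (rule monic_rem_unique) auto

end

declare char_poly.simps(2) [simp del]

text \<open>Coordinates for 1, u, ..., u^(n-1), \<open>K~\<close>: substituting u^n =
  \<open>K~\<close> + A_0 u^(n-1) + ... + A_(n-1) in the remainder r adds r_n A_(n-1-j) to the
  coefficient of u^j.\<close>

definition basis_coeff :: "nat \<Rightarrow> (nat \<Rightarrow> 'c::comm_ring_1) \<Rightarrow> nat \<Rightarrow> 'c poly \<Rightarrow> 'c" where
  "basis_coeff n A j f = (let r = monic_rem (char_poly A (Suc n)) f
     in if j = n then coeff r n else coeff r j + coeff r n * A (n - 1 - j))"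

lemma basis_coeff_add: "basis_coeff n A j (f + g) = basis_coeff n A j f + basis_coeff n A j g"
  by (simp add: basis_coeff_def Let_def monic_rem_add algebra_simps)

lemma basis_coeff_smult: "basis_coeff n A j (smult a f) = a * basis_coeff n A j f"
  by (simp add: basis_coeff_def Let_def monic_rem_smult algebra_simps)

lemma basis_coeff_cong: "cyc_poly n A dvd f - g \<Longrightarrow> basis_coeff n A j f = basis_coeff n A j g"
  using monic_rem_cong[of "char_poly A (Suc n)" f g]
  by (simp add: basis_coeff_def Let_def cyc_poly_eq)

lemma basis_coeff_small:
  assumes "degree f \<le> n"
  shows "basis_coeff n A j f = (if j = n then coeff f n else coeff f j + coeff f n * A (n - 1 - j))"
  using monic_rem_small[of "char_poly A (Suc n)" f] assms
  by (simp add: basis_coeff_def)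

text \<open>The single vector x is non-zero, hence independent over the field k, so a value
  prescribed on it extends to all of k(x).\<close>

lemma linear_functional_var_x:
  obtains f :: "'k::field poly fract \<Rightarrow> 'k"
  where "\<And>r s. f (r + s) = f r + f s" "\<And>c r. f (const_x c * r) = c * f r" "f var_x = 1"
proof -
  have const: "const_x (a + b) = const_x a + const_x b" "const_x (a * b) = const_x a * const_x b" "const_x 1 = 1" for a b :: 'k
    by (simp_all add: const_x_def One_fract_def one_pCons mult.commute)
  interpret V: vector_space "\<lambda>c r. const_x (c :: 'k) * r"
    by unfold_locales (simp_all add: const algebra_simps)
  interpret W: vector_space "(*) :: 'k \<Rightarrow> 'k \<Rightarrow> 'k"
    by unfold_locales (simp_all add: algebra_simps)
  interpret VW: vector_space_pair "\<lambda>c r. const_x (c :: 'k) * r" "(*) :: 'k \<Rightarrow> 'k \<Rightarrow> 'k" ..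
  have "(var_x :: 'k poly fract) \<noteq> 0" by (simp add: var_x_def Zero_fract_def eq_fract)
  then have "V.independent {var_x}" by (simp add: V.dependent_single)
  then obtain g where g: "Vector_Spaces.linear (\<lambda>c r. const_x (c :: 'k) * r) (*) g" "g var_x = 1"
    using VW.linear_independent_extend[of "{var_x}" "\<lambda>_. 1"] by blast
  interpret g: Vector_Spaces.linear "\<lambda>c r. const_x (c :: 'k) * r" "(*)" g by (rule g(1))
  show thesis by (rule that[of g]) (use g.add g.scale g(2) in auto)
qed

lemma (in tensor_linear) tmap_finsum:
  "(\<And>i. i \<in> U \<Longrightarrow> V i \<in> carrier A.T) \<Longrightarrow> tmap (\<Oplus>\<^bsub>A.T\<^esub>i\<in>U. V i) = (\<Oplus>\<^bsub>B.T\<^esub>i\<in>U. tmap (V i))"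
  by (induction U rule: infinite_finite_induct) (simp_all add: tmap_add Pi_def A.T.finsum_closed)

text \<open>\<open>R\<close> acts on \<open>\<zz>[u]/(p)\<close> by the scalar \<open>\<rho>\<close>, a root of its quadratic relation.\<close>

definition gen_image :: "'z::comm_ring_1 \<Rightarrow> gen \<Rightarrow> 'z poly" where
  "gen_image \<rho> l = (case l of GenR \<Rightarrow> [:\<rho>:] | GenK \<Rightarrow> [:0, 1:])"

definition model :: "'z::comm_ring_1 \<Rightarrow> (gen_word \<Rightarrow>\<^sub>0 'z) \<Rightarrow> 'z poly" where
  "model \<rho> = monoid_algebra_hom.extend ring_of_type_algebra (\<lambda>z. [:z:]) (\<lambda>v. prod_list (map (gen_image \<rho>) (letters v)))"

lemma model_hom:
  "monoid_algebra_hom (ring_of_type_algebra :: 'z::comm_ring_1 poly ring) (\<lambda>z. [:z:])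
    (\<lambda>v. prod_list (map (gen_image \<rho>) (letters v)))"
  by (intro monoid_algebra_hom.intro monoid_algebra_hom_axioms.intro ring_ring_of_type_algebra)
    (auto simp: zero_gen_word_def plus_gen_word_def one_pCons mult.commute intro!: ring_hom_memI)

lemma model_simps [simp]:
  "model \<rho> (f + g) = model \<rho> f + model \<rho> g"
  "model \<rho> (f * g) = model \<rho> f * model \<rho> g"
  "model \<rho> (scalar z) = [:z:]" "model \<rho> (letter GenR) = [:\<rho>:]" "model \<rho> (letter GenK) = [:0, 1:]"
  "model \<rho> 1 = 1" "model \<rho> 0 = 0"
proof -
  show "model \<rho> (f + g) = model \<rho> f + model \<rho> g" "model \<rho> (f * g) = model \<rho> f * model \<rho> g" "model \<rho> 0 = 0"
    using monoid_algebra_hom.extend_add[OF model_hom[of \<rho>], of f g]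
      monoid_algebra_hom.extend_mult[OF model_hom[of \<rho>], of f g]
      monoid_algebra_hom.extend_0[OF model_hom[of \<rho>]]
    by (simp_all add: model_def)
  show s: "model \<rho> (scalar z) = [:z:]" for z
    using monoid_algebra_hom.extend_single[OF model_hom[of \<rho>], of 0 z]
    by (simp add: model_def scalar_def zero_gen_word_def)
  show "model \<rho> (letter GenR) = [:\<rho>:]" "model \<rho> (letter GenK) = [:0, 1:]"
    using monoid_algebra_hom.extend_single[OF model_hom[of \<rho>], of "Word [GenR]" 1]
      monoid_algebra_hom.extend_single[OF model_hom[of \<rho>], of "Word [GenK]" 1]
    by (simp_all add: model_def letter_def gen_image_def)
  show "model \<rho> 1 = 1"
    using s[of 1] by (simp add: scalar_simps one_pCons)
qed

lemma model_diff [simp]: "model \<rho> (f - g) = model \<rho> f - model \<rho> g"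
  using model_simps(1)[of \<rho> "f - g" g] by simp

lemma model_power [simp]: "model \<rho> (f ^ m) = model \<rho> f ^ m"
  by (induction m) simp_all

lemma model_sum: "model \<rho> (\<Sum>i\<in>U. f i) = (\<Sum>i\<in>U. model \<rho> (f i))"
  by (induction U rule: infinite_finite_induct) simp_all

lemma model_eval_K: "model \<rho> (eval_K f) = (f :: 'z::comm_ring_1 poly)"
proof -
  have "[:0, 1:] ^ i = monom (1 :: 'z) i" for i
    by (induction i) (simp_all add: monom_Suc monom_0 one_pCons)
  then show ?thesis
    by (simp add: eval_K_def model_sum smult_monom poly_as_sum_of_monoms)
qed

section \<open>Coordinate functions on H_p over \<zz>\<close>

context hecke_quotient
begin

context
  fixes n :: nat and A :: "nat \<Rightarrow> 'z" and \<rho> :: 'z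
  assumes p: "p = cyc_poly n A" and \<rho>: "\<rho> * \<rho> = w * \<rho> + 1"
begin

text \<open>The target \<zz>[u] is commutative, so RKRK = KRKR is automatic; the quadratic relation
  is the assumption on \<open>\<rho>\<close>, and p(K) goes to p. Thus the preimage of the ideal (p)
  contains all relations.\<close>

lemma model_kernel: "hecke_p_of w p f = \<zero>\<^bsub>hecke_p w p\<^esub> \<Longrightarrow> p dvd model \<rho> f"
proof -
  have "ideal {f. p dvd model \<rho> f} free_ring"
  proof (rule idealI)
    show "subgroup {f. p dvd model \<rho> f} (add_monoid free_ring)"
    proof
      fix x assume "x \<in> {f. p dvd model \<rho> f}"
      moreover have "inv\<^bsub>add_monoid free_ring\<^esub> x = - x"
        using a_inv_ring_of_type_algebra[of x] by (simp add: a_inv_def)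
      ultimately show "inv\<^bsub>add_monoid free_ring\<^esub> x \<in> {f. p dvd model \<rho> f}"
        using model_diff[of \<rho> 0 x] by simp
    qed auto
  qed (auto intro: ring_ring_of_type_algebra)
  then show "hecke_p_of w p f = \<zero>\<^bsub>hecke_p w p\<^esub> \<Longrightarrow> p dvd model \<rho> f"
    using hecke_p_of_kernel[of "{f. p dvd model \<rho> f}" f]
    by (simp add: model_eval_K \<rho> one_pCons mult.commute)
qed

text \<open>Read off from an arbitrary preimage in the free algebra; by \<open>model_kernel\<close>
  two preimages have images congruent modulo p, and hence the same remainder.\<close>

definition coord :: "nat \<Rightarrow> (gen_word \<Rightarrow>\<^sub>0 'z) set set \<Rightarrow> 'z" where
  "coord j a = basis_coeff n A j (model \<rho> (SOME f. a = hecke_p_of w p f))"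

lemma coord_of: "coord j (hecke_p_of w p f) = basis_coeff n A j (model \<rho> f)"
proof -
  define f' where "f' = (SOME f'. hecke_p_of w p f = hecke_p_of w p f')"
  have "hecke_p_of w p f = hecke_p_of w p f'"
    unfolding f'_def by (rule someI) (rule refl)
  then have "hecke_p_of w p (f' - f) = \<zero>\<^bsub>hecke_p w p\<^esub>"
    by (simp add: hecke_p_of_diff)
  then have "cyc_poly n A dvd model \<rho> f' - model \<rho> f"
    using model_kernel[of "f' - f"] p by simp
  then show ?thesis
    unfolding coord_def f'_def[symmetric] by (rule basis_coeff_cong)
qed

lemma coord_add: "\<lbrakk>a \<in> carrier (hecke_p w p); b \<in> carrier (hecke_p w p)\<rbrakk> \<Longrightarrow>
    coord j (a \<oplus>\<^bsub>hecke_p w p\<^esub> b) = coord j a + coord j b"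
  using hecke_p_of_surj[of a] hecke_p_of_surj[of b]
  by (auto simp: coord_of basis_coeff_add simp flip: hecke_p_of_simps(2))

lemma coord_scale: "a \<in> carrier (hecke_p w p) \<Longrightarrow> coord j (scalar_p w p z \<otimes>\<^bsub>hecke_p w p\<^esub> a) = z * coord j a"
  using hecke_p_of_surj[of a]
  by (auto simp: coord_of basis_coeff_smult simp flip: hecke_p_of_simps(3))

lemma coord_K_power: "\<lbrakk>m \<le> n; j \<le> n\<rbrakk> \<Longrightarrow> coord j (hecke_p_of w p (letter GenK ^ m)) =
    (if j = n then if m = n then 1 else 0
     else (if m = j then 1 else 0) + (if m = n then A (n - 1 - j) else 0))"
proof -
  assume "m \<le> n" "j \<le> n"
  moreover have "[:0, 1:] ^ m = monom (1 :: 'z) m"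
    by (induction m) (simp_all add: monom_Suc monom_0 one_pCons)
  ultimately show ?thesis
    by (auto simp: coord_of basis_coeff_small degree_monom_eq)
qed

lemma K_basis_eq: "K_basis w n A i = hecke_p_of w p
     (if i < n then letter GenK ^ i
      else letter GenK ^ n - (\<Sum>j<n. scalar (A j) * letter GenK ^ (n - 1 - j)))"
  by (simp add: K_basis_def p)

lemma coord_basis: "\<lbrakk>i \<le> n; j \<le> n\<rbrakk> \<Longrightarrow> coord j (K_basis w n A i) = (if i = j then 1 else 0)"
proof -
  assume ij: "i \<le> n" "j \<le> n"
  show ?thesis
  proof (cases "i < n")
    case True
    then show ?thesis using ij by (auto simp: K_basis_eq coord_K_power)
  next
    case False
    have bd: "basis_coeff n A j (f - g) = basis_coeff n A j f - basis_coeff n A j g" for f g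
      using basis_coeff_add[of n A j "f - g" g] by simp
    have b0: "basis_coeff n A j 0 = 0" using bd[of 0 0] by simp
    have bs: "basis_coeff n A j (\<Sum>l\<in>U. f l) = (\<Sum>l\<in>U. basis_coeff n A j (f l))" for f :: "nat \<Rightarrow> _" and U
      by (induction U rule: infinite_finite_induct) (simp_all add: b0 basis_coeff_add)
    have "coord j (K_basis w n A i) = coord j (hecke_p_of w p (letter GenK ^ n))
        - (\<Sum>l<n. A l * coord j (hecke_p_of w p (letter GenK ^ (n - 1 - l))))"
      using False by (simp add: K_basis_eq coord_of bd bs model_sum basis_coeff_smult)
    \<comment> \<open>Only l = n - 1 - j contributes, and it is in range unless j = n. Its term
      cancels the correction hidden in the coordinates of K^n.\<close>
    also have "(\<Sum>l<n. A l * coord j (hecke_p_of w p (letter GenK ^ (n - 1 - l))))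
        = (\<Sum>l<n. if l = n - 1 - j \<and> j \<noteq> n then A l else 0)"
      using ij by (intro sum.cong) (auto simp: coord_K_power)
    also have "\<dots> = (if j = n then 0 else A (n - 1 - j))"
      using ij by (auto simp: sum.delta)
    finally show ?thesis using False ij by (auto simp: coord_K_power)
  qed
qed

end

end

section \<open>Coordinates over \<zz>(x) and the coefficient of K^(n-1)\<close>

context hecke_spectral
begin

lemma Z_el_consts: "Z.el 0 1 = \<zero>\<^bsub>Z.T\<^esub>" "Z.el 1 1 = \<one>\<^bsub>Z.T\<^esub>"
  using Z.el_zero_left[of 1] Z.one_T by simp_all

text \<open>For a k-linear functional f on k(x) with f(x) = 1, the assignment a \<otimes> l to a
  \<iota>(f(l)) respects the tensor relations and sends \<xi> \<otimes> x to \<xi>.\<close>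

lemma el_nonzero:
  assumes \<iota>: "\<iota> \<in> ring_hom ring_of_type_algebra ring_of_type_algebra" and "\<xi> \<noteq> 0"
  shows "Z.el \<xi> var_x \<noteq> \<zero>\<^bsub>Z.T\<^esub>"
proof
  assume 0: "Z.el \<xi> var_x = \<zero>\<^bsub>Z.T\<^esub>"
  obtain f :: "'k poly fract \<Rightarrow> 'k" where f: "\<And>r s. f (r + s) = f r + f s" "\<And>c r. f (const_x c * r) = c * f r" "f var_x = 1"
    using linear_functional_var_x[where 'k = 'k] by blast
  have f_const: "f (r * const_x c) = c * f r" for r c
    using f(2)[of c r] by (simp add: mult.commute)
  define \<Psi> :: "(('z \<times> 'k poly fract) \<Rightarrow>\<^sub>0 int) \<Rightarrow> 'z" where
    "\<Psi> s = (\<Sum>u\<in>Poly_Mapping.keys s. of_int (Poly_Mapping.lookup s u) * (fst u * \<iota> (f (snd u))))" for s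
  have \<Psi>_add: "\<Psi> (s + s') = \<Psi> s + \<Psi> s'" for s s'
    unfolding \<Psi>_def by (rule setsum_keys_plus_distrib) (simp_all add: algebra_simps)
  have \<Psi>_diff: "\<Psi> (s - s') = \<Psi> s - \<Psi> s'" for s s'
    using \<Psi>_add[of "s - s'" s'] by simp
  have \<Psi>_pair: "\<Psi> (formal_pair a l) = a * \<iota> (f l)" for a l
    by (simp add: \<Psi>_def)
  have \<iota>_simps: "\<iota> (a + b) = \<iota> a + \<iota> b" "\<iota> (a * b) = \<iota> a * \<iota> b" "\<iota> 1 = 1" for a b
    using ring_hom_add[OF \<iota>, of a b] ring_hom_mult[OF \<iota>, of a b] ring_hom_one[OF \<iota>] by simp_all
  have "formal_pair \<xi> var_x \<in> Z.I"
    using 0 Z.I.rcos_const_imp_mem[of "formal_pair \<xi> var_x"]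
    by (simp add: tensor_elem_def tensor_alg_def FactRing_def Z.ring_axioms)
  then have "\<Psi> (formal_pair \<xi> var_x) \<in> {0}"
  proof (rule Z.additive_vanishes[rotated -1])
    fix r assume "r \<in> Z.Rel"
    then show "\<Psi> r \<in> {0}"
      unfolding tensor_relations_def
      by (auto simp: \<Psi>_add \<Psi>_diff \<Psi>_pair f \<iota>_simps distrib_left distrib_right
          f_const mult.assoc mult.commute mult.left_commute)
  qed (simp_all add: \<Psi>_add)
  with assms(2) show False by (simp add: \<Psi>_pair f \<iota>_simps)
qed

context
  fixes n :: nat and A :: "nat \<Rightarrow> 'z" and \<rho> :: 'z
  assumes p: "p = cyc_poly n A" and \<rho>: "\<rho> * \<rho> = w * \<rho> + 1"
begin

lemma coord_linear: "tensor_linear (alg_K w p) \<alpha> const_x ring_of_type_algebra \<iota> const_x (coord n A \<rho> j) id"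
  by unfold_locales (simp_all add: coord_add[OF p \<rho>] coord_scale[OF p \<rho>] alg_K_carrier)

definition coord_x where "coord_x j = tensor_map ring_of_type_algebra \<iota> const_x (coord n A \<rho> j) id"

lemmas coord_x_rules =
  tensor_linear.tmap_zero[OF coord_linear, folded coord_x_def]
  tensor_linear.tmap_el[OF coord_linear, folded coord_x_def, unfolded id_apply]
  tensor_linear.tmap_add[OF coord_linear, folded coord_x_def]
lemmas coord_x_finsum = tensor_linear.tmap_finsum[OF coord_linear, folded coord_x_def]

lemma coord_x_scaled:
  assumes "c \<in> carrier Z.T" "b \<in> carrier (alg_K w p)"
  shows "coord_x j (scalar_x \<iota> w p c \<otimes>\<^bsub>Kx.T\<^esub> alg_K_elem \<iota> w p b) = c \<otimes>\<^bsub>Z.T\<^esub> Z.el (coord n A \<rho> j b) 1"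
  using assms(1)
proof (induction c rule: Z.tensor_induct)
  case zero
  then show ?case
    using assms(2) scalar_x.tmap_zero[folded scalar_x_def] by (simp add: coord_x_rules)
next
  case (el a l)
  show ?case
    using assms(2) alg_K.m_closed[of "scalar_p w p a" b]
    by (simp add: alg_K_elem_def Kx.el_mult Z.el_mult coord_x_rules coord_scale[OF p \<rho>] alg_K_carrier)
next
  case (add c d)
  then show ?case
    using assms(2) by (simp add: sx_rules Kx.T.l_distr Z.T.l_distr coord_x_rules)
qed

lemma of_power_alg_K [simp]: "hecke_p_of w p (letter GenK ^ m) \<in> carrier (alg_K w p)"
  using K_power_closed[of m] by (simp add: alg_K_power hecke_p_power)

text \<open>Partial sums of K^n - \<open>K~\<close>, cut off at \<open>m\<close> so that membership
  and spanning can be proved by induction.\<close>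

definition sub_basis :: "nat \<Rightarrow> gen_word \<Rightarrow>\<^sub>0 'z" where
  "sub_basis m = (\<Sum>j<m. scalar (A j) * letter GenK ^ (n - 1 - j))"

lemma sub_basis_alg_K [simp]: "hecke_p_of w p (sub_basis m) \<in> carrier (alg_K w p)"
proof (induction m)
  case 0
  show ?case using alg_K.zero_closed by (simp add: sub_basis_def)
next
  case (Suc m)
  then show ?case
    using alg_K.m_closed[of "scalar_p w p (A m)" "hecke_p_of w p (letter GenK ^ (n - 1 - m))"]
      alg_K.a_closed[of "hecke_p_of w p (sub_basis m)"]
    by (simp add: sub_basis_def)
qed

lemma K_basis_alg_K [simp]: "K_basis w n A i \<in> carrier (alg_K w p)"
proof (cases "i < n")
  case False
  have "scalar (- 1) * sub_basis n = - sub_basis n"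
    by (simp add: scalar_simps)
  then have "K_basis w n A i = hecke_p_of w p (letter GenK ^ n + scalar (- 1) * sub_basis n)"
    using False by (simp add: K_basis_eq[OF p \<rho>] sub_basis_def del: hecke_p_of_simps)
  then show ?thesis
    using alg_K.m_closed[of "scalar_p w p (- 1)" "hecke_p_of w p (sub_basis n)"] alg_K.a_closed[OF of_power_alg_K[of n]]
    by simp
qed (simp add: K_basis_eq[OF p \<rho>])

definition expansion where
  "expansion c = (\<Oplus>\<^bsub>Kx.T\<^esub> i\<in>{..n}. scalar_x \<iota> w p (c i) \<otimes>\<^bsub>Kx.T\<^esub> alg_K_elem \<iota> w p (K_basis w n A i))"

text \<open>The coordinate functions are dual to the basis, so coefficients over \<zz>(x) are
  unique. This is the uniqueness half of the definite description in
  \<open>K_coeffs\<close>.\<close>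

lemma coord_x_expansion:
  assumes c: "c \<in> {..n} \<rightarrow> carrier Z.T" and j: "j \<le> n"
  shows "coord_x j (expansion c) = c j"
proof -
  have "coord_x j (expansion c) = (\<Oplus>\<^bsub>Z.T\<^esub> i\<in>{..n}. coord_x j
      (scalar_x \<iota> w p (c i) \<otimes>\<^bsub>Kx.T\<^esub> alg_K_elem \<iota> w p (K_basis w n A i)))"
    unfolding expansion_def using c by (intro coord_x_finsum) (simp_all add: Pi_iff)
  also have "\<dots> = (\<Oplus>\<^bsub>Z.T\<^esub> i\<in>{..n}. c i \<otimes>\<^bsub>Z.T\<^esub> Z.el (coord n A \<rho> j (K_basis w n A i)) 1)"
    using c by (intro Z.T.finsum_cong') (simp_all add: coord_x_scaled Pi_iff)
  also have "\<dots> = (\<Oplus>\<^bsub>Z.T\<^esub> i\<in>{..n}. if j = i then c i else \<zero>\<^bsub>Z.T\<^esub>)"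
    using c j by (intro Z.T.finsum_cong') (auto simp: coord_basis[OF p \<rho>] Pi_iff Z_el_consts)
  also have "\<dots> = c j"
    using c j by (intro Z.T.add.finprod_singleton) auto
  finally show ?thesis .
qed

text \<open>The existence half of that description. It is obtained for K(x) by assembling multiples
  of K^m with m \<le> n.\<close>

definition spanned where
  "spanned V \<longleftrightarrow> (\<exists>c\<in>{..n} \<rightarrow> carrier Z.T. V = expansion c)"

lemma spanned_add: "\<lbrakk>spanned V; spanned W\<rbrakk> \<Longrightarrow> spanned (V \<oplus>\<^bsub>Kx.T\<^esub> W)"
proof -
  assume "spanned V" "spanned W"
  then obtain c d where cd: "c \<in> {..n} \<rightarrow> carrier Z.T" "V = expansion c" "d \<in> {..n} \<rightarrow> carrier Z.T" "W = expansion d"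
    unfolding spanned_def by blast
  let ?b = "\<lambda>i. alg_K_elem \<iota> w p (K_basis w n A i)"
  have "V \<oplus>\<^bsub>Kx.T\<^esub> W = (\<Oplus>\<^bsub>Kx.T\<^esub> i\<in>{..n}. scalar_x \<iota> w p (c i) \<otimes>\<^bsub>Kx.T\<^esub> ?b i \<oplus>\<^bsub>Kx.T\<^esub> scalar_x \<iota> w p (d i) \<otimes>\<^bsub>Kx.T\<^esub> ?b i)"
    unfolding cd expansion_def using cd(1,3) by (intro Kx.T.finsum_addf[symmetric]) (simp_all add: Pi_iff)
  also have "\<dots> = expansion (\<lambda>i. c i \<oplus>\<^bsub>Z.T\<^esub> d i)"
    unfolding expansion_def using cd(1,3)
    by (intro Kx.T.finsum_cong') (simp_all add: sx_rules Kx.T.l_distr Pi_iff)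
  finally have "V \<oplus>\<^bsub>Kx.T\<^esub> W = expansion (\<lambda>i. c i \<oplus>\<^bsub>Z.T\<^esub> d i)" .
  then show ?thesis
    unfolding spanned_def using cd(1,3) by (intro bexI[of _ "\<lambda>i. c i \<oplus>\<^bsub>Z.T\<^esub> d i"]) auto
qed

lemma sx_zero [simp]: "scalar_x \<iota> w p \<zero>\<^bsub>Z.T\<^esub> = \<zero>\<^bsub>Kx.T\<^esub>"
  by (rule scalar_x.tmap_zero[folded scalar_x_def])

lemma spanned_basis:
  assumes "\<kappa> \<in> carrier Z.T" "i \<le> n"
  shows "spanned (scalar_x \<iota> w p \<kappa> \<otimes>\<^bsub>Kx.T\<^esub> alg_K_elem \<iota> w p (K_basis w n A i))"
proof -
  define c where "c l = (if i = l then \<kappa> else \<zero>\<^bsub>Z.T\<^esub>)" for l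
  have "expansion c = (\<Oplus>\<^bsub>Kx.T\<^esub> l\<in>{..n}. if i = l then scalar_x \<iota> w p \<kappa> \<otimes>\<^bsub>Kx.T\<^esub> alg_K_elem \<iota> w p (K_basis w n A l) else \<zero>\<^bsub>Kx.T\<^esub>)"
    unfolding expansion_def using assms by (intro Kx.T.finsum_cong') (auto simp: c_def)
  also have "\<dots> = scalar_x \<iota> w p \<kappa> \<otimes>\<^bsub>Kx.T\<^esub> alg_K_elem \<iota> w p (K_basis w n A i)"
    using assms by (intro Kx.T.add.finprod_singleton) auto
  finally show ?thesis
    unfolding spanned_def using assms by (intro bexI[of _ c]) (auto simp: c_def)
qed

lemma alg_K_elem_add: "\<lbrakk>a \<in> carrier (alg_K w p); b \<in> carrier (alg_K w p)\<rbrakk> \<Longrightarrow>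
    alg_K_elem \<iota> w p (a \<oplus>\<^bsub>hecke_p w p\<^esub> b) = alg_K_elem \<iota> w p a \<oplus>\<^bsub>Kx.T\<^esub> alg_K_elem \<iota> w p b"
  using Kx.el_add_left[of a b 1] by (simp add: alg_K_elem_def)

lemma spanned_sub_basis:
  assumes \<kappa>: "\<kappa> \<in> carrier Z.T"
  shows "m \<le> n \<Longrightarrow> spanned (scalar_x \<iota> w p \<kappa> \<otimes>\<^bsub>Kx.T\<^esub> alg_K_elem \<iota> w p (hecke_p_of w p (sub_basis m)))"
proof (induction m)
  case 0
  have "alg_K_elem \<iota> w p (hecke_p_of w p (sub_basis 0)) = \<zero>\<^bsub>Kx.T\<^esub>"
    using Kx.el_zero_left[of 1] by (simp add: sub_basis_def alg_K_elem_def)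
  then show ?case
    using spanned_basis[of "\<zero>\<^bsub>Z.T\<^esub>" 0] \<kappa> by simp
next
  case (Suc m)
  let ?K = "hecke_p_of w p (letter GenK ^ (n - 1 - m))"
  have mult: "scalar_p w p (A m) \<otimes>\<^bsub>hecke_p w p\<^esub> ?K \<in> carrier (alg_K w p)"
    using alg_K.m_closed[of "scalar_p w p (A m)" ?K] by simp
  have "alg_K_elem \<iota> w p (hecke_p_of w p (sub_basis (Suc m)))
    = alg_K_elem \<iota> w p (hecke_p_of w p (sub_basis m)) \<oplus>\<^bsub>Kx.T\<^esub> alg_K_elem \<iota> w p (scalar_p w p (A m) \<otimes>\<^bsub>hecke_p w p\<^esub> ?K)"
    using alg_K_elem_add[OF sub_basis_alg_K[of m] mult] by (simp add: sub_basis_def)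
  also have "alg_K_elem \<iota> w p (scalar_p w p (A m) \<otimes>\<^bsub>hecke_p w p\<^esub> ?K)
    = scalar_x \<iota> w p (Z.el (A m) 1) \<otimes>\<^bsub>Kx.T\<^esub> alg_K_elem \<iota> w p ?K"
    by (simp add: alg_K_elem_def Kx.el_mult)
  finally have "scalar_x \<iota> w p \<kappa> \<otimes>\<^bsub>Kx.T\<^esub> alg_K_elem \<iota> w p (hecke_p_of w p (sub_basis (Suc m)))
    = scalar_x \<iota> w p \<kappa> \<otimes>\<^bsub>Kx.T\<^esub> alg_K_elem \<iota> w p (hecke_p_of w p (sub_basis m))
     \<oplus>\<^bsub>Kx.T\<^esub> scalar_x \<iota> w p (\<kappa> \<otimes>\<^bsub>Z.T\<^esub> Z.el (A m) 1) \<otimes>\<^bsub>Kx.T\<^esub> alg_K_elem \<iota> w p ?K"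
    using \<kappa> by (simp add: Kx.T.r_distr sx_rules Kx.T.m_assoc)
  moreover have "?K = K_basis w n A (n - 1 - m)"
    using Suc.prems by (simp add: K_basis_eq[OF p \<rho>])
  ultimately show ?case
    using Suc spanned_basis[of "\<kappa> \<otimes>\<^bsub>Z.T\<^esub> Z.el (A m) 1" "n - 1 - m"] \<kappa> by (simp add: spanned_add)
qed

lemma spanned_power:
  assumes \<kappa>: "\<kappa> \<in> carrier Z.T" and "m \<le> n"
  shows "spanned (scalar_x \<iota> w p \<kappa> \<otimes>\<^bsub>Kx.T\<^esub> alg_K_elem \<iota> w p (hecke_p_of w p (letter GenK ^ m)))"
proof (cases "m < n")
  case True
  then show ?thesis using spanned_basis[OF \<kappa>, of m] by (simp add: K_basis_eq[OF p \<rho>])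
next
  case False
  have "hecke_p_of w p (letter GenK ^ m) = K_basis w n A n \<oplus>\<^bsub>hecke_p w p\<^esub> hecke_p_of w p (sub_basis n)"
    using False assms(2) unfolding K_basis_eq[OF p \<rho>] sub_basis_def by (simp flip: hecke_p_of_simps(2))
  then show ?thesis
    using spanned_add[OF spanned_basis[OF \<kappa>, of n] spanned_sub_basis[OF \<kappa>, of n]] \<kappa>
    by (simp add: alg_K_elem_add Kx.T.r_distr)
qed

lemma K_coeffs_eq:
  assumes "spanned V" "j \<le> n"
  shows "K_coeffs \<iota> w n A V j = coord_x j V"
proof -
  obtain c where c: "c \<in> {..n} \<rightarrow> carrier Z.T" "V = expansion c"
    using assms(1) unfolding spanned_def by blast
  \<comment> \<open>\<open>K_coeffs\<close> ranges over families that are \<open>undefined\<close>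
    outside {..n}, so the witness is restricted.\<close>
  have "expansion (restrict c {..n}) = expansion c"
    unfolding expansion_def using c(1) by (intro Kx.T.finsum_cong') (simp_all add: Pi_iff)
  then have r: "V = expansion (restrict c {..n})" using c(2) by simp
  have "K_coeffs \<iota> w n A V = (THE c. c \<in> {..n} \<rightarrow>\<^sub>E carrier Z.T \<and> V = expansion c)"
    unfolding K_coeffs_def alg_K_x_def expansion_def p[symmetric] ..
  also have "\<dots> = restrict c {..n}"
  proof (rule the_equality)
    show "restrict c {..n} \<in> {..n} \<rightarrow>\<^sub>E carrier Z.T \<and> V = expansion (restrict c {..n})"
      using c(1) r by auto
  next
    fix d assume d: "d \<in> {..n} \<rightarrow>\<^sub>E carrier Z.T \<and> V = expansion d"
    have "d i = restrict c {..n} i" for i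
    proof (cases "i \<le> n")
      case True
      have "d \<in> {..n} \<rightarrow> carrier Z.T" using d by blast
      with True show ?thesis
        using d c coord_x_expansion[of c i] coord_x_expansion[of d i] by simp
    next
      case False
      then show ?thesis using d by (auto simp: PiE_def extensional_def)
    qed
    then show "d = restrict c {..n}" by blast
  qed
  finally have "K_coeffs \<iota> w n A V = restrict c {..n}" .
  then show ?thesis
    using coord_x_expansion[OF c(1) assms(2)] c(2) assms(2) by simp
qed

theorem K_coeffs_K_x:
  assumes n: "n \<ge> 2"
  shows "K_coeffs \<iota> w n A (K_x \<iota> w n A \<xi> \<zeta>) (n - 1) = Z.el \<xi> var_x"
proof -
  define t where "t i = scalar_x \<iota> w p (phi \<iota> A \<xi> i) \<otimes>\<^bsub>Kx.T\<^esub> alg_K_elem \<iota> w p (hecke_p_of w p (letter GenK ^ (n - i)))" for i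
  define \<kappa> where "\<kappa> = (Z.el \<zeta> 1 \<ominus>\<^bsub>Z.T\<^esub> Z.el 1 (inverse var_x) \<otimes>\<^bsub>Z.T\<^esub> phi \<iota> A \<xi> n) \<otimes>\<^bsub>Z.T\<^esub> Z.el 1 (inverse (var_x - inverse var_x))"
  have \<kappa>: "\<kappa> \<in> carrier Z.T" by (simp add: \<kappa>_def)
  have t: "t i \<in> carrier Kx.T" for i by (simp add: t_def)
  have one: "scalar_x \<iota> w p \<kappa> = scalar_x \<iota> w p \<kappa> \<otimes>\<^bsub>Kx.T\<^esub> alg_K_elem \<iota> w p (hecke_p_of w p (letter GenK ^ 0))"
  proof -
    have "alg_K_elem \<iota> w p (hecke_p_of w p (letter GenK ^ 0)) = \<one>\<^bsub>Kx.T\<^esub>"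
      using Kx.one_T by (simp add: alg_K_elem_def)
    then show ?thesis using \<kappa> by (simp del: power_0)
  qed
  have K_x: "K_x \<iota> w n A \<xi> \<zeta> = (\<Oplus>\<^bsub>Kx.T\<^esub> i\<in>{0..<n}. t i) \<oplus>\<^bsub>Kx.T\<^esub> scalar_x \<iota> w p \<kappa>"
    unfolding K_x_def Let_def alg_K_x_def p[symmetric] t_def \<kappa>_def alg_K_power hecke_p_power ..
  have "spanned (\<Oplus>\<^bsub>Kx.T\<^esub> i\<in>{0..<m}. t i)" for m
  proof (induction m)
    case 0
    show ?case using spanned_basis[of "\<zero>\<^bsub>Z.T\<^esub>" 0] by simp
  next
    case (Suc m)
    have "spanned (t m)" unfolding t_def by (rule spanned_power) simp_all
    with Suc show ?case
      using t by (simp add: atLeast0_lessThan_Suc Kx.T.finsum_insert spanned_add)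
  qed
  then have "spanned (K_x \<iota> w n A \<xi> \<zeta>)"
    unfolding K_x by (subst one) (intro spanned_add spanned_power \<kappa>, simp_all)
  then have "K_coeffs \<iota> w n A (K_x \<iota> w n A \<xi> \<zeta>) (n - 1) = coord_x (n - 1) (K_x \<iota> w n A \<xi> \<zeta>)"
    by (rule K_coeffs_eq) simp
  also have "\<dots> = (\<Oplus>\<^bsub>Z.T\<^esub> i\<in>{0..<n}. coord_x (n - 1) (t i)) \<oplus>\<^bsub>Z.T\<^esub> coord_x (n - 1) (scalar_x \<iota> w p \<kappa>)"
    unfolding K_x using t \<kappa> by (simp add: coord_x_rules coord_x_finsum Kx.T.finsum_closed)
  \<comment> \<open>For n \<ge> 2 the index n - 1 is not 0, so K^0 has no component there.\<close>
  also have "coord_x (n - 1) (scalar_x \<iota> w p \<kappa>) = \<zero>\<^bsub>Z.T\<^esub>"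
    using n coord_K_power[OF p \<rho>, of 0 "n - 1"] \<kappa> by (subst one, subst coord_x_scaled) (simp_all add: Z_el_consts del: power_0)
  \<comment> \<open>K^n contributes A_0 through \<open>K~\<close>, K^(n-1) contributes 1, and lower
    powers nothing. The A_0 then cancels against \<phi>_1 = \<xi> x - A_0.\<close>
  also have "(\<Oplus>\<^bsub>Z.T\<^esub> i\<in>{0..<n}. coord_x (n - 1) (t i))
    = (\<Oplus>\<^bsub>Z.T\<^esub> i\<in>{0..<n}. phi \<iota> A \<xi> i \<otimes>\<^bsub>Z.T\<^esub> Z.el (if i = 0 then A 0 else if i = 1 then 1 else 0) 1)"
    using n by (intro Z.T.finsum_cong') (auto simp: t_def coord_x_scaled coord_K_power[OF p \<rho>])
  also have "{0..<n} = insert 0 (insert 1 {2..<n})" using n by auto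
  also have "(\<Oplus>\<^bsub>Z.T\<^esub> i\<in>\<dots>. phi \<iota> A \<xi> i \<otimes>\<^bsub>Z.T\<^esub> Z.el (if i = 0 then A 0 else if i = 1 then 1 else 0) 1)
    = Z.el (A 0) 1 \<oplus>\<^bsub>Z.T\<^esub> (phi \<iota> A \<xi> 1 \<oplus>\<^bsub>Z.T\<^esub> (\<Oplus>\<^bsub>Z.T\<^esub> i\<in>{2..<n}. \<zero>\<^bsub>Z.T\<^esub>))"
  proof -
    have "(\<Oplus>\<^bsub>Z.T\<^esub> i\<in>{2..<n}. phi \<iota> A \<xi> i \<otimes>\<^bsub>Z.T\<^esub> Z.el (if i = 0 then A 0 else if i = 1 then 1 else 0) 1)
        = (\<Oplus>\<^bsub>Z.T\<^esub> i\<in>{2..<n}. \<zero>\<^bsub>Z.T\<^esub>)"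
      by (intro Z.T.finsum_cong') (auto simp: Z_el_consts)
    with Z_el_consts show ?thesis
      by (simp add: Z.T.finsum_insert del: phi.simps(2))
  qed
  also have "\<dots> \<oplus>\<^bsub>Z.T\<^esub> \<zero>\<^bsub>Z.T\<^esub> = Z.el \<xi> var_x"
    by (simp add: a_minus_def Z.T.a_lcomm Z.T.r_neg)
  finally show ?thesis .
qed

end

end

text \<open>Principality is stated for \<xi> \<noteq> 0: the coefficient of K^(n-1) is \<xi>
  \<otimes> x, which is zero when \<xi> = 0, and the solution is then small.\<close>

theorem theorem3p7:
  fixes \<iota> :: "'k::field_char_0 \<Rightarrow> 'z::comm_ring_1"
    and q :: 'k and n :: nat and A :: "nat \<Rightarrow> 'z" and \<xi> \<zeta> :: 'z
  assumes "\<iota> \<in> ring_hom ring_of_type_algebra ring_of_type_algebra"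
    and "q \<noteq> 0" and "q \<noteq> 1" and "q \<noteq> -1"
    and "n \<ge> 2"
    and "\<zeta> * \<xi> = poly (cyc_poly n A) 0"
  shows "is_solution \<iota> (\<iota> (q - inverse q)) (cyc_poly n A) (K_x \<iota> (\<iota> (q - inverse q)) n A \<xi> \<zeta>)
    \<and> (\<xi> \<noteq> 0 \<longrightarrow> is_principal_solution \<iota> (\<iota> (q - inverse q)) n A
                    (K_x \<iota> (\<iota> (q - inverse q)) n A \<xi> \<zeta>))"
proof -
  have ring: "\<iota> (a + b) = \<iota> a + \<iota> b" "\<iota> (a * b) = \<iota> a * \<iota> b" "\<iota> 1 = 1" for a b
    using ring_hom_add[OF assms(1), of a b] ring_hom_mult[OF assms(1), of a b] ring_hom_one[OF assms(1)]
    by simp_all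
  \<comment> \<open>The quadratic relation has the roots q and -q^-1 in k; the image of q serves as
    the scalar by which R acts in the model.\<close>
  have "q * q = (q - inverse q) * q + 1"
    using assms(2) by (simp add: algebra_simps)
  then have \<rho>: "\<iota> q * \<iota> q = \<iota> (q - inverse q) * \<iota> q + 1"
    by (simp flip: ring)
  have sol: "is_solution \<iota> (\<iota> (q - inverse q)) (cyc_poly n A) (K_x \<iota> (\<iota> (q - inverse q)) n A \<xi> \<zeta>)"
    by (rule hecke_spectral.K_x_solution[OF refl assms(6)])
  moreover have "K_coeffs \<iota> (\<iota> (q - inverse q)) n A (K_x \<iota> (\<iota> (q - inverse q)) n A \<xi> \<zeta>) (n - 1)
      = tensor_elem ring_of_type_algebra \<iota> const_x \<xi> var_x"
    by (rule hecke_spectral.K_coeffs_K_x[OF refl \<rho> assms(5)])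
  then have "is_principal_solution \<iota> (\<iota> (q - inverse q)) n A (K_x \<iota> (\<iota> (q - inverse q)) n A \<xi> \<zeta>)" if "\<xi> \<noteq> 0"
    unfolding is_principal_solution_def
    using sol assms(5) hecke_spectral.el_nonzero[OF assms(1) that]
    by simp
  ultimately show ?thesis by blast
qed

end
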